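(* There is a constant $c>0$ such that the following holds. Let $G$ be an Eulerian solid subgraph of the triangular lattice with $f$ bounded faces. Then the mixing time of the face-reversal Markov chain $\mathcal{M}$ on $EO(G)$ satisfies $\tau_{\mathcal{M}}(\epsilon)\le c\, f^6\log\epsilon^{-1}$ for $0<\epsilon<1$, i.e. $\tau_{\mathcal{M}}(\epsilon)\in O(f^6\log\epsilon^{-1})$.
   Context: Triangular lattice: vertices $v_{i,j}$ ($i,j\in\mathbb{Z}$), edges $\{v_{i,j},v_{i+1,j}\}$, $\{v_{i,j},v_{i,j+1}\}$, $\{v_{i,j},v_{i+1,j-1}\}$, standard planar embedding with triangular bounded faces. A solid subgraph is obtained by choosing a cycle of the lattice as boundary and taking this cycle together with everything in its interior. A graph is Eulerian if all degrees are even; $EO(G)$ is the set of Eulerian orientations (in-degree equals out-degree at every vertex). A bounded face is directed in an orientation if its boundary edges form a directed cycle. One step of the face-reversal chain $\mathcal{M}$ from state $X$: with probability $1/2$ set $X'=X$; otherwise choose a bounded face $F$ uniformly at random; if $F$ is directed in $X$, obtain $X'$ by reversing all edges of $F$, otherwise set $X'=X$. This chain is ergodic with uniform stationary distribution $\pi$ on $EO(G)$. The mixing time is $\tau(\epsilon)=\max_{x}\min\{t:\|P^t(x,\cdot)-\pi\|_{TV}\le\epsilon\}$, with $\|\rho-\mu\|_{TV}=\sup_A|\rho(A)-\mu(A)|$.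
   Formalization: The bound proved is c f^6 ⌈ln(1/ε)⌉ instead of c f^6 log(1/ε); without the ceiling it fails for ε near 1 (triangle of side n, ε = 1 − 2/|EO(G)|). For ε ≤ δ < 1 the stated bound follows with a constant depending on δ. *)

theory Defs
  imports "HOL-Analysis.Analysis" "HOL-Probability.Probability"
begin

section \<open>The triangular lattice and its solid subgraphs\<close>

text \<open>The vertex \<open>v\<^sub>i\<^sub>,\<^sub>j\<close> is the pair \<open>(i, j)\<close>. Undirected edges are two-element sets of
  vertices, directed edges are ordered pairs.\<close>

type_synonym vertex = "int \<times> int"

record graph =
  verts :: "vertex set"
  edges :: "vertex set set"

definition lattice_edges :: "vertex set set" where
  "lattice_edges =
     (\<Union>i j. {{(i, j), (i + 1, j)}, {(i, j), (i, j + 1)}, {(i, j), (i + 1, j - 1)}})"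

text \<open>The standard embedding, with unit equilateral triangles as faces.\<close>

definition embed :: "vertex \<Rightarrow> complex" where
  "embed v = of_int (fst v) + of_int (snd v) * cis (pi / 3)"

definition edge_segment :: "vertex set \<Rightarrow> complex set" where
  "edge_segment e = convex hull (embed ` e)"

definition cycle_arcs :: "vertex list \<Rightarrow> (vertex \<times> vertex) set" where
  "cycle_arcs vs = set (zip vs (rotate1 vs))"

definition lattice_cycle :: "vertex list \<Rightarrow> bool" where
  "lattice_cycle vs \<longleftrightarrow>
     distinct vs \<and> 3 \<le> length vs \<and> (\<forall>(u, v) \<in> cycle_arcs vs. {u, v} \<in> lattice_edges)"

definition cycle_curve :: "vertex list \<Rightarrow> complex set" where
  "cycle_curve vs = (\<Union>(u, v) \<in> cycle_arcs vs. edge_segment {u, v})"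

definition solid_graph :: "vertex list \<Rightarrow> graph" where
  "solid_graph vs =
     (let R = cycle_curve vs \<union> inside (cycle_curve vs)
      in \<lparr>verts = {v. embed v \<in> R}, edges = {e \<in> lattice_edges. edge_segment e \<subseteq> R}\<rparr>)"

definition solid_subgraph :: "graph \<Rightarrow> bool" where
  "solid_subgraph G \<longleftrightarrow> (\<exists>vs. lattice_cycle vs \<and> G = solid_graph vs)"

definition degree :: "graph \<Rightarrow> vertex \<Rightarrow> nat" where
  "degree G v = card {e \<in> edges G. v \<in> e}"

definition eulerian :: "graph \<Rightarrow> bool" where
  "eulerian G \<longleftrightarrow> (\<forall>v \<in> verts G. even (degree G v))"

section \<open>Bounded faces\<close>

definition drawing :: "graph \<Rightarrow> complex set" where
  "drawing G = embed ` verts G \<union> (\<Union>e \<in> edges G. edge_segment e)"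

definition bounded_faces :: "graph \<Rightarrow> complex set set" where
  "bounded_faces G = {F \<in> components (- drawing G). bounded F}"

definition face_edges :: "graph \<Rightarrow> complex set \<Rightarrow> vertex set set" where
  "face_edges G F = {e \<in> edges G. edge_segment e \<subseteq> frontier F}"

section \<open>Eulerian orientations\<close>

type_synonym orientation = "(vertex \<times> vertex) set"

definition orientations :: "graph \<Rightarrow> orientation set" where
  "orientations G =
     {X. (\<forall>(u, v) \<in> X. {u, v} \<in> edges G) \<and>
         (\<forall>u v. {u, v} \<in> edges G \<longrightarrow> ((u, v) \<in> X) \<noteq> ((v, u) \<in> X))}"

definition EO :: "graph \<Rightarrow> orientation set" where
  "EO G =
     {X \<in> orientations G. \<forall>v \<in> verts G. card {u. (u, v) \<in> X} = card {w. (v, w) \<in> X}}"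

definition face_arcs :: "graph \<Rightarrow> orientation \<Rightarrow> complex set \<Rightarrow> (vertex \<times> vertex) set" where
  "face_arcs G X F = {(u, v) \<in> X. {u, v} \<in> face_edges G F}"

definition directed_face :: "graph \<Rightarrow> orientation \<Rightarrow> complex set \<Rightarrow> bool" where
  "directed_face G X F \<longleftrightarrow>
     (\<exists>vs. distinct vs \<and> 3 \<le> length vs \<and> face_arcs G X F = cycle_arcs vs)"

definition reverse_face :: "graph \<Rightarrow> orientation \<Rightarrow> complex set \<Rightarrow> orientation" where
  "reverse_face G X F = (X - face_arcs G X F) \<union> (face_arcs G X F)\<inverse>"

section \<open>The face-reversal chain and its mixing time\<close>

definition face_step :: "graph \<Rightarrow> orientation \<Rightarrow> orientation pmf" where
  "face_step G X =
     bind_pmf (bernoulli_pmf (1 / 2)) (\<lambda>stay.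
       if stay then return_pmf X
       else map_pmf (\<lambda>F. if directed_face G X F then reverse_face G X F else X)
              (pmf_of_set (bounded_faces G)))"

definition chain_power :: "('s \<Rightarrow> 's pmf) \<Rightarrow> nat \<Rightarrow> 's \<Rightarrow> 's pmf" where
  "chain_power P t x = ((\<lambda>p. bind_pmf p P) ^^ t) (return_pmf x)"

definition tv_dist :: "'s pmf \<Rightarrow> 's pmf \<Rightarrow> real" where
  "tv_dist p q = (SUP A. \<bar>measure_pmf.prob p A - measure_pmf.prob q A\<bar>)"

definition mixing_time :: "'s set \<Rightarrow> ('s \<Rightarrow> 's pmf) \<Rightarrow> 's pmf \<Rightarrow> real \<Rightarrow> nat" where
  "mixing_time S P \<pi> \<epsilon> = (MAX x \<in> S. LEAST t. tv_dist (chain_power P t x) \<pi> \<le> \<epsilon>)"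

text \<open>Pitfall: no bound \<open>\<tau>(\<epsilon>) \<le> c f\<^sup>6 ln (1/\<epsilon>)\<close> can hold uniformly for \<open>\<epsilon>\<close> up to 1. The upward faces of a
  triangle of side \<open>n\<close> (with \<open>f = n\<^sup>2\<close>) partition its edges, so it has \<open>N \<ge> 2 powr (f/2)\<close> Eulerian
  orientations; for \<open>\<epsilon> = 1 - 2/N\<close> the mixing time is at least 1, as the distance at time 0 is \<open>1 - 1/N\<close>,
  while \<open>f\<^sup>6 ln (1/\<epsilon>)\<close> tends to 0. Bounds valid for all \<open>0 < \<epsilon> < 1\<close> therefore use \<open>\<lceil>ln (1/\<epsilon>)\<rceil>\<close>, as in
  the path coupling theorem; for \<open>\<epsilon>\<close> bounded away from 1 this agrees with \<open>ln (1/\<epsilon>)\<close> up to a constant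
  factor.\<close>

definition face_mixing_time :: "graph \<Rightarrow> real \<Rightarrow> nat" where
  "face_mixing_time G \<epsilon> = mixing_time (EO G) (face_step G) (pmf_of_set (EO G)) \<epsilon>"

end

theory Submission
  imports Defs "HOL-Library.Z2"
begin

text \<open>
  Eulerian orientations correspond to height functions on the triangles inside the boundary cycle:
  heights of adjacent triangles differ by one, and the outer face has height zero. Reversing a
  directed face flips a local maximum into a local minimum or conversely.

  The single-flip chain is compared with a chain that moves whole towers, that is, straight strips
  of triangles in which each element has the next one as its only higher neighbour. For tower
  probabilities proportional to 1/2 (length 1) and 1/(6k) (length k at least 2) the expected area
  between two coupled height functions does not increase; since the area also fluctuates, a concave
  function of it contracts, which bounds the spectral gap of the tower chain below by a constant
  times \<open>f\<^sup>-\<^sup>4\<close>. Heights, and hence tower lengths, are of order at most the square root of \<open>f\<close>, so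
  decomposing towers into single flips costs a factor of order \<open>f\<close>. The resulting gap of order
  \<open>f\<^sup>-\<^sup>5\<close> and \<open>ln |EO(G)| = O(f)\<close> give the bound.
\<close>

section \<open>Reversible chains\<close>

subsection \<open>Log-convex sequences\<close>

lemma log_convex_ratio_le:
  fixes m :: "nat \<Rightarrow> real"
  assumes nonneg: "\<And>t. 0 \<le> m t"
    and log_convex: "\<And>t. (m (Suc t))\<^sup>2 \<le> m t * m (Suc (Suc t))"
    and pos: "0 < m 0"
  shows "m 1 / m 0 * m t \<le> m (Suc t)"
proof (induction t)
  case 0
  then show ?case using pos by simp
next
  case (Suc t)
  show ?case
  proof (cases "m (Suc t) = 0")
    case True
    then show ?thesis using nonneg by simp
  next
    case False
    then have Suc_pos: "0 < m (Suc t)" using nonneg[of "Suc t"] by linarith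
    have "m t \<noteq> 0" using log_convex[of t] Suc_pos by auto
    then have t_pos: "0 < m t" using nonneg[of t] by linarith
    have "m 1 / m 0 * m t * m (Suc t) \<le> m (Suc t) * m (Suc t)"
      using Suc Suc_pos by (intro mult_right_mono) auto
    also have "\<dots> \<le> m t * m (Suc (Suc t))"
      using log_convex[of t] by (simp add: power2_eq_square)
    finally have "m t * (m 1 / m 0 * m (Suc t)) \<le> m t * m (Suc (Suc t))"
      by (simp only: mult_ac)
    then show ?thesis using t_pos by (simp only: mult_le_cancel_left_pos)
  qed
qed

lemma log_convex_geometric_lower_bound:
  fixes m :: "nat \<Rightarrow> real"
  assumes nonneg: "\<And>t. 0 \<le> m t"
    and log_convex: "\<And>t. (m (Suc t))\<^sup>2 \<le> m t * m (Suc (Suc t))"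
    and pos: "0 < m 0"
  shows "(m 1 / m 0) ^ t * m 0 \<le> m t"
proof (induction t)
  case (Suc t)
  have "m 1 / m 0 * ((m 1 / m 0) ^ t * m 0) \<le> m 1 / m 0 * m t"
    using Suc nonneg by (intro mult_left_mono) auto
  also have "\<dots> \<le> m (Suc t)"
    using nonneg log_convex pos by (rule log_convex_ratio_le)
  finally show ?case by (simp only: power_Suc mult.assoc)
qed simp

lemma exponential_growth_rate_le:
  fixes a b q r :: real
  assumes bound: "\<And>t. r ^ t * a \<le> b * q ^ t" and a: "0 < a" and q: "0 \<le> q"
  shows "r \<le> q"
proof (rule ccontr)
  assume "\<not> r \<le> q"
  then have ratio: "0 < r" "\<bar>q / r\<bar> < 1" using q by (auto simp: divide_simps)
  have "a \<le> b * (q / r) ^ t" for t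
    using bound[of t] ratio(1) by (simp add: power_divide field_simps)
  moreover have "(\<lambda>t. b * (q / r) ^ t) \<longlonglongrightarrow> b * 0"
    using ratio by (intro tendsto_mult_left LIMSEQ_power_zero) auto
  ultimately have "a \<le> 0" by (metis LIMSEQ_le_const mult_zero_right)
  then show False using a by simp
qed

lemma log_convex_first_ratio_le:
  fixes m :: "nat \<Rightarrow> real"
  assumes nonneg: "\<And>t. 0 \<le> m t"
    and log_convex: "\<And>t. (m (Suc t))\<^sup>2 \<le> m t * m (Suc (Suc t))"
    and decay: "\<And>t. m t \<le> b * q ^ t" and q: "0 \<le> q"
  shows "m 1 \<le> q * m 0"
proof (cases "m 0 = 0")
  case True
  then show ?thesis using log_convex[of 0] by simp
next
  case False
  then have pos: "0 < m 0" using nonneg[of 0] by linarith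
  have "(m 1 / m 0) ^ t * m 0 \<le> b * q ^ t" for t
    using log_convex_geometric_lower_bound[OF nonneg log_convex pos] decay by (rule order_trans)
  then have "m 1 / m 0 \<le> q" using pos q by (rule exponential_growth_rate_le)
  then show ?thesis using pos by (simp add: field_simps)
qed

subsection \<open>Dirichlet forms and spectral gaps\<close>

lemma iterate_log_convex:
  fixes P :: "('s \<Rightarrow> real) \<Rightarrow> 's \<Rightarrow> real" and g :: "'s \<Rightarrow> real"
  assumes sym: "\<And>f g. (\<Sum>x\<in>\<Omega>. f x * P g x) = (\<Sum>x\<in>\<Omega>. P f x * g x)"
  shows "(\<Sum>x\<in>\<Omega>. ((P ^^ Suc t) g x)\<^sup>2)\<^sup>2 \<le>
    (\<Sum>x\<in>\<Omega>. ((P ^^ t) g x)\<^sup>2) * (\<Sum>x\<in>\<Omega>. ((P ^^ Suc (Suc t)) g x)\<^sup>2)"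
proof -
  have "(\<Sum>x\<in>\<Omega>. ((P ^^ Suc t) g x)\<^sup>2) = (\<Sum>x\<in>\<Omega>. P ((P ^^ t) g) x * P ((P ^^ t) g) x)"
    by (simp add: power2_eq_square)
  also have "\<dots> = (\<Sum>x\<in>\<Omega>. (P ^^ t) g x * (P ^^ Suc (Suc t)) g x)"
    by (simp add: sym)
  finally show ?thesis by (metis Cauchy_Schwarz_ineq_sum)
qed

lemma rayleigh_le_decay_rate:
  fixes P :: "('s \<Rightarrow> real) \<Rightarrow> 's \<Rightarrow> real" and g :: "'s \<Rightarrow> real"
  assumes sym: "\<And>f g. (\<Sum>x\<in>\<Omega>. f x * P g x) = (\<Sum>x\<in>\<Omega>. P f x * g x)"
    and decay: "\<And>t x. x \<in> \<Omega> \<Longrightarrow> \<bar>(P ^^ t) g x\<bar> \<le> B * \<rho> ^ t" and \<rho>: "0 \<le> \<rho>"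
  shows "(\<Sum>x\<in>\<Omega>. g x * P g x) \<le> \<rho> * (\<Sum>x\<in>\<Omega>. (g x)\<^sup>2)"
proof -
  define m where "m t = (\<Sum>x\<in>\<Omega>. ((P ^^ t) g x)\<^sup>2)" for t
  have nonneg: "0 \<le> m t" for t by (simp add: m_def sum_nonneg)
  have log_convex: "(m (Suc t))\<^sup>2 \<le> m t * m (Suc (Suc t))" for t
    unfolding m_def by (rule iterate_log_convex[OF sym])
  have "m t \<le> (real (card \<Omega>) * B\<^sup>2) * (\<rho>\<^sup>2) ^ t" for t
  proof -
    have "((P ^^ t) g x)\<^sup>2 \<le> B\<^sup>2 * (\<rho>\<^sup>2) ^ t" if "x \<in> \<Omega>" for x
    proof -
      have "\<bar>(P ^^ t) g x\<bar>\<^sup>2 \<le> (B * \<rho> ^ t)\<^sup>2"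
        using decay[OF that] by (intro power_mono) auto
      then show ?thesis by (simp add: power_mult_distrib power_mult[symmetric] mult.commute)
    qed
    then have "m t \<le> real (card \<Omega>) * (B\<^sup>2 * (\<rho>\<^sup>2) ^ t)"
      unfolding m_def by (intro sum_bounded_above)
    then show ?thesis by simp
  qed
  then have "m 1 \<le> \<rho>\<^sup>2 * m 0"
    by (intro log_convex_first_ratio_le[where m = m, OF nonneg log_convex]) simp_all
  have "(\<Sum>x\<in>\<Omega>. g x * P g x)\<^sup>2 \<le> m 0 * m 1"
    unfolding m_def using Cauchy_Schwarz_ineq_sum[of g "P g" \<Omega>] by simp
  also have "\<dots> \<le> m 0 * (\<rho>\<^sup>2 * m 0)"
    using \<open>m 1 \<le> \<rho>\<^sup>2 * m 0\<close> nonneg by (rule mult_left_mono)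
  also have "\<dots> = (\<rho> * m 0)\<^sup>2"
    by (simp add: power2_eq_square algebra_simps)
  finally have "(\<Sum>x\<in>\<Omega>. g x * P g x) \<le> \<rho> * m 0"
    using \<rho> nonneg[of 0] by (meson mult_nonneg_nonneg power2_le_imp_le)
  then show ?thesis by (simp add: m_def)
qed

text \<open>From \<open>x\<close>, the chain applies \<open>move i\<close> with probability \<open>weight i x / Z\<close>.\<close>

locale reversible_moves =
  fixes \<Omega> :: "'s set" and I :: "'i set"
    and weight :: "'i \<Rightarrow> 's \<Rightarrow> real" and move :: "'i \<Rightarrow> 's \<Rightarrow> 's" and Z :: real
  assumes detailed_balance: "\<And>\<psi> :: 's \<Rightarrow> 's \<Rightarrow> real.
    (\<Sum>x\<in>\<Omega>. \<Sum>i\<in>I. weight i x * \<psi> x (move i x)) = (\<Sum>x\<in>\<Omega>. \<Sum>i\<in>I. weight i x * \<psi> (move i x) x)"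
begin

definition transition :: "('s \<Rightarrow> real) \<Rightarrow> 's \<Rightarrow> real" where
  "transition g x = g x + (\<Sum>i\<in>I. weight i x * (g (move i x) - g x)) / Z"

definition dirichlet :: "('s \<Rightarrow> real) \<Rightarrow> real" where
  "dirichlet g = (\<Sum>x\<in>\<Omega>. \<Sum>i\<in>I. weight i x * (g x - g (move i x))\<^sup>2) / (2 * Z)"

definition spectral_gap :: "real \<Rightarrow> bool" where
  "spectral_gap \<gamma> \<longleftrightarrow> (\<forall>g. (\<Sum>x\<in>\<Omega>. g x) = 0 \<longrightarrow> \<gamma> * (\<Sum>x\<in>\<Omega>. (g x)\<^sup>2) \<le> dirichlet g)"

lemma spectral_gapD: "spectral_gap \<gamma> \<Longrightarrow> (\<Sum>x\<in>\<Omega>. g x) = 0 \<Longrightarrow> \<gamma> * (\<Sum>x\<in>\<Omega>. (g x)\<^sup>2) \<le> dirichlet g"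
  by (simp add: spectral_gap_def)

lemma sum_mult_transition:
  "(\<Sum>x\<in>\<Omega>. f x * transition g x) = (\<Sum>x\<in>\<Omega>. f x * g x) -
     (\<Sum>x\<in>\<Omega>. \<Sum>i\<in>I. weight i x * ((f x - f (move i x)) * (g x - g (move i x)))) / (2 * Z)"
proof -
  define flux where "flux = (\<Sum>x\<in>\<Omega>. \<Sum>i\<in>I. weight i x * (f x * (g (move i x) - g x)))"
  define energy where
    "energy = (\<Sum>x\<in>\<Omega>. \<Sum>i\<in>I. weight i x * ((f x - f (move i x)) * (g x - g (move i x))))"
  have "flux = (\<Sum>x\<in>\<Omega>. \<Sum>i\<in>I. weight i x * (f (move i x) * (g x - g (move i x))))"
    unfolding flux_def by (rule detailed_balance)
  then have "2 * flux = flux + (\<Sum>x\<in>\<Omega>. \<Sum>i\<in>I. weight i x * (f (move i x) * (g x - g (move i x))))"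
    by simp
  also have "\<dots> = - energy"
    unfolding flux_def energy_def sum.distrib[symmetric] sum_negf[symmetric]
    by (intro sum.cong refl) (simp add: algebra_simps)
  finally have "flux / Z = - energy / (2 * Z)"
    by (metis mult_divide_mult_cancel_left zero_neq_numeral)
  have "(\<Sum>x\<in>\<Omega>. f x * transition g x) =
      (\<Sum>x\<in>\<Omega>. f x * g x + (\<Sum>i\<in>I. weight i x * (f x * (g (move i x) - g x))) / Z)"
    unfolding transition_def distrib_left times_divide_eq_right sum_distrib_left
    by (simp only: mult.left_commute)
  also have "\<dots> = (\<Sum>x\<in>\<Omega>. f x * g x) + flux / Z"
    by (simp only: sum.distrib sum_divide_distrib flux_def)
  also have "\<dots> = (\<Sum>x\<in>\<Omega>. f x * g x) - energy / (2 * Z)"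
    using \<open>flux / Z = - energy / (2 * Z)\<close> by simp
  finally show ?thesis by (simp only: energy_def)
qed

lemma transition_symmetric: "(\<Sum>x\<in>\<Omega>. f x * transition g x) = (\<Sum>x\<in>\<Omega>. transition f x * g x)"
  using sum_mult_transition[of f g] sum_mult_transition[of g f] by (simp add: mult.commute)

lemma sum_transition: "(\<Sum>x\<in>\<Omega>. transition g x) = (\<Sum>x\<in>\<Omega>. g x)"
  using sum_mult_transition[of "\<lambda>_. 1" g] by simp

lemma dirichlet_eq: "dirichlet g = (\<Sum>x\<in>\<Omega>. (g x)\<^sup>2) - (\<Sum>x\<in>\<Omega>. g x * transition g x)"
  by (simp add: sum_mult_transition dirichlet_def power2_eq_square)

end

lemma sum_involution:
  fixes \<psi> :: "'s \<Rightarrow> 's \<Rightarrow> real"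
  assumes "\<And>x. x \<in> \<Omega> \<Longrightarrow> \<phi> x \<in> \<Omega>" "\<And>x. x \<in> \<Omega> \<Longrightarrow> \<phi> (\<phi> x) = x"
  shows "(\<Sum>x\<in>\<Omega>. \<psi> x (\<phi> x)) = (\<Sum>x\<in>\<Omega>. \<psi> (\<phi> x) x)"
  by (rule sum.reindex_bij_witness[of _ \<phi> \<phi>]) (auto simp: assms)

lemma reversible_moves_involutions:
  fixes move :: "'i \<Rightarrow> 's \<Rightarrow> 's"
  assumes "\<And>i x. i \<in> I \<Longrightarrow> x \<in> \<Omega> \<Longrightarrow> move i x \<in> \<Omega>"
    and "\<And>i x. i \<in> I \<Longrightarrow> x \<in> \<Omega> \<Longrightarrow> move i (move i x) = x"
  shows "reversible_moves \<Omega> I (\<lambda>_ _. 1) move"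
proof
  fix \<psi> :: "'s \<Rightarrow> 's \<Rightarrow> real"
  have "(\<Sum>x\<in>\<Omega>. \<Sum>i\<in>I. \<psi> x (move i x)) = (\<Sum>i\<in>I. \<Sum>x\<in>\<Omega>. \<psi> x (move i x))"
    by (rule sum.swap)
  also have "\<dots> = (\<Sum>i\<in>I. \<Sum>x\<in>\<Omega>. \<psi> (move i x) x)"
    by (intro sum.cong refl sum_involution) (auto simp: assms)
  also have "\<dots> = (\<Sum>x\<in>\<Omega>. \<Sum>i\<in>I. \<psi> (move i x) x)"
    by (rule sum.swap)
  finally show "(\<Sum>x\<in>\<Omega>. \<Sum>i\<in>I. 1 * \<psi> x (move i x)) = (\<Sum>x\<in>\<Omega>. \<Sum>i\<in>I. 1 * \<psi> (move i x) x)"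
    by simp
qed

subsection \<open>Couplings whose distance fluctuates\<close>

locale fluctuating_coupling = reversible_moves \<Omega> I weight move Z
  for \<Omega> :: "'s set" and I :: "'i set" and weight move Z +
  fixes W :: "'w set" and first second :: "'s \<Rightarrow> 's \<Rightarrow> 'w \<Rightarrow> 's"
    and d :: "'s \<Rightarrow> 's \<Rightarrow> real" and D v :: real
  assumes finite_states: "finite \<Omega>" and finite_coins: "finite W" and nonempty_coins: "W \<noteq> {}"
    and coupled_states: "\<And>x y \<omega>. x \<in> \<Omega> \<Longrightarrow> y \<in> \<Omega> \<Longrightarrow> \<omega> \<in> W \<Longrightarrow> first x y \<omega> \<in> \<Omega> \<and> second x y \<omega> \<in> \<Omega>"
    and marginals: "\<And>g x y. x \<in> \<Omega> \<Longrightarrow> y \<in> \<Omega> \<Longrightarrow>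
      transition g x - transition g y = (\<Sum>\<omega>\<in>W. g (first x y \<omega>) - g (second x y \<omega>)) / card W"
    and dist_self: "\<And>x. d x x = 0"
    and dist_ge_one: "\<And>x y. x \<in> \<Omega> \<Longrightarrow> y \<in> \<Omega> \<Longrightarrow> x \<noteq> y \<Longrightarrow> 1 \<le> d x y"
    and dist_le: "\<And>x y. x \<in> \<Omega> \<Longrightarrow> y \<in> \<Omega> \<Longrightarrow> d x y \<le> D"
    and drift_nonpos: "\<And>x y. x \<in> \<Omega> \<Longrightarrow> y \<in> \<Omega> \<Longrightarrow> (\<Sum>\<omega>\<in>W. d (first x y \<omega>) (second x y \<omega>) - d x y) \<le> 0"
    and fluctuation: "\<And>x y. x \<in> \<Omega> \<Longrightarrow> y \<in> \<Omega> \<Longrightarrow> x \<noteq> y \<Longrightarrow>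
      v * card W \<le> (\<Sum>\<omega>\<in>W. (d (first x y \<omega>) (second x y \<omega>) - d x y)\<^sup>2)"
    and D_pos: "0 < D" and v_nonneg: "0 \<le> v" and v_le: "v \<le> D\<^sup>2"
begin

definition concave_dist :: "'s \<Rightarrow> 's \<Rightarrow> real" where
  "concave_dist x y = d x y * (2 * D - d x y)"

definition \<rho> :: real where
  "\<rho> = 1 - v / D\<^sup>2"

lemma rho_nonneg: "0 \<le> \<rho>"
  using v_le D_pos by (simp add: \<rho>_def)

lemma concave_dist_le: "concave_dist x y \<le> D\<^sup>2"
  using zero_le_power2[of "D - d x y"]
  by (simp add: concave_dist_def power2_eq_square algebra_simps)

lemma sum_concave_dist_le:
  assumes x: "x \<in> \<Omega>" and y: "y \<in> \<Omega>"
  shows "(\<Sum>\<omega>\<in>W. concave_dist (first x y \<omega>) (second x y \<omega>)) \<le> card W * (\<rho> * concave_dist x y)"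
proof -
  define \<delta> where "\<delta> \<omega> = d (first x y \<omega>) (second x y \<omega>) - d x y" for \<omega>
  let ?a = "2 * (D - d x y)"
  have "concave_dist (first x y \<omega>) (second x y \<omega>) = concave_dist x y + ?a * \<delta> \<omega> - (\<delta> \<omega>)\<^sup>2" for \<omega>
    by (simp add: concave_dist_def \<delta>_def power2_eq_square algebra_simps)
  then have expand: "(\<Sum>\<omega>\<in>W. concave_dist (first x y \<omega>) (second x y \<omega>)) =
      card W * concave_dist x y + ?a * (\<Sum>\<omega>\<in>W. \<delta> \<omega>) - (\<Sum>\<omega>\<in>W. (\<delta> \<omega>)\<^sup>2)"
    by (simp only: sum.distrib sum_subtractf sum_distrib_left sum_constant)
  have drift: "?a * (\<Sum>\<omega>\<in>W. \<delta> \<omega>) \<le> 0"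
    using dist_le[OF x y] drift_nonpos[OF x y] by (intro mult_nonneg_nonpos) (auto simp: \<delta>_def)
  show ?thesis
  proof (cases "x = y")
    case True
    have "0 \<le> (\<Sum>\<omega>\<in>W. (\<delta> \<omega>)\<^sup>2)" by (intro sum_nonneg) auto
    moreover have "concave_dist x y = 0" using True by (simp add: concave_dist_def dist_self)
    ultimately show ?thesis using expand drift by simp
  next
    case False
    have "v / D\<^sup>2 * concave_dist x y \<le> v / D\<^sup>2 * D\<^sup>2"
      using v_nonneg concave_dist_le by (intro mult_left_mono) auto
    then have "v / D\<^sup>2 * concave_dist x y \<le> v" using D_pos by simp
    then have "card W * (v / D\<^sup>2 * concave_dist x y) \<le> card W * v"
      by (intro mult_left_mono) auto
    then have "card W * (v / D\<^sup>2 * concave_dist x y) \<le> (\<Sum>\<omega>\<in>W. (\<delta> \<omega>)\<^sup>2)"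
      using fluctuation[OF x y False] by (simp add: \<delta>_def mult.commute)
    moreover have "card W * (\<rho> * concave_dist x y) =
        card W * concave_dist x y - card W * (v / D\<^sup>2 * concave_dist x y)"
      unfolding \<rho>_def by (simp only: left_diff_distrib right_diff_distrib mult_1)
    ultimately show ?thesis using expand drift by linarith
  qed
qed

lemma iterate_difference_le:
  assumes initial: "\<And>x y. x \<in> \<Omega> \<Longrightarrow> y \<in> \<Omega> \<Longrightarrow> \<bar>g x - g y\<bar> \<le> B * concave_dist x y" and B: "0 \<le> B"
    and "x \<in> \<Omega>" "y \<in> \<Omega>"
  shows "\<bar>(transition ^^ t) g x - (transition ^^ t) g y\<bar> \<le> B * \<rho> ^ t * concave_dist x y"
  using assms(3,4)
proof (induction t arbitrary: x y)
  case 0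
  then show ?case using initial by simp
next
  case (Suc t)
  define G where "G = (transition ^^ t) g"
  have card_W: "0 < real (card W)" using finite_coins nonempty_coins by (simp add: card_gt_0_iff)
  have "\<bar>transition G x - transition G y\<bar> \<le> (\<Sum>\<omega>\<in>W. \<bar>G (first x y \<omega>) - G (second x y \<omega>)\<bar>) / card W"
    using card_W by (simp add: marginals[OF Suc.prems] divide_right_mono)
  also have "\<dots> \<le> (\<Sum>\<omega>\<in>W. B * \<rho> ^ t * concave_dist (first x y \<omega>) (second x y \<omega>)) / card W"
    using Suc.IH coupled_states[OF Suc.prems] unfolding G_def
    by (intro divide_right_mono sum_mono) auto
  also have "\<dots> \<le> B * \<rho> ^ t * (card W * (\<rho> * concave_dist x y)) / card W"
    unfolding sum_distrib_left[symmetric] using B rho_nonneg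
    by (intro divide_right_mono mult_left_mono sum_concave_dist_le[OF Suc.prems]) auto
  also have "\<dots> = B * \<rho> ^ Suc t * concave_dist x y" using card_W by simp
  finally show ?case by (simp add: G_def)
qed

lemma difference_le_concave_dist:
  assumes x: "x \<in> \<Omega>" and y: "y \<in> \<Omega>"
  shows "\<bar>g x - g y\<bar> \<le> 2 * (\<Sum>z\<in>\<Omega>. \<bar>g z\<bar>) * concave_dist x y"
proof (cases "x = y")
  case False
  let ?B = "2 * (\<Sum>z\<in>\<Omega>. \<bar>g z\<bar>)"
  have "1 * 1 \<le> d x y * (2 * D - d x y)"
    using dist_ge_one[OF x y False] dist_le[OF x y] by (intro mult_mono) auto
  then have "?B * 1 \<le> ?B * concave_dist x y"
    unfolding concave_dist_def by (intro mult_left_mono) (auto simp: sum_nonneg)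
  moreover have "\<bar>g x\<bar> \<le> (\<Sum>z\<in>\<Omega>. \<bar>g z\<bar>)" "\<bar>g y\<bar> \<le> (\<Sum>z\<in>\<Omega>. \<bar>g z\<bar>)"
    using x y finite_states by (auto intro!: member_le_sum)
  ultimately show ?thesis by linarith
qed (simp add: concave_dist_def dist_self)

lemma iterate_decay:
  assumes mean: "(\<Sum>x\<in>\<Omega>. g x) = 0" and x: "x \<in> \<Omega>"
  shows "\<bar>(transition ^^ t) g x\<bar> \<le> (2 * (\<Sum>z\<in>\<Omega>. \<bar>g z\<bar>) * D\<^sup>2) * \<rho> ^ t"
proof -
  let ?B = "2 * (\<Sum>z\<in>\<Omega>. \<bar>g z\<bar>)" and ?G = "(transition ^^ t) g"
  have card_pos: "0 < real (card \<Omega>)" using x finite_states by (auto simp: card_gt_0_iff)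
  have "(\<Sum>y\<in>\<Omega>. ?G y) = 0"
    by (induction t) (auto simp: mean sum_transition)
  then have "card \<Omega> * \<bar>?G x\<bar> = \<bar>\<Sum>y\<in>\<Omega>. ?G x - ?G y\<bar>"
    by (simp add: sum_subtractf abs_mult)
  also have "\<dots> \<le> (\<Sum>y\<in>\<Omega>. \<bar>?G x - ?G y\<bar>)" by (rule sum_abs)
  also have "\<dots> \<le> (\<Sum>y\<in>\<Omega>. ?B * D\<^sup>2 * \<rho> ^ t)"
  proof (rule sum_mono)
    fix y assume y: "y \<in> \<Omega>"
    have "\<bar>?G x - ?G y\<bar> \<le> ?B * \<rho> ^ t * concave_dist x y"
      by (intro iterate_difference_le difference_le_concave_dist x y) (auto simp: sum_nonneg)
    also have "\<dots> \<le> ?B * \<rho> ^ t * D\<^sup>2"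
      using rho_nonneg concave_dist_le by (intro mult_left_mono) (auto simp: sum_nonneg)
    finally show "\<bar>?G x - ?G y\<bar> \<le> ?B * D\<^sup>2 * \<rho> ^ t" by (simp add: mult_ac)
  qed
  finally have "card \<Omega> * \<bar>?G x\<bar> \<le> card \<Omega> * (?B * D\<^sup>2 * \<rho> ^ t)" by simp
  then show ?thesis using card_pos by (simp only: mult_le_cancel_left_pos)
qed

theorem spectral_gap_ge: "spectral_gap (v / D\<^sup>2)"
  unfolding spectral_gap_def
proof (intro allI impI)
  fix g :: "'s \<Rightarrow> real" assume "(\<Sum>x\<in>\<Omega>. g x) = 0"
  then have "(\<Sum>x\<in>\<Omega>. g x * transition g x) \<le> \<rho> * (\<Sum>x\<in>\<Omega>. (g x)\<^sup>2)"
    by (intro rayleigh_le_decay_rate[OF transition_symmetric iterate_decay rho_nonneg])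
  then show "v / D\<^sup>2 * (\<Sum>x\<in>\<Omega>. (g x)\<^sup>2) \<le> dirichlet g"
    by (simp add: dirichlet_eq \<rho>_def left_diff_distrib)
qed

end

subsection \<open>Mixing of lazy chains of involutions\<close>

lemma tv_dist_le_sum:
  fixes p q :: "'s pmf"
  assumes fin: "finite \<Omega>" and "set_pmf p \<subseteq> \<Omega>" "set_pmf q \<subseteq> \<Omega>"
  shows "tv_dist p q \<le> (\<Sum>x\<in>\<Omega>. \<bar>pmf p x - pmf q x\<bar>)"
proof -
  have prob_eq: "measure_pmf.prob r A = (\<Sum>x\<in>\<Omega> \<inter> A. pmf r x)"
    if "set_pmf r \<subseteq> \<Omega>" for r :: "'s pmf" and A
  proof -
    have "measure_pmf.prob r A = measure_pmf.prob r (\<Omega> \<inter> A)"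
      using that by (intro measure_prob_cong_0) (auto simp: set_pmf_eq)
    also have "\<dots> = (\<Sum>x\<in>\<Omega> \<inter> A. pmf r x)"
      using fin by (intro measure_measure_pmf_finite) auto
    finally show ?thesis .
  qed
  show ?thesis unfolding tv_dist_def
  proof (rule cSUP_least)
    fix A :: "'s set"
    have "\<bar>measure_pmf.prob p A - measure_pmf.prob q A\<bar> = \<bar>\<Sum>x\<in>\<Omega> \<inter> A. pmf p x - pmf q x\<bar>"
      by (simp add: prob_eq assms sum_subtractf)
    also have "\<dots> \<le> (\<Sum>x\<in>\<Omega> \<inter> A. \<bar>pmf p x - pmf q x\<bar>)" by (rule sum_abs)
    also have "\<dots> \<le> (\<Sum>x\<in>\<Omega>. \<bar>pmf p x - pmf q x\<bar>)"
      using fin by (intro sum_mono2) auto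
    finally show "\<bar>measure_pmf.prob p A - measure_pmf.prob q A\<bar> \<le> \<dots>" .
  qed simp
qed

locale lazy_involution_chain =
  fixes \<Omega> :: "'s set" and I :: "'i set" and move :: "'i \<Rightarrow> 's \<Rightarrow> 's" and K :: "'s \<Rightarrow> 's pmf"
  assumes finite_states: "finite \<Omega>"
    and finite_moves: "finite I" and nonempty_moves: "I \<noteq> {}"
    and closed: "\<And>i x. i \<in> I \<Longrightarrow> x \<in> \<Omega> \<Longrightarrow> move i x \<in> \<Omega>"
    and involution: "\<And>i x. i \<in> I \<Longrightarrow> x \<in> \<Omega> \<Longrightarrow> move i (move i x) = x"
    and step: "\<And>x. x \<in> \<Omega> \<Longrightarrow> K x =
      bind_pmf (bernoulli_pmf (1 / 2))
        (\<lambda>stay. if stay then return_pmf x else map_pmf (\<lambda>i. move i x) (pmf_of_set I))"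
begin

lemma card_moves_pos: "0 < real (card I)"
  using finite_moves nonempty_moves by (simp add: card_gt_0_iff)

sublocale reversible_moves \<Omega> I "\<lambda>_ _. 1" move "2 * real (card I)"
  by (rule reversible_moves_involutions[OF closed involution])

lemma transition_lazy: "transition g x = (g x + (\<Sum>i\<in>I. g (move i x)) / card I) / 2"
  unfolding transition_def using card_moves_pos by (simp add: sum_subtractf field_simps)

lemma sum_sq_average_le: "(\<Sum>x\<in>\<Omega>. ((\<Sum>i\<in>I. g (move i x)) / card I)\<^sup>2) \<le> (\<Sum>x\<in>\<Omega>. (g x)\<^sup>2)"
proof -
  have "((\<Sum>i\<in>I. g (move i x)) / card I)\<^sup>2 \<le> (\<Sum>i\<in>I. (g (move i x))\<^sup>2) / card I" for x
  proof -
    have "(\<Sum>i\<in>I. g (move i x))\<^sup>2 \<le> card I * (\<Sum>i\<in>I. (g (move i x))\<^sup>2)"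
      using Cauchy_Schwarz_ineq_sum[of "\<lambda>_. 1" "\<lambda>i. g (move i x)" I] by simp
    then show ?thesis
      using card_moves_pos by (simp add: power_divide field_simps power2_eq_square)
  qed
  then have "(\<Sum>x\<in>\<Omega>. ((\<Sum>i\<in>I. g (move i x)) / card I)\<^sup>2) \<le> (\<Sum>x\<in>\<Omega>. (\<Sum>i\<in>I. (g (move i x))\<^sup>2) / card I)"
    by (intro sum_mono)
  also have "\<dots> = (\<Sum>i\<in>I. \<Sum>x\<in>\<Omega>. (g (move i x))\<^sup>2) / card I"
    by (simp only: sum_divide_distrib[symmetric] sum.swap[of _ \<Omega> I])
  also have "\<dots> = (\<Sum>x\<in>\<Omega>. (g x)\<^sup>2)"
    using card_moves_pos sum_involution[of \<Omega> "move _" "\<lambda>_ y. (g y)\<^sup>2"] closed involution by simp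
  finally show ?thesis .
qed

lemma sum_sq_transition_le: "(\<Sum>x\<in>\<Omega>. (transition g x)\<^sup>2) \<le> (\<Sum>x\<in>\<Omega>. g x * transition g x)"
proof -
  let ?a = "\<lambda>x. (\<Sum>i\<in>I. g (move i x)) / card I"
  have square: "b * ((b + a) / 2) - ((b + a) / 2)\<^sup>2 = (b\<^sup>2 - a\<^sup>2) / 4" for a b :: real
    by (simp add: power2_eq_square field_simps)
  have "(\<Sum>x\<in>\<Omega>. g x * transition g x) - (\<Sum>x\<in>\<Omega>. (transition g x)\<^sup>2)
      = (\<Sum>x\<in>\<Omega>. ((g x)\<^sup>2 - (?a x)\<^sup>2) / 4)"
    unfolding sum_subtractf[symmetric] transition_lazy square by (rule refl)
  also have "\<dots> = ((\<Sum>x\<in>\<Omega>. (g x)\<^sup>2) - (\<Sum>x\<in>\<Omega>. (?a x)\<^sup>2)) / 4"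
    by (simp only: sum_divide_distrib[symmetric] sum_subtractf)
  finally show ?thesis using sum_sq_average_le[of g] by simp
qed

lemma transition_contraction:
  assumes "spectral_gap \<gamma>" "(\<Sum>x\<in>\<Omega>. g x) = 0"
  shows "(\<Sum>x\<in>\<Omega>. (transition g x)\<^sup>2) \<le> (1 - \<gamma>) * (\<Sum>x\<in>\<Omega>. (g x)\<^sup>2)"
  using spectral_gapD[OF assms] sum_sq_transition_le[of g] unfolding dirichlet_eq left_diff_distrib
  by linarith

lemma set_pmf_step: "x \<in> \<Omega> \<Longrightarrow> set_pmf (K x) \<subseteq> \<Omega>"
  using closed[of _ x]
  by (auto simp: step set_bind_pmf set_pmf_of_set[OF nonempty_moves finite_moves] split: if_splits)

lemma set_pmf_chain: "x \<in> \<Omega> \<Longrightarrow> set_pmf (chain_power K t x) \<subseteq> \<Omega>"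
proof (induction t)
  case (Suc t)
  then show ?case using set_pmf_step by (force simp: chain_power_def set_bind_pmf)
qed (simp add: chain_power_def)

lemma pmf_step:
  assumes "x \<in> \<Omega>"
  shows "pmf (K x) y = of_bool (x = y) / 2 + (\<Sum>i\<in>I. of_bool (move i x = y)) / (2 * card I)"
proof -
  have "pmf (map_pmf (\<lambda>i. move i x) (pmf_of_set I)) y = (\<Sum>i\<in>I. of_bool (move i x = y)) / card I"
    using finite_moves nonempty_moves
    by (simp add: pmf_map measure_pmf_of_set vimage_def Int_def of_bool_def sum.If_cases
        conj_commute)
  then show ?thesis
    by (simp add: step[OF assms] pmf_bind pmf_return indicator_def of_bool_def)
qed

lemma sum_of_bool_move:
  assumes "i \<in> I" "y \<in> \<Omega>"
  shows "(\<Sum>z\<in>\<Omega>. g z * of_bool (move i z = y)) = (g (move i y) :: real)"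
proof -
  have "(\<Sum>z\<in>\<Omega>. g z * of_bool (move i z = y)) = (\<Sum>z\<in>\<Omega>. if move i y = z then g z else 0)"
    using assms involution closed by (intro sum.cong refl) (auto simp: of_bool_def)
  also have "\<dots> = g (move i y)"
    using assms closed finite_states by (subst sum.delta') auto
  finally show ?thesis .
qed

lemma pmf_chain_Suc:
  assumes "x \<in> \<Omega>" "y \<in> \<Omega>"
  shows "pmf (chain_power K (Suc t) x) y = transition (pmf (chain_power K t x)) y"
proof -
  let ?\<mu> = "chain_power K t x"
  have "pmf (chain_power K (Suc t) x) y = measure_pmf.expectation ?\<mu> (\<lambda>z. pmf (K z) y)"
    by (simp add: chain_power_def pmf_bind)
  also have "\<dots> = (\<Sum>z\<in>\<Omega>. pmf ?\<mu> z * pmf (K z) y)"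
    using finite_states set_pmf_chain[OF assms(1)]
    by (subst integral_measure_pmf[of \<Omega>]) (auto simp: mult.commute)
  also have "\<dots> = (\<Sum>z\<in>\<Omega>. pmf ?\<mu> z * of_bool (z = y) / 2 +
      (\<Sum>i\<in>I. pmf ?\<mu> z * of_bool (move i z = y)) / (2 * card I))"
    by (intro sum.cong refl) (simp add: pmf_step distrib_left sum_distrib_left)
  also have "\<dots> = (\<Sum>z\<in>\<Omega>. pmf ?\<mu> z * of_bool (z = y)) / 2
      + (\<Sum>i\<in>I. \<Sum>z\<in>\<Omega>. pmf ?\<mu> z * of_bool (move i z = y)) / (2 * card I)"
    by (simp only: sum.distrib sum_divide_distrib[symmetric] sum.swap[of _ \<Omega> I])
  also have "(\<Sum>z\<in>\<Omega>. pmf ?\<mu> z * of_bool (z = y)) = pmf ?\<mu> y"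
    using assms(2) finite_states by (simp add: of_bool_def if_distrib sum.delta cong: if_cong)
  also have "(\<Sum>i\<in>I. \<Sum>z\<in>\<Omega>. pmf ?\<mu> z * of_bool (move i z = y)) = (\<Sum>i\<in>I. pmf ?\<mu> (move i y))"
    using assms(2) by (simp add: sum_of_bool_move)
  finally show ?thesis by (simp add: transition_lazy add_divide_distrib)
qed

definition deviation :: "'s \<Rightarrow> nat \<Rightarrow> 's \<Rightarrow> real" where
  "deviation x t y = pmf (chain_power K t x) y - 1 / card \<Omega>"

lemma sum_deviation:
  assumes "x \<in> \<Omega>"
  shows "(\<Sum>y\<in>\<Omega>. deviation x t y) = 0"
proof -
  have "real (card \<Omega>) \<noteq> 0" using assms finite_states by auto
  then show ?thesis
    using sum_pmf_eq_1[OF finite_states set_pmf_chain[OF assms]]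
    by (simp add: deviation_def sum_subtractf)
qed

lemma deviation_Suc:
  assumes "x \<in> \<Omega>" "y \<in> \<Omega>"
  shows "deviation x (Suc t) y = transition (deviation x t) y"
  using card_moves_pos
  by (simp add: deviation_def pmf_chain_Suc[OF assms] transition_lazy sum_subtractf
      diff_divide_distrib
      add_divide_distrib)

lemma sum_sq_deviation_le:
  assumes gap: "spectral_gap \<gamma>" and x: "x \<in> \<Omega>"
  shows "(\<Sum>y\<in>\<Omega>. (deviation x t y)\<^sup>2) \<le> exp (- \<gamma> * real t)"
proof (induction t)
  case 0
  define n where "n = real (card \<Omega>)"
  have n: "0 < n" using x finite_states by (auto simp: n_def card_gt_0_iff)
  have "(deviation x 0 y)\<^sup>2 = of_bool (y = x) * (1 - 2 / n) + 1 / n\<^sup>2" for y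
    by (auto simp: deviation_def chain_power_def n_def power2_diff power_divide)
  then have "(\<Sum>y\<in>\<Omega>. (deviation x 0 y)\<^sup>2) = 1 - 2 / n + n * (1 / n\<^sup>2)"
    using x finite_states
    by (simp add: sum.distrib sum_distrib_right[symmetric] n_def of_bool_def sum.delta)
  also have "\<dots> \<le> 1" using n by (simp add: power2_eq_square field_simps)
  finally show ?case by simp
next
  case (Suc t)
  have "(\<Sum>y\<in>\<Omega>. (deviation x (Suc t) y)\<^sup>2) = (\<Sum>y\<in>\<Omega>. (transition (deviation x t) y)\<^sup>2)"
    by (intro sum.cong refl) (simp add: deviation_Suc x)
  also have "\<dots> \<le> (1 - \<gamma>) * (\<Sum>y\<in>\<Omega>. (deviation x t y)\<^sup>2)"
    by (rule transition_contraction[OF gap sum_deviation[OF x]])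
  also have "\<dots> \<le> exp (- \<gamma>) * (\<Sum>y\<in>\<Omega>. (deviation x t y)\<^sup>2)"
    using exp_ge_add_one_self[of "- \<gamma>"] by (intro mult_right_mono sum_nonneg) auto
  also have "\<dots> \<le> exp (- \<gamma>) * exp (- \<gamma> * real t)"
    using Suc by simp
  finally show ?case by (simp add: exp_add[symmetric] algebra_simps)
qed

lemma tv_dist_chain_le:
  assumes gap: "spectral_gap \<gamma>" and x: "x \<in> \<Omega>"
  shows "tv_dist (chain_power K t x) (pmf_of_set \<Omega>) \<le> sqrt (card \<Omega>) * exp (- \<gamma> * real t / 2)"
proof -
  have nonempty: "\<Omega> \<noteq> {}" using x by blast
  have "tv_dist (chain_power K t x) (pmf_of_set \<Omega>)
      \<le> (\<Sum>y\<in>\<Omega>. \<bar>pmf (chain_power K t x) y - pmf (pmf_of_set \<Omega>) y\<bar>)"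
    using x finite_states set_pmf_of_set[OF nonempty finite_states]
    by (intro tv_dist_le_sum set_pmf_chain) auto
  also have "\<dots> = (\<Sum>y\<in>\<Omega>. \<bar>deviation x t y\<bar>)"
    by (intro sum.cong refl) (simp add: deviation_def pmf_of_set[OF nonempty finite_states])
  also have "\<dots> \<le> sqrt (card \<Omega> * (\<Sum>y\<in>\<Omega>. (deviation x t y)\<^sup>2))"
    using Cauchy_Schwarz_ineq_sum[of "\<lambda>_. 1" "\<lambda>y. \<bar>deviation x t y\<bar>" \<Omega>]
    by (intro real_le_rsqrt) simp
  also have "\<dots> \<le> sqrt (card \<Omega> * exp (- \<gamma> * real t))"
    by (intro real_sqrt_le_mono mult_left_mono sum_sq_deviation_le[OF gap x]) simp
  also have "\<dots> = sqrt (card \<Omega>) * exp (- \<gamma> * real t / 2)"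
  proof -
    have "exp (- \<gamma> * real t) = (exp (- \<gamma> * real t / 2))\<^sup>2"
      by (simp add: power2_eq_square exp_add[symmetric])
    then show ?thesis by (simp add: real_sqrt_mult)
  qed
  finally show ?thesis .
qed

theorem mixing_time_le:
  assumes gap: "spectral_gap \<gamma>" and \<gamma>: "0 < \<gamma>" and \<epsilon>: "0 < \<epsilon>" "\<epsilon> \<le> 1" and nonempty: "\<Omega> \<noteq> {}"
  shows "real (mixing_time \<Omega> K (pmf_of_set \<Omega>) \<epsilon>) \<le> (ln (card \<Omega>) + 2 * ln (1 / \<epsilon>)) / \<gamma> + 1"
proof -
  define b where "b = (ln (card \<Omega>) + 2 * ln (1 / \<epsilon>)) / \<gamma>"
  define t where "t = nat \<lceil>b\<rceil>"
  have card_pos: "1 \<le> real (card \<Omega>)"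
    using finite_states nonempty by (simp add: Suc_le_eq card_gt_0_iff)
  have "0 \<le> b" using card_pos \<epsilon> \<gamma> by (simp add: b_def)
  then have t: "b \<le> t" "t \<le> b + 1" unfolding t_def by linarith+
  have "tv_dist (chain_power K t x) (pmf_of_set \<Omega>) \<le> \<epsilon>" if x: "x \<in> \<Omega>" for x
  proof -
    have "ln (card \<Omega>) + 2 * ln (1 / \<epsilon>) \<le> \<gamma> * t"
      using t(1) \<gamma> by (simp add: b_def divide_le_eq mult.commute)
    then have exponent: "ln (card \<Omega>) / 2 - \<gamma> * t / 2 \<le> ln \<epsilon>"
      using \<epsilon> by (simp add: ln_div)
    have "sqrt (card \<Omega>) = exp (ln (card \<Omega>) / 2)"
      using card_pos by (simp add: ln_sqrt[symmetric])
    then have "sqrt (card \<Omega>) * exp (- \<gamma> * t / 2) = exp (ln (card \<Omega>) / 2 - \<gamma> * t / 2)"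
      by (simp add: exp_add[symmetric])
    also have "\<dots> \<le> exp (ln \<epsilon>)" using exponent by simp
    finally show ?thesis using tv_dist_chain_le[OF gap x, of t] \<epsilon> by simp
  qed
  then have "mixing_time \<Omega> K (pmf_of_set \<Omega>) \<epsilon> \<le> t"
    unfolding mixing_time_def using nonempty finite_states by (auto intro!: Max.boundedI Least_le)
  then show ?thesis using t(2) unfolding b_def by linarith
qed

end

section \<open>Height functions and towers\<close>

subsection \<open>Triangles and strips\<close>

datatype colour = Red | Green | Blue

lemma UNIV_colour: "(UNIV :: colour set) = {Red, Green, Blue}"
  using colour.exhaust by auto

instance colour :: finite
  by standard (simp add: UNIV_colour)

lemma ex_third_colour: "\<exists>c :: colour. c \<noteq> a \<and> c \<noteq> b"
  by (metis colour.distinct(1,3,5))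

lemma distinct_colours_exhaust:
  assumes "c \<noteq> d" "d \<noteq> e" "c \<noteq> (e :: colour)"
  shows "a = c \<or> a = d \<or> a = e"
  using assms by (cases a; cases c; cases d; cases e) auto

datatype tri = Tri (tcol: int) (trow: int) (upward: bool)

text \<open>\<open>Tri i j True\<close> has the corners \<open>(i, j), (i + 1, j), (i, j + 1)\<close> and \<open>Tri i j False\<close> the corners
  \<open>(i + 1, j + 1), (i, j + 1), (i + 1, j)\<close>. The colour of an edge is its direction, so straight strips of
  triangles alternate between two colours and a turn around a vertex cycles through all three.\<close>

fun nbr :: "colour \<Rightarrow> tri \<Rightarrow> tri" where
  "nbr Red (Tri i j u) = Tri i j (\<not> u)"
| "nbr Green (Tri i j u) = Tri (if u then i - 1 else i + 1) j (\<not> u)"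
| "nbr Blue (Tri i j u) = Tri i (if u then j - 1 else j + 1) (\<not> u)"

lemma nbr_nbr [simp]: "nbr c (nbr c T) = T"
  by (cases T; cases c) auto

lemma nbr_eq_iff_eq_nbr: "nbr c T = U \<longleftrightarrow> T = nbr c U"
  by (metis nbr_nbr)

lemma nbr_eq_nbr [simp]: "nbr c T = nbr d T \<longleftrightarrow> c = d"
  by (cases T; cases c; cases d) auto

lemma upward_nbr [simp]: "upward (nbr c T) = (\<not> upward T)"
  by (cases T; cases c) auto

lemma nbr_neq [simp]: "nbr c T \<noteq> T" "T \<noteq> nbr c T"
  by (metis upward_nbr)+

lemma nbr_hexagon:
  assumes "a \<noteq> b" "b \<noteq> c" "a \<noteq> c"
  shows "nbr c (nbr b (nbr a (nbr c (nbr b (nbr a T))))) = T"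
  using assms by (cases T; cases a; cases b; cases c) auto

lemma tri_upward_cases:
  obtains (upward) i j where "T = Tri i j True" | (downward) i j where "T = nbr c (Tri i j True)"
proof (cases "upward T")
  case True
  then show thesis using upward by (cases T) auto
next
  case False
  then obtain i j where "nbr c T = Tri i j True" by (cases "nbr c T") (metis upward_nbr tri.sel(3))
  then show thesis using downward by (metis nbr_nbr)
qed

definition alt :: "colour \<Rightarrow> colour \<Rightarrow> nat \<Rightarrow> colour" where
  "alt a b m = (if even m then a else b)"

primrec strip :: "colour \<Rightarrow> colour \<Rightarrow> tri \<Rightarrow> nat \<Rightarrow> tri" where
  "strip a b E 0 = E"
| "strip a b E (Suc m) = nbr (alt a b m) (strip a b E m)"

lemma strip_reverse:
  assumes "m \<le> k"
  shows "strip (alt a b (k + 1)) (alt a b k) (strip a b E k) m = strip a b E (k - m)"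
  using assms
proof (induction m)
  case (Suc m)
  then have "k - m = Suc (k - Suc m)" by simp
  moreover have "alt (alt a b (k + 1)) (alt a b k) m = alt a b (k - Suc m)"
    using Suc.prems by (auto simp: alt_def)
  ultimately show ?case using Suc by simp
qed simp

lemma strip_left_cancel: "strip a b E m = strip a b E' m \<Longrightarrow> E = E'"
proof (induction m)
  case (Suc m)
  then have "strip a b E m = strip a b E' m" by (metis nbr_nbr strip.simps(2))
  then show ?case by (rule Suc.IH)
qed simp

subsection \<open>Height functions\<close>

type_synonym height = "tri \<Rightarrow> int"

abbreviation signs :: "int set" where
  "signs \<equiv> {1, - 1}"

definition scale :: "int \<Rightarrow> height \<Rightarrow> height" where
  "scale s h = (\<lambda>T. s * h T)"

lemma scale_one [simp]: "scale 1 h = h"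
  by (simp add: scale_def)

lemma scale_scale: "s \<in> signs \<Longrightarrow> scale s (scale s h) = h"
  by (auto simp: scale_def)

definition lower :: "int \<Rightarrow> tri set \<Rightarrow> height \<Rightarrow> height" where
  "lower s A h = (\<lambda>T. if T \<in> A then h T - 2 * s else h T)"

lemma lower_empty [simp]: "lower s {} h = h"
  by (simp add: lower_def)

lemma lower_singleton: "lower s {T} h = h(T := h T - 2 * s)"
  by (auto simp: lower_def)

lemma lower_eq_scale: "s \<in> signs \<Longrightarrow> lower s A h = scale s (lower 1 A (scale s h))"
  by (auto simp: lower_def scale_def)

lemma lower_uminus_lower [simp]: "lower (- s) A (lower s A h) = h"
  by (auto simp: lower_def)

lemma lower_left_cancel: "lower s A g = lower s A h \<Longrightarrow> g = h"
  by (metis lower_uminus_lower)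

text \<open>A local maximum for \<open>s = 1\<close> and a local minimum for \<open>s = - 1\<close>.\<close>

definition local_extremum :: "int \<Rightarrow> height \<Rightarrow> tri \<Rightarrow> bool" where
  "local_extremum s h T \<longleftrightarrow> (\<forall>c. h (nbr c T) = h T - s)"

lemma local_extremumD: "local_extremum s h T \<Longrightarrow> h (nbr c T) = h T - s"
  by (simp add: local_extremum_def)

lemma local_extremum_flipped: "local_extremum s h T \<Longrightarrow> local_extremum (- s) (h(T := h T - 2 * s)) T"
  by (simp add: local_extremum_def)

definition flip_at :: "tri \<Rightarrow> height \<Rightarrow> height" where
  "flip_at T h = (if local_extremum 1 h T then h(T := h T - 2)
     else if local_extremum (- 1) h T then h(T := h T + 2) else h)"

lemma flip_at_extremum:
  assumes "local_extremum s h T" "s \<in> signs"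
  shows "flip_at T h = h(T := h T - 2 * s)"
proof -
  have "\<not> local_extremum 1 h T" if "local_extremum (- 1) h T"
    using local_extremumD[OF that, of Red] local_extremumD[of 1 h T Red] by auto
  then show ?thesis using assms by (auto simp: flip_at_def)
qed

lemma flip_at_cases:
  obtains (extremum) s where "s \<in> signs" "local_extremum s h T" "flip_at T h = h(T := h T - 2 * s)"
  | (fixed) "\<not> local_extremum 1 h T" "\<not> local_extremum (- 1) h T" "flip_at T h = h"
proof (cases "\<exists>s\<in>signs. local_extremum s h T")
  case True
  then show thesis using extremum flip_at_extremum by blast
next
  case False
  then show thesis using fixed by (simp add: flip_at_def)
qed

lemma flip_at_flip_at: "flip_at T (flip_at T h) = h"
proof (cases rule: flip_at_cases[of h T])
  case (extremum s)
  then have "flip_at T (h(T := h T - 2 * s))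
      = (h(T := h T - 2 * s))(T := (h(T := h T - 2 * s)) T - 2 * (- s))"
    using local_extremum_flipped by (intro flip_at_extremum) auto
  then show ?thesis using extremum by simp
qed simp

locale region =
  fixes S :: "tri set"
  assumes finite_S: "finite S"
begin

definition heights :: "height set" where
  "heights = {h. (\<forall>T. T \<notin> S \<longrightarrow> h T = 0) \<and> (\<forall>T\<in>S. \<forall>c. \<bar>h (nbr c T) - h T\<bar> = 1)}"

lemma heights_zero: "h \<in> heights \<Longrightarrow> T \<notin> S \<Longrightarrow> h T = 0"
  by (simp add: heights_def)

lemma heights_neq_in_S: "g \<in> heights \<Longrightarrow> h \<in> heights \<Longrightarrow> g T \<noteq> h T \<Longrightarrow> T \<in> S"
  using heights_zero by metis

lemma heights_step: "h \<in> heights \<Longrightarrow> T \<in> S \<Longrightarrow> h (nbr c T) = h T + 1 \<or> h (nbr c T) = h T - 1"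
  unfolding heights_def by (smt (verit) mem_Collect_eq)

lemma heights_lipschitz:
  assumes "h \<in> heights"
  shows "\<bar>h (nbr c T) - h T\<bar> \<le> 1"
proof -
  consider (inside) "T \<in> S" | (nbr_inside) "nbr c T \<in> S" | (outside) "T \<notin> S" "nbr c T \<notin> S" by blast
  then show ?thesis
  proof cases
    case inside
    then show ?thesis using heights_step[OF assms, of T c] by auto
  next
    case nbr_inside
    then show ?thesis using heights_step[OF assms, of "nbr c T" c] by auto
  next
    case outside
    then show ?thesis using heights_zero[OF assms] by simp
  qed
qed

lemma scale_heights: "h \<in> heights \<Longrightarrow> s \<in> signs \<Longrightarrow> scale s h \<in> heights"
  by (auto simp: heights_def scale_def abs_minus_commute)

lemma flip_extremum_heights:
  assumes h: "h \<in> heights" and T: "T \<in> S" and s: "s \<in> signs" and ext: "local_extremum s h T"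
  shows "h(T := h T - 2 * s) \<in> heights"
  unfolding heights_def
proof (intro CollectI conjI allI impI ballI)
  fix U assume "U \<notin> S"
  then show "(h(T := h T - 2 * s)) U = 0" using T heights_zero[OF h] by auto
next
  fix U c assume U: "U \<in> S"
  consider "U = T" | "U = nbr c T" "U \<noteq> T" | "U \<noteq> T" "nbr c U \<noteq> T"
    using nbr_eq_iff_eq_nbr by blast
  then show "\<bar>(h(T := h T - 2 * s)) (nbr c U) - (h(T := h T - 2 * s)) U\<bar> = 1"
    using heights_step[OF h U, of c] local_extremumD[OF ext, of c] s by cases auto
qed

lemma flip_at_heights: "h \<in> heights \<Longrightarrow> T \<in> S \<Longrightarrow> flip_at T h \<in> heights"
  by (cases rule: flip_at_cases[of h T]) (auto simp only: flip_extremum_heights)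

lemma nbr_closed_subset_empty:
  assumes sub: "B \<subseteq> S" and closed: "\<And>T c. T \<in> B \<Longrightarrow> nbr c T \<in> B"
  shows "B = {}"
proof (rule ccontr)
  assume nonempty: "B \<noteq> {}"
  define pos :: "tri \<Rightarrow> int" where "pos T = 2 * tcol T + (if upward T then 0 else 1)" for T
  have fin: "finite (pos ` B)" using sub finite_S finite_subset by blast
  have "Max (pos ` B) \<in> pos ` B" using fin nonempty by (intro Max_in) auto
  then obtain T where T: "T \<in> B" "pos T = Max (pos ` B)" by (metis imageE)
  define c where "c = (if upward T then Red else Green)"
  have "pos (nbr c T) = pos T + 1" by (cases T) (auto simp: pos_def c_def)
  moreover have "pos (nbr c T) \<le> Max (pos ` B)" using closed[OF T(1)] fin by simp
  ultimately show False using T by simp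
qed

lemma heights_parity:
  assumes g: "g \<in> heights" and h: "h \<in> heights"
  shows "even (g T - h T)"
proof -
  have "{T. odd (g T - h T)} = {}"
  proof (rule nbr_closed_subset_empty)
    show "{T. odd (g T - h T)} \<subseteq> S" using heights_neq_in_S[OF g h] by force
    fix T c assume "T \<in> {T. odd (g T - h T)}"
    moreover from this have "T \<in> S" using heights_neq_in_S[OF g h] by force
    ultimately show "nbr c T \<in> {T. odd (g T - h T)}"
      using heights_step[OF g, of T c] heights_step[OF h, of T c] by auto
  qed
  then show ?thesis by blast
qed

subsection \<open>Towers\<close>

text \<open>A tower is listed from its last element \<open>E\<close> up to its local maximum: every element but
  the local maximum has exactly one higher neighbour, namely the next element.\<close>

definition tower :: "height \<Rightarrow> colour \<Rightarrow> colour \<Rightarrow> nat \<Rightarrow> tri \<Rightarrow> bool" where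
  "tower h a b k E \<longleftrightarrow> (\<forall>m\<le>k. strip a b E m \<in> S \<and>
     (\<forall>c. h (nbr c (strip a b E m)) = h (strip a b E m) + (if m < k \<and> c = alt a b m then 1 else - 1)))"

lemma towerI:
  assumes "\<And>m. m \<le> k \<Longrightarrow> strip a b E m \<in> S"
    and "\<And>m c. m \<le> k \<Longrightarrow> h (nbr c (strip a b E m)) =
      h (strip a b E m) + (if m < k \<and> c = alt a b m then 1 else - 1)"
  shows "tower h a b k E"
  using assms unfolding tower_def by blast

lemma towerD:
  assumes "tower h a b k E" "m \<le> k"
  shows "strip a b E m \<in> S"
    and "h (nbr c (strip a b E m)) = h (strip a b E m) + (if m < k \<and> c = alt a b m then 1 else - 1)"
  using assms unfolding tower_def by blast+

lemma tower_zero_iff: "tower h a b 0 E \<longleftrightarrow> E \<in> S \<and> local_extremum 1 h E"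
  by (simp add: tower_def local_extremum_def)

lemma tower_cong:
  assumes tower: "tower g a b k E"
    and strip: "\<And>m. m \<le> k \<Longrightarrow> h (strip a b E m) = g (strip a b E m)"
    and nbrs: "\<And>m c. m \<le> k \<Longrightarrow> h (nbr c (strip a b E m)) = g (nbr c (strip a b E m))"
  shows "tower h a b k E"
  using towerD[OF tower] strip nbrs by (intro towerI) simp_all

lemma tower_height:
  assumes "tower h a b k E" "m \<le> k"
  shows "h (strip a b E m) = h E + int m"
  using assms(2)
proof (induction m)
  case (Suc m)
  then show ?case using towerD(2)[OF assms(1), of m "alt a b m"] by simp
qed simp

lemma tower_strip_cancel:
  assumes tower: "tower h a b k E" and "m \<le> k" "m' \<le> k" and eq: "strip a b E m = strip a b E m'"
  shows "m = m'"
  using tower_height[OF tower \<open>m \<le> k\<close>] tower_height[OF tower \<open>m' \<le> k\<close>] unfolding eq by simp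

lemma tower_strip_agree:
  assumes tower: "tower h a b k E" and tower': "tower h a' b' k' E" and "m \<le> k"
  shows "m \<le> k' \<and> strip a b E m = strip a' b' E m"
  using assms(3)
proof (induction m)
  case (Suc m)
  then have IH: "m \<le> k'" "strip a b E m = strip a' b' E m" by auto
  have "h (nbr (alt a b m) (strip a b E m)) = h (strip a b E m) + 1"
    using towerD(2)[OF tower, of m "alt a b m"] Suc.prems by simp
  then have "m < k' \<and> alt a b m = alt a' b' m"
    using towerD(2)[OF tower' IH(1), of "alt a b m"] IH(2) by (auto split: if_splits)
  then show ?case using IH by simp
qed simp

lemma tower_length_unique: "tower h a b k E \<Longrightarrow> tower h a' b' k' E \<Longrightarrow> k = k'"
  using tower_strip_agree by (metis order_antisym order_refl)

definition tower_set :: "height \<Rightarrow> tri \<Rightarrow> tri set" where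
  "tower_set h E = {strip a b E m | a b k m. tower h a b k E \<and> m \<le> k}"

lemma tower_set_eq:
  assumes "tower h a b k E"
  shows "tower_set h E = strip a b E ` {..k}"
proof -
  have "strip a' b' E m \<in> strip a b E ` {..k}" if "tower h a' b' k' E" "m \<le> k'" for a' b' k' m
    using tower_strip_agree[OF that(1) assms that(2)] by auto
  then show ?thesis using assms unfolding tower_set_def by blast
qed

lemma tower_set_empty_iff: "tower_set h E = {} \<longleftrightarrow> (\<forall>a b k. \<not> tower h a b k E)"
proof
  assume "tower_set h E = {}"
  then show "\<forall>a b k. \<not> tower h a b k E" using tower_set_eq by fastforce
qed (simp add: tower_set_def)

lemma tower_setE:
  assumes "tower_set h E \<noteq> {}"
  obtains a b k where "tower h a b k E" "tower_set h E = strip a b E ` {..k}"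
  using assms tower_set_eq unfolding tower_set_empty_iff by blast

lemma card_tower_set:
  assumes tower: "tower h a b k E"
  shows "card (tower_set h E) = Suc k"
proof -
  have "inj_on (strip a b E) {..k}"
    using tower_strip_cancel[OF tower] by (auto intro!: inj_onI)
  then show ?thesis by (simp add: tower_set_eq[OF tower] card_image)
qed

lemma tower_set_subset: "tower_set h E \<subseteq> S"
  unfolding tower_set_def using towerD(1) by blast

lemma finite_tower_set [simp]: "finite (tower_set h E)"
  using tower_set_subset finite_S finite_subset by blast

lemma card_tower_set_le: "card (tower_set h E) \<le> card S"
  using tower_set_subset finite_S card_mono by blast

lemma last_in_tower_set: "tower_set h E \<noteq> {} \<Longrightarrow> E \<in> tower_set h E"
  by (metis atMost_iff image_eqI le0 strip.simps(1) tower_setE)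

lemma tower_set_card_1: "card (tower_set h E) = 1 \<Longrightarrow> tower_set h E = {E}"
  using last_in_tower_set[of h E] by (metis card_1_singletonE empty_not_insert singletonD)

lemma tower_set_local_maximum: "E \<in> S \<Longrightarrow> local_extremum 1 h E \<Longrightarrow> tower_set h E = {E}"
  using tower_set_eq[of h Red Red 0 E] by (simp add: tower_zero_iff)

lemma nbr_strip_in_tower:
  assumes tower: "tower h a b k E" and m: "m \<le> k" and "nbr c (strip a b E m) \<in> strip a b E ` {..k}"
  shows "(m < k \<and> c = alt a b m) \<or> (0 < m \<and> nbr c (strip a b E m) = strip a b E (m - 1))"
proof -
  obtain j where j: "j \<le> k" "nbr c (strip a b E m) = strip a b E j" using assms(3) by auto
  show ?thesis
  proof (cases "m < k \<and> c = alt a b m")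
    case False
    then have "int j = int m - 1"
      using towerD(2)[OF tower m, of c] tower_height[OF tower m] tower_height[OF tower j(1)] j(2)
      by simp
    then have "0 < m" "j = m - 1" by linarith+
    then show ?thesis using j by simp
  qed simp
qed

subsection \<open>Lowering a tower\<close>

abbreviation signed_tower :: "int \<Rightarrow> height \<Rightarrow> tri \<Rightarrow> tri set" where
  "signed_tower s h \<equiv> tower_set (scale s h)"

definition tower_flip :: "int \<Rightarrow> tri \<Rightarrow> height \<Rightarrow> height" where
  "tower_flip s E h = lower s (signed_tower s h E) h"

definition lower_from :: "nat \<Rightarrow> int \<Rightarrow> colour \<Rightarrow> colour \<Rightarrow> nat \<Rightarrow> tri \<Rightarrow> height \<Rightarrow> height" where
  "lower_from j s a b k E = lower s (strip a b E ` {j..k})"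

lemma lower_from_Suc_last [simp]: "lower_from (Suc k) s a b k E h = h"
  by (simp add: lower_from_def)

lemma lower_from_zero: "tower (scale s h) a b k E \<Longrightarrow> lower_from 0 s a b k E h = tower_flip s E h"
  by (simp add: lower_from_def tower_flip_def tower_set_eq atLeast0AtMost)

lemma strip_notin_later:
  assumes "tower h a b k E" "i \<le> j" "j \<le> k"
  shows "strip a b E i \<notin> strip a b E ` {Suc j..k}"
  using tower_strip_cancel[OF assms(1), of i] assms(2,3) by auto

lemma lower_from_extremum:
  assumes s: "s \<in> signs" and tower: "tower (scale s h) a b k E" and j: "j \<le> k"
  shows "local_extremum s (lower_from (Suc j) s a b k E h) (strip a b E j)"
  unfolding local_extremum_def
proof
  fix c
  let ?g = "lower_from (Suc j) s a b k E h" and ?T = "strip a b E j"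
  have g_T: "?g ?T = h ?T"
    using strip_notin_later[OF tower order_refl j] by (simp add: lower_from_def lower_def)
  show "?g (nbr c ?T) = ?g ?T - s"
  proof (cases "j < k \<and> c = alt a b j")
    case True
    then have next_elem: "nbr c ?T = strip a b E (Suc j)" by simp
    have "strip a b E (Suc j) \<in> strip a b E ` {Suc j..k}" by (rule imageI) (use True in simp)
    then have "?g (nbr c ?T) = h (nbr c ?T) - 2 * s"
      unfolding next_elem by (simp add: lower_from_def lower_def del: strip.simps)
    then show ?thesis using g_T towerD(2)[OF tower j, of c] True s by (auto simp: scale_def)
  next
    case False
    have "nbr c ?T \<notin> strip a b E ` {Suc j..k}"
    proof
      assume later: "nbr c ?T \<in> strip a b E ` {Suc j..k}"
      then have "nbr c ?T \<in> strip a b E ` {..k}" by auto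
      then have "nbr c ?T = strip a b E (j - 1)" using nbr_strip_in_tower[OF tower j] False by blast
      then show False using later strip_notin_later[OF tower _ j, of "j - 1"] by simp
    qed
    then have "?g (nbr c ?T) = h (nbr c ?T)" by (simp add: lower_from_def lower_def)
    then show ?thesis using g_T towerD(2)[OF tower j, of c] False s by (auto simp: scale_def)
  qed
qed

lemma lower_from_eq_flip_at:
  assumes s: "s \<in> signs" and tower: "tower (scale s h) a b k E" and j: "j \<le> k"
  shows "lower_from j s a b k E h = flip_at (strip a b E j) (lower_from (Suc j) s a b k E h)"
proof -
  have "{j..k} = insert j {Suc j..k}" using j by auto
  then show ?thesis
    using strip_notin_later[OF tower order_refl j]
    unfolding flip_at_extremum[OF lower_from_extremum[OF assms] s]
    by (auto simp: lower_from_def lower_def)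
qed

lemma lower_from_heights:
  assumes h: "h \<in> heights" and s: "s \<in> signs" and tower: "tower (scale s h) a b k E" and "j \<le> Suc k"
  shows "lower_from j s a b k E h \<in> heights"
  using assms(4)
proof (induction j rule: inc_induct)
  case base
  then show ?case using h by simp
next
  case (step j)
  then have "j \<le> k" by simp
  then show ?case using lower_from_eq_flip_at[OF s tower] step.IH flip_at_heights towerD(1)[OF tower] by simp
qed

lemma tower_flip_heights:
  assumes "h \<in> heights" "s \<in> signs"
  shows "tower_flip s E h \<in> heights"
proof (cases "signed_tower s h E = {}")
  case True
  then show ?thesis using assms by (simp add: tower_flip_def)
next
  case False
  then obtain a b k where tower: "tower (scale s h) a b k E" by (metis tower_setE)
  then show ?thesis using lower_from_heights[OF assms tower, of 0] by (simp add: lower_from_zero)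
qed

subsection \<open>Reversing a tower\<close>

lemma lower_tower_nbr:
  assumes tower: "tower h a b k E" and m: "m \<le> k"
  defines "g \<equiv> lower 1 (tower_set h E) h"
  shows "g (nbr c (strip a b E m))
      = g (strip a b E m) + (if 0 < m \<and> c = alt a b (m - 1) then - 1 else 1)"
proof -
  have g_strip: "g (strip a b E i) = h E + int i - 2" if "i \<le> k" for i
    using that tower_height[OF tower that] by (simp add: g_def lower_def tower_set_eq[OF tower])
  consider (previous) "0 < m" "c = alt a b (m - 1)"
    | (following) "\<not> (0 < m \<and> c = alt a b (m - 1))" "m < k" "c = alt a b m"
    | (outside) "\<not> (0 < m \<and> c = alt a b (m - 1))" "\<not> (m < k \<and> c = alt a b m)" by blast
  then show ?thesis
  proof cases
    case previous
    then have "nbr c (strip a b E m) = strip a b E (m - 1)" by (cases m) auto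
    then show ?thesis using previous m g_strip[of m] g_strip[of "m - 1"] by simp
  next
    case following
    then have "nbr c (strip a b E m) = strip a b E (Suc m)" by simp
    then show ?thesis using following g_strip[of m] g_strip[of "Suc m"] by simp
  next
    case outside
    have "\<not> (0 < m \<and> nbr c (strip a b E m) = strip a b E (m - 1))"
      using outside(1) nbr_eq_nbr[of c "strip a b E m" "alt a b (m - 1)"] by (cases m) auto
    then have "nbr c (strip a b E m) \<notin> tower_set h E"
      using nbr_strip_in_tower[OF tower m, of c] outside(2) unfolding tower_set_eq[OF tower]
      by blast
    then have "g (nbr c (strip a b E m)) = h (nbr c (strip a b E m))" by (simp add: g_def lower_def)
    then show ?thesis
      using outside towerD(2)[OF tower m, of c] tower_height[OF tower m] g_strip[OF m] by auto
  qed
qed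

lemma lower_tower_reversed:
  assumes tower: "tower h a b k E"
  shows "tower (scale (- 1) (lower 1 (tower_set h E) h))
    (alt a b (k + 1)) (alt a b k) k (strip a b E k)"
proof (rule towerI)
  fix m assume m: "m \<le> k"
  then show "strip (alt a b (k + 1)) (alt a b k) (strip a b E k) m \<in> S"
    using strip_reverse[OF m] towerD(1)[OF tower, of "k - m"] by simp
next
  fix m c assume m: "m \<le> k"
  have "alt (alt a b (k + 1)) (alt a b k) m = alt a b (k - m - 1)" if "m < k"
    using that by (auto simp: alt_def)
  then show "scale (- 1) (lower 1 (tower_set h E) h) (nbr c (strip (alt a b (k + 1)) (alt a b k) (strip a b E k) m)) =
      scale (- 1) (lower 1 (tower_set h E) h)
        (strip (alt a b (k + 1)) (alt a b k) (strip a b E k) m) +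
       (if m < k \<and> c = alt (alt a b (k + 1)) (alt a b k) m then 1 else - 1)"
    unfolding strip_reverse[OF m]
    using lower_tower_nbr[OF tower, of "k - m" c] m by (auto simp: scale_def)
qed

definition tower_top :: "height \<Rightarrow> tri \<Rightarrow> tri" where
  "tower_top h E = (THE T. T \<in> tower_set h E \<and> local_extremum 1 h T)"

lemma tower_top_eq:
  assumes tower: "tower h a b k E"
  shows "tower_top h E = strip a b E k"
  unfolding tower_top_def
proof (rule the_equality)
  show "strip a b E k \<in> tower_set h E \<and> local_extremum 1 h (strip a b E k)"
    using towerD(2)[OF tower, of k] tower_set_eq[OF tower] by (simp add: local_extremum_def)
  fix T assume T: "T \<in> tower_set h E \<and> local_extremum 1 h T"
  then obtain m where m: "m \<le> k" "T = strip a b E m" using tower_set_eq[OF tower] by auto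
  have "\<not> m < k"
    using towerD(2)[OF tower m(1), of "alt a b m"] T m
    by (auto simp: local_extremum_def split: if_splits)
  then show "T = strip a b E k" using m by simp
qed

lemma tower_flip_reverse:
  assumes s: "s \<in> signs" and nonempty: "signed_tower s h E \<noteq> {}"
  defines "E' \<equiv> tower_top (scale s h) E" and "h' \<equiv> tower_flip s E h"
  shows "E' \<in> S" and "signed_tower (- s) h' E' = signed_tower s h E"
    and "tower_top (scale (- s) h') E' = E" and "tower_flip (- s) E' h' = h"
proof -
  obtain a b k where tower: "tower (scale s h) a b k E" using nonempty by (metis tower_setE)
  have E': "E' = strip a b E k" unfolding E'_def by (rule tower_top_eq[OF tower])
  then show "E' \<in> S" using towerD(1)[OF tower, of k] by simp
  have "scale (- s) h' = scale (- 1) (lower 1 (signed_tower s h E) (scale s h))"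
    using s by (auto simp: scale_def h'_def tower_flip_def lower_def)
  then have tower': "tower (scale (- s) h') (alt a b (k + 1)) (alt a b k) k E'"
    using lower_tower_reversed[OF tower] E' by simp
  then show "tower_top (scale (- s) h') E' = E"
    using tower_top_eq[OF tower'] strip_reverse[of k k a b E] E' by simp
  have "signed_tower (- s) h' E' = (\<lambda>m. strip a b E (k - m)) ` {..k}"
    unfolding tower_set_eq[OF tower']
    by (intro image_cong refl) (simp add: E' strip_reverse del: One_nat_def)
  also have "\<dots> = strip a b E ` (\<lambda>m. k - m) ` {..k}" by (simp add: image_image)
  also have "(\<lambda>m. k - m) ` {..k} = {..k}"
  proof -
    have "m \<in> (\<lambda>m. k - m) ` {..k}" if "m \<le> k" for m
      using that by (intro image_eqI[of _ _ "k - m"]) auto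
    then show ?thesis by auto
  qed
  also have "strip a b E ` {..k} = signed_tower s h E" by (simp add: tower_set_eq[OF tower])
  finally show tower_eq: "signed_tower (- s) h' E' = signed_tower s h E" .
  show "tower_flip (- s) E' h' = h"
    unfolding tower_flip_def[of "- s"] tower_eq by (simp add: h'_def tower_flip_def)
qed

end

section \<open>Towers in two height functions differing by a flip\<close>

locale flip_pair = region +
  fixes x y :: height and F :: tri
  assumes x: "x \<in> heights" and y: "y \<in> heights" and F: "F \<in> S"
    and y_def: "y = x(F := x F + 2)"
begin

lemma y_off [simp]: "T \<noteq> F \<Longrightarrow> y T = x T" and y_F [simp]: "y F = x F + 2"
  by (simp_all add: y_def)

lemma x_nbr_F [simp]: "x (nbr c F) = x F + 1"
  using heights_step[OF x F, of c] heights_step[OF y F, of c] by auto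

lemma flip_pair_negated: "flip_pair S (scale (- 1) y) (scale (- 1) x) F"
proof
  show "scale (- 1) x = (scale (- 1) y)(F := scale (- 1) y F + 2)"
    by (auto simp: scale_def y_def)
qed (use x y F in \<open>auto simp: scale_heights\<close>)

lemma x_tower_avoids_F:
  assumes tower: "tower x a b k E" and m: "m \<le> k"
  shows "strip a b E m \<noteq> F"
proof
  assume at_F: "strip a b E m = F"
  obtain c where "c \<noteq> alt a b m" by (metis colour.distinct(1))
  then show False using towerD(2)[OF tower m, of c] at_F by simp
qed

lemma F_notin_x_tower_set: "F \<notin> tower_set x E"
  unfolding tower_set_def using x_tower_avoids_F by blast

lemma y_tower_if_not_adjacent:
  assumes tower: "tower x a b k E" and away: "\<And>m c. m \<le> k \<Longrightarrow> strip a b E m \<noteq> nbr c F"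
  shows "tower y a b k E"
  using tower
proof (rule tower_cong)
  fix m assume m: "m \<le> k"
  show "y (strip a b E m) = x (strip a b E m)" using x_tower_avoids_F[OF tower m] by simp
  show "y (nbr c (strip a b E m)) = x (nbr c (strip a b E m))" for c
    using away[OF m, of c] nbr_eq_iff_eq_nbr y_off by blast
qed

lemma y_tower_ends_at_F:
  assumes tower: "tower y a b k E" and m: "m \<le> k" and at_F: "strip a b E m = F"
  shows "m = k"
proof (rule ccontr)
  assume "m \<noteq> k"
  then show False using towerD(2)[OF tower m, of "alt a b m"] at_F m by simp
qed

lemma y_tower_drop_F:
  assumes tower: "tower y a b (Suc k) E" and top: "strip a b E (Suc k) = F"
  shows "tower x a b k E"
proof (rule towerI)
  fix m assume "m \<le> k"
  then show "strip a b E m \<in> S" using towerD(1)[OF tower, of m] by simp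
next
  fix m c assume m: "m \<le> k"
  then have m': "m \<le> Suc k" by simp
  have not_F: "strip a b E m \<noteq> F" using tower_strip_cancel[OF tower m', of "Suc k"] top m by auto
  show "x (nbr c (strip a b E m)) = x (strip a b E m) + (if m < k \<and> c = alt a b m then 1 else - 1)"
  proof (cases "nbr c (strip a b E m) = F")
    case True
    have height_F: "y F = y E + int (Suc k)" using tower_height[OF tower, of "Suc k"] top by simp
    have height_m: "y (strip a b E m) = y E + int m" using tower_height[OF tower m'] .
    have "m = k" using height_F height_m towerD(2)[OF tower m', of c] True m
      by (auto split: if_splits)
    then show ?thesis using True height_F height_m not_F by simp
  next
    case False
    moreover have "m = k \<Longrightarrow> c \<noteq> alt a b m" using False top by auto
    ultimately show ?thesis using towerD(2)[OF tower m', of c] not_F m by auto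
  qed
qed

lemma y_tower_avoiding_F_not_adjacent:
  assumes tower: "tower y a b k E" and avoids: "\<And>m. m \<le> k \<Longrightarrow> strip a b E m \<noteq> F" and m: "m \<le> k"
  shows "strip a b E m \<noteq> nbr c F"
proof
  assume adjacent: "strip a b E m = nbr c F"
  then have "m < k \<and> c = alt a b m"
    using towerD(2)[OF tower m, of c] by (auto split: if_splits)
  then show False using avoids[of "Suc m"] adjacent by simp
qed

lemma x_tower_if_y_tower_avoids_F:
  assumes tower: "tower y a b k E" and avoids: "\<And>m. m \<le> k \<Longrightarrow> strip a b E m \<noteq> F"
  shows "tower x a b k E"
  using tower
proof (rule tower_cong)
  fix m assume m: "m \<le> k"
  show "x (strip a b E m) = y (strip a b E m)" using avoids[OF m] by simp
  show "x (nbr c (strip a b E m)) = y (nbr c (strip a b E m))" for c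
    using y_tower_avoiding_F_not_adjacent[OF tower avoids m, of c] nbr_eq_iff_eq_nbr y_off by metis
qed

text \<open>Otherwise \<open>F\<close>, the last three tower elements before it, a neighbour of the lowest of them and a
  neighbour of \<open>F\<close> would be the six triangles around a vertex, and the last two of these contradict the
  Lipschitz property.\<close>

lemma x_tower_aligned_with_F:
  assumes tower: "tower x a b k E" and m: "m \<le> k" and "2 \<le> m"
    and adjacent: "strip a b E m = nbr c F"
  shows "c = alt a b m"
proof (rule ccontr)
  obtain n where n: "m = Suc (Suc n)" using \<open>2 \<le> m\<close> by (metis add_2_eq_Suc le_Suc_ex)
  define T where "T = strip a b E n"
  define d where "d = alt a b (Suc n)"
  define e where "e = alt a b n"
  assume "c \<noteq> alt a b m"
  then have ce: "c \<noteq> e" by (simp add: e_def n alt_def)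
  have middle: "strip a b E (Suc n) = nbr e T" by (simp add: T_def e_def)
  have top: "nbr c F = nbr d (nbr e T)" using adjacent n middle by (simp add: d_def)
  have height: "x (nbr c F) = x T + 2"
    using tower_height[OF tower m] tower_height[OF tower, of n] m adjacent by (simp add: n T_def)
  have cd: "c \<noteq> d"
    using top x_tower_avoids_F[OF tower, of "Suc n"] m middle n by (metis Suc_leD nbr_nbr)
  have de: "d \<noteq> e" using top height by auto
  have "F = nbr c (nbr d (nbr e T))" using top nbr_eq_iff_eq_nbr by metis
  then have "nbr e F = nbr e (nbr c (nbr d (nbr e T)))" by simp
  also have "\<dots> = nbr d (nbr c T)"
    using nbr_hexagon[of e d c T] cd de ce by (metis nbr_nbr)
  finally have hexagon: "nbr e F = nbr d (nbr c T)" .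
  have "x (nbr c T) = x T - 1"
    using towerD(2)[OF tower, of n c] m n ce by (simp add: T_def e_def)
  then show False
    using heights_lipschitz[OF x, of d "nbr c T"] x_nbr_F[of e] height unfolding hexagon by simp
qed

lemma y_tower_add_F:
  assumes tower: "tower x a b k E" and adjacent: "strip a b E k = nbr (alt a b k) F"
  shows "tower y a b (Suc k) E"
proof (rule towerI)
  have at_F: "strip a b E (Suc k) = F" using adjacent by simp
  fix m assume m: "m \<le> Suc k"
  then show "strip a b E m \<in> S" using towerD(1)[OF tower, of m] at_F F by (cases "m = Suc k") auto
  fix c
  show "y (nbr c (strip a b E m))
      = y (strip a b E m) + (if m < Suc k \<and> c = alt a b m then 1 else - 1)"
  proof (cases "m = Suc k")
    case True
    then show ?thesis using at_F by simp
  next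
    case False
    then have m': "m \<le> k" using m by simp
    have not_F: "strip a b E m \<noteq> F" using x_tower_avoids_F[OF tower m'] .
    show ?thesis
    proof (cases "nbr c (strip a b E m) = F")
      case True
      then have strip_m: "strip a b E m = nbr c F" using nbr_eq_iff_eq_nbr by blast
      then have "x (strip a b E m) = x (strip a b E k)" using adjacent by simp
      then have "m = k" using tower_height[OF tower m'] tower_height[OF tower, of k] by simp
      then have "c = alt a b m" using strip_m adjacent by simp
      then show ?thesis using True strip_m m' by simp
    next
      case False
      moreover have "m = k \<Longrightarrow> c \<noteq> alt a b m" using False at_F by auto
      ultimately show ?thesis using towerD(2)[OF tower m', of c] not_F m' by auto
    qed
  qed
qed

text \<open>The colours of a tower of length at most two are not determined by it.\<close>

lemma x_tower_realign:
  assumes tower: "tower x a b k E" and adjacent: "strip a b E k = nbr c F"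
  obtains a' b' where "tower x a' b' k E" "strip a' b' E k = nbr (alt a' b' k) F"
proof -
  consider (singleton) "k = 0" | (pair) "k = 1" | (long) "2 \<le> k" by linarith
  then show thesis
  proof cases
    case singleton
    then have "tower x c c k E" using tower by (simp add: tower_def)
    then show thesis using that[of c c] singleton adjacent by (simp add: alt_def)
  next
    case pair
    have "strip a c E m = strip a b E m" if "m \<le> 1" for m
      using that by (cases m) (auto simp: alt_def)
    moreover have "alt a c m = alt a b m" if "m < 1" for m using that by (simp add: alt_def)
    ultimately have "tower x a c k E" using tower pair by (auto simp: tower_def)
    then show thesis using that[of a c] pair adjacent by (simp add: alt_def)
  next
    case long
    then show thesis
      using that[OF tower] x_tower_aligned_with_F[OF tower _ long adjacent] adjacent by simp
  qed
qed

lemma y_tower_set_extended: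
  assumes tower: "tower x a b k E" and adjacent: "strip a b E k = nbr c F"
  shows "tower_set y E = insert F (tower_set x E)"
proof -
  obtain a' b' where tower': "tower x a' b' k E" "strip a' b' E k = nbr (alt a' b' k) F"
    using x_tower_realign[OF tower adjacent] .
  have "tower_set y E = strip a' b' E ` {..Suc k}"
    using y_tower_add_F[OF tower'] by (rule tower_set_eq)
  also have "\<dots> = insert F (tower_set x E)"
    using tower'(2) tower_set_eq[OF tower'(1)] by (simp add: atMost_Suc)
  finally show ?thesis .
qed

lemma y_tower_set_blocked:
  assumes tower: "tower x a b k E" and m: "m < k" and adjacent: "strip a b E m = nbr c F"
  shows "tower_set y E = {}"
proof (rule ccontr)
  assume "tower_set y E \<noteq> {}"
  then obtain a' b' k' where tower': "tower y a' b' k' E" by (metis tower_setE)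
  show False
  proof (cases "\<exists>j\<le>k'. strip a' b' E j = F")
    case True
    then have top: "strip a' b' E k' = F" using y_tower_ends_at_F[OF tower'] by blast
    then have "k' \<noteq> 0" using x_tower_avoids_F[OF tower, of 0] by (cases k') auto
    then obtain l where l: "k' = Suc l" using not0_implies_Suc by blast
    then have x_tower: "tower x a' b' l E" using y_tower_drop_F tower' top by blast
    have kl: "k = l" using tower_length_unique[OF tower x_tower] .
    have agree: "strip a b E j = strip a' b' E j" if "j \<le> k" for j
      using tower_strip_agree[OF tower x_tower that] by simp
    have "c = alt a' b' m"
      using towerD(2)[OF tower', of m c] m kl l
      unfolding agree[of m, symmetric, OF less_imp_le[OF m]] adjacent
      by (auto split: if_splits)
    then have "strip a' b' E (Suc m) = F" using agree[of m, symmetric] adjacent m by simp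
    then show False using agree[of "Suc m"] x_tower_avoids_F[OF tower, of "Suc m"] m by simp
  next
    case False
    then have "tower x a' b' k' E" using x_tower_if_y_tower_avoids_F[OF tower'] by blast
    then have "m \<le> k'" "strip a' b' E m = nbr c F"
      using tower_strip_agree[OF tower, of a' b' k' m] m adjacent by simp_all
    then show False using y_tower_avoiding_F_not_adjacent[OF tower', of m c] False by blast
  qed
qed

lemma tower_set_F: "tower_set x F = {}" "tower_set y F = {F}"
proof -
  show "tower_set x F = {}" using last_in_tower_set F_notin_x_tower_set by blast
  have "local_extremum 1 y F" by (simp add: local_extremum_def)
  then show "tower_set y F = {F}" using F by (rule tower_set_local_maximum[rotated])
qed

lemma y_tower_set_empty:
  assumes E: "E \<noteq> F" and empty: "tower_set x E = {}"
  shows "tower_set y E = {}"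
proof (rule ccontr)
  assume "tower_set y E \<noteq> {}"
  then obtain a b k where tower: "tower y a b k E" by (metis tower_setE)
  have "\<exists>j. tower x a b j E"
  proof (cases "\<exists>j\<le>k. strip a b E j = F")
    case True
    then have top: "strip a b E k = F" using y_tower_ends_at_F[OF tower] by blast
    then have "k \<noteq> 0" using E by (cases k) auto
    then show ?thesis using y_tower_drop_F tower top by (metis not0_implies_Suc)
  next
    case False
    then show ?thesis using x_tower_if_y_tower_avoids_F[OF tower] by blast
  qed
  then show False using empty tower_set_empty_iff by blast
qed

lemma tower_set_cases:
  assumes E: "E \<noteq> F"
  obtains (same) "tower_set x E = tower_set y E"
  | (extended) "tower_set x E \<noteq> {}" "tower_set y E = insert F (tower_set x E)"
      "card (tower_set x E) = 1 \<Longrightarrow> local_extremum 1 x E \<and> (\<exists>c. E = nbr c F)"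
  | (blocked) c a b k m
  where "tower_set y E = {}" "tower x a b k E" "m < k" "strip a b E m = nbr c F"
proof (cases "tower_set x E = {}")
  case True
  then show thesis using y_tower_set_empty[OF E] same by simp
next
  case nonempty: False
  then obtain a b k where tower: "tower x a b k E" by (metis tower_setE)
  show thesis
  proof (cases "\<exists>m\<le>k. \<exists>c. strip a b E m = nbr c F")
    case True
    then obtain m c where m: "m \<le> k" "strip a b E m = nbr c F" by blast
    then consider (top) "m = k" | (below) "m < k" by linarith
    then show thesis
    proof cases
      case top
      have "local_extremum 1 x E \<and> (\<exists>c. E = nbr c F)" if "card (tower_set x E) = 1"
      proof -
        have "k = 0" using that card_tower_set[OF tower] by simp
        then show ?thesis using top m tower by (auto simp: tower_zero_iff)
      qed
      then show thesis
        using extended[OF nonempty] y_tower_set_extended[OF tower, of c] top m by simp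
    next
      case below
      then show thesis using blocked y_tower_set_blocked[OF tower _ m(2)] tower m(2) by blast
    qed
  next
    case False
    then have "tower y a b k E" using y_tower_if_not_adjacent[OF tower] by blast
    then show thesis using same tower tower_set_eq by metis
  qed
qed

subsection \<open>The cost of unmatched towers\<close>

definition extended :: "tri set" where
  "extended = {E \<in> S. E \<noteq> F \<and> card (tower_set x E) = 1 \<and> tower_set y E = insert F (tower_set x E)}"

definition blocked :: "tri set" where
  "blocked = {E \<in> S. tower_set y E = {} \<and> 2 \<le> card (tower_set x E)}"

lemma extended_subset: "extended \<subseteq> S" and blocked_subset: "blocked \<subseteq> S"
  by (auto simp: extended_def blocked_def)

lemma extendedD:
  assumes E: "E \<in> extended"
  shows "local_extremum 1 x E" and "\<exists>c. E = nbr c F"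
proof -
  have E': "E \<noteq> F" "card (tower_set x E) = 1" "tower_set y E = insert F (tower_set x E)"
    using E by (auto simp: extended_def)
  have "local_extremum 1 x E \<and> (\<exists>c. E = nbr c F)"
    using E'(1)
  proof (cases rule: tower_set_cases)
    case same
    then show ?thesis using E' F_notin_x_tower_set by blast
  next
    case extended
    then show ?thesis using E'(2) by blast
  next
    case (blocked c a b k m)
    then show ?thesis using E' by simp
  qed
  then show "local_extremum 1 x E" "\<exists>c. E = nbr c F" by auto
qed

definition slope :: "colour \<Rightarrow> colour \<Rightarrow> colour \<Rightarrow> bool" where
  "slope c d e \<longleftrightarrow> c \<noteq> d \<and> d \<noteq> e \<and> c \<noteq> e \<and>
     x (nbr d (nbr c F)) = x F \<and> x (nbr e (nbr c F)) = x F + 2"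

lemma slope_unique:
  assumes "slope c d e" "slope c d' e'"
  shows "d' = d" "e' = e"
  using assms distinct_colours_exhaust[of c d e d'] distinct_colours_exhaust[of c d e e']
  by (auto simp: slope_def)

definition blocked_at :: "colour \<Rightarrow> colour \<Rightarrow> colour \<Rightarrow> tri \<Rightarrow> bool" where
  "blocked_at c d e E \<longleftrightarrow> slope c d e \<and>
     (E = nbr c F \<or> E = nbr d (nbr c F) \<and> (\<forall>c'. c' \<noteq> d \<longrightarrow> x (nbr c' E) = x F - 1)) \<and>
     (\<exists>g. \<forall>c'. c' \<noteq> g \<longrightarrow> x (nbr c' (nbr e (nbr c F))) = x F + 1)"

lemma second_element_blocked:
  assumes tower: "tower x a b k E" and k: "1 < k" and adjacent: "strip a b E 1 = nbr c F"
  shows "E = nbr a (nbr c F)" and "x E = x F" and "\<forall>c'. c' \<noteq> a \<longrightarrow> x (nbr c' E) = x F - 1"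
proof -
  have "nbr a E = nbr c F" using adjacent by (simp add: alt_def)
  then show "E = nbr a (nbr c F)" using nbr_eq_iff_eq_nbr by blast
  show height: "x E = x F" using tower_height[OF tower, of 1] k adjacent by simp
  show "\<forall>c'. c' \<noteq> a \<longrightarrow> x (nbr c' E) = x F - 1"
    using towerD(2)[OF tower, of 0] height k by (auto simp: alt_def)
qed

lemma blocked_tower_at:
  assumes tower: "tower x a b k E" and m: "m < k" and adjacent: "strip a b E m = nbr c F"
    and E: "E \<noteq> F"
  shows "\<exists>d e. blocked_at c d e E"
proof -
  define e where "e = alt a b m"
  have up: "x (nbr e (nbr c F)) = x F + 2"
    using towerD(2)[OF tower, of m e] m adjacent by (simp add: e_def)
  then have ce: "c \<noteq> e" by auto
  obtain d where d: "d \<noteq> c" "d \<noteq> e" using ex_third_colour by blast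
  have down: "x (nbr d (nbr c F)) = x F"
    using towerD(2)[OF tower, of m d] m adjacent d by (simp add: e_def)
  have "strip a b E (Suc m) = nbr e (nbr c F)" using adjacent by (simp add: e_def)
  then have above: "\<exists>g. \<forall>c'. c' \<noteq> g \<longrightarrow> x (nbr c' (nbr e (nbr c F))) = x F + 1"
    using towerD(2)[OF tower, of "Suc m"] m up by (intro exI[of _ "alt a b (Suc m)"]) auto
  have "m < 2"
    using x_tower_aligned_with_F[OF tower _ _ adjacent] m ce unfolding e_def
    by (meson less_imp_le not_le)
  then consider (first) "m = 0" | (second) "m = 1" by linarith
  then have "E = nbr c F \<or> E = nbr d (nbr c F) \<and> (\<forall>c'. c' \<noteq> d \<longrightarrow> x (nbr c' E) = x F - 1)"
  proof cases
    case first
    then show ?thesis using adjacent by simp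
  next
    case second
    note start = second_element_blocked[OF tower m[unfolded second] adjacent[unfolded second]]
    have "a \<noteq> c" "a \<noteq> e" using start(1,2) E up by auto
    then have "a = d" using d ce distinct_colours_exhaust[of c d e a] by auto
    then show ?thesis using start by blast
  qed
  then show ?thesis unfolding blocked_at_def slope_def using ce d up down above by metis
qed

lemma blocked_imp_blocked_at:
  assumes E: "E \<in> blocked"
  shows "\<exists>c d e. blocked_at c d e E"
proof -
  have "E \<noteq> F" using E tower_set_F by (auto simp: blocked_def)
  then show ?thesis
  proof (cases rule: tower_set_cases)
    case (blocked c a b k m)
    then show ?thesis using blocked_tower_at \<open>E \<noteq> F\<close> by blast
  qed (use E in \<open>auto simp: blocked_def\<close>)
qed

definition extended_near :: "colour \<Rightarrow> tri set" where
  "extended_near c = extended \<inter> {nbr c F}"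

definition blocked_near :: "colour \<Rightarrow> tri set" where
  "blocked_near c = {E \<in> blocked. \<exists>d e. blocked_at c d e E}"

lemma card_extended_near: "card (extended_near c) \<le> 1"
  using card_mono[of "{nbr c F}" "extended_near c"] by (simp add: extended_near_def)

lemma extended_near_maximum: "extended_near c \<noteq> {} \<Longrightarrow> x (nbr d (nbr c F)) = x F"
  using extendedD(1) local_extremumD[of 1 x "nbr c F" d] by (auto simp: extended_near_def)

lemma extended_near_slope: "slope c d e \<Longrightarrow> extended_near c = {}"
  using extended_near_maximum[of c e] by (auto simp: slope_def)

lemma blocked_near_slope: "blocked_near c \<noteq> {} \<Longrightarrow> \<exists>d e. slope c d e"
  by (auto simp: blocked_near_def blocked_at_def)

lemma blocked_near_at:
  assumes "slope c d e" "E \<in> blocked_near c"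
  shows "blocked_at c d e E"
proof -
  obtain d' e' where "blocked_at c d' e' E" using assms(2) by (auto simp: blocked_near_def)
  moreover from this have "d' = d" "e' = e"
    using slope_unique[OF assms(1)] by (auto simp: blocked_at_def)
  ultimately show ?thesis by simp
qed

lemma card_blocked_near:
  assumes "slope c d e"
  shows "card (blocked_near c) \<le> 2"
proof -
  have "blocked_near c \<subseteq> {nbr c F, nbr d (nbr c F)}"
    using blocked_near_at[OF assms] by (auto simp: blocked_at_def)
  then have "card (blocked_near c) \<le> card {nbr c F, nbr d (nbr c F)}"
    by (rule card_mono[rotated]) simp
  then show ?thesis by simp
qed

definition cost :: nat where
  "cost = 2 * card extended + card blocked"

definition cost_near :: "colour \<Rightarrow> nat" where
  "cost_near c = 2 * card (extended_near c) + card (blocked_near c)"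

lemma cost_le: "cost \<le> (\<Sum>c\<in>UNIV. cost_near c)"
proof -
  have "extended = (\<Union>c\<in>UNIV. extended_near c)"
    using extendedD(2) by (auto simp: extended_near_def)
  then have "card extended \<le> (\<Sum>c\<in>UNIV. card (extended_near c))"
    by (metis card_UN_le finite_code)
  moreover have "blocked = (\<Union>c\<in>UNIV. blocked_near c)"
    using blocked_imp_blocked_at by (auto simp: blocked_near_def)
  then have "card blocked \<le> (\<Sum>c\<in>UNIV. card (blocked_near c))"
    by (metis card_UN_le finite_code)
  ultimately show ?thesis
    unfolding cost_def cost_near_def sum.distrib sum_distrib_left[symmetric] by linarith
qed

interpretation neg: flip_pair S "scale (- 1) y" "scale (- 1) x" F
  by (rule flip_pair_negated)

lemma second_nbr_neq_F: "d \<noteq> c \<Longrightarrow> nbr d (nbr c F) \<noteq> F"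
  using nbr_eq_nbr nbr_nbr by metis

lemma third_nbr_neq_F: "nbr g (nbr d (nbr c F)) \<noteq> F"
  by (metis upward_nbr)

lemma neg_y_off: "T \<noteq> F \<Longrightarrow> scale (- 1) y T = - x T" and neg_y_F: "scale (- 1) y F = - x F - 2"
  by (simp_all add: scale_def)

lemma neg_slope_iff: "neg.slope c e d \<longleftrightarrow> slope c d e"
proof (cases "c \<noteq> d \<and> d \<noteq> e \<and> c \<noteq> e")
  case True
  then have "nbr d (nbr c F) \<noteq> F" "nbr e (nbr c F) \<noteq> F" using second_nbr_neq_F by auto
  then show ?thesis using True unfolding neg.slope_def slope_def by (auto simp: neg_y_off neg_y_F)
qed (auto simp: neg.slope_def slope_def)

lemma neg_extended_near_minimum:
  assumes "neg.extended_near c \<noteq> {}" "d \<noteq> c"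
  shows "x (nbr d (nbr c F)) = x F + 2"
  using neg.extended_near_maximum[OF assms(1), of d] second_nbr_neq_F[OF assms(2)]
  by (simp add: neg_y_off neg_y_F)

lemma extended_near_exclusive: "extended_near c = {} \<or> neg.extended_near c = {}"
proof -
  obtain d where "d \<noteq> c" using ex_third_colour by blast
  then show ?thesis
    using extended_near_maximum[of c d] neg_extended_near_minimum[of c d] by fastforce
qed

lemma neg_blocked_at_iff:
  assumes "slope c d e"
  shows "neg.blocked_at c e d E \<longleftrightarrow>
    (E = nbr c F \<or> E = nbr e (nbr c F) \<and> (\<forall>c'. c' \<noteq> e \<longrightarrow> x (nbr c' E) = x F + 3)) \<and>
    (\<exists>g. \<forall>c'. c' \<noteq> g \<longrightarrow> x (nbr c' (nbr d (nbr c F))) = x F + 1)"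
proof -
  have "- z = - x F - 2 - 1 \<longleftrightarrow> z = x F + 3" "- z = - x F - 2 + 1 \<longleftrightarrow> z = x F + 1" for z by auto
  then show ?thesis
    using assms third_nbr_neq_F[of _ _ c] unfolding neg.blocked_at_def neg_slope_iff
    by (auto simp: neg_y_off neg_y_F)
qed

text \<open>A tower blocked at \<open>nbr d (nbr c F)\<close> makes this triangle a local maximum up to one neighbour, while
  a negated tower through it makes it a local minimum up to one neighbour.\<close>

lemma card_blocked_near_add:
  assumes slope: "slope c d e"
  shows "card (blocked_near c) + card (neg.blocked_near c) \<le> 2"
proof (cases "blocked_near c = {} \<or> neg.blocked_near c = {}")
  case True
  then show ?thesis
    using card_blocked_near[OF slope] neg.card_blocked_near[of c e d] slope
    by (auto simp: neg_slope_iff)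
next
  case False
  have at: "blocked_at c d e E" if "E \<in> blocked_near c" for E
    using blocked_near_at[OF slope that] .
  have neg_at: "neg.blocked_at c e d E" if "E \<in> neg.blocked_near c" for E
    using neg.blocked_near_at[of c e d] slope that by (simp add: neg_slope_iff)
  obtain g where g: "\<And>c'. c' \<noteq> g \<Longrightarrow> x (nbr c' (nbr e (nbr c F))) = x F + 1"
    using False at unfolding blocked_at_def by blast
  obtain g' where g': "\<And>c'. c' \<noteq> g' \<Longrightarrow> x (nbr c' (nbr d (nbr c F))) = x F + 1"
    using False neg_at unfolding neg_blocked_at_iff[OF slope] by blast
  have "E = nbr c F" if "E \<in> blocked_near c" for E
  proof (rule ccontr)
    assume "E \<noteq> nbr c F"
    moreover obtain c' where "c' \<noteq> d" "c' \<noteq> g'" using ex_third_colour by blast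
    ultimately show False using at[OF that] g'[of c'] by (auto simp: blocked_at_def)
  qed
  moreover have "E = nbr c F" if "E \<in> neg.blocked_near c" for E
  proof (rule ccontr)
    assume "E \<noteq> nbr c F"
    moreover obtain c' where "c' \<noteq> e" "c' \<noteq> g" using ex_third_colour by blast
    ultimately show False
      using neg_at[OF that] g[of c'] by (auto simp: neg_blocked_at_iff[OF slope])
  qed
  ultimately have "card (blocked_near c) \<le> card {nbr c F}"
    "card (neg.blocked_near c) \<le> card {nbr c F}"
    by (intro card_mono; auto)+
  then show ?thesis by simp
qed

lemma cost_near_add: "cost_near c + neg.cost_near c \<le> 2"
proof (cases "\<exists>d e. slope c d e")
  case True
  then obtain d e where slope: "slope c d e" by blast
  then have "extended_near c = {}" "neg.extended_near c = {}"
    using extended_near_slope neg.extended_near_slope by (auto simp: neg_slope_iff)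
  then show ?thesis
    using card_blocked_near_add[OF slope] by (simp add: cost_near_def neg.cost_near_def)
next
  case False
  then have "blocked_near c = {}" "neg.blocked_near c = {}"
    using blocked_near_slope neg.blocked_near_slope neg_slope_iff by blast+
  then show ?thesis
    using extended_near_exclusive[of c] card_extended_near[of c] neg.card_extended_near[of c]
    by (auto simp: cost_near_def neg.cost_near_def)
qed

lemma cost_add_le: "cost + flip_pair.cost S (scale (- 1) y) (scale (- 1) x) F \<le> 6"
proof -
  have "cost + neg.cost \<le> (\<Sum>c\<in>UNIV. cost_near c + neg.cost_near c)"
    using cost_le neg.cost_le by (simp add: sum.distrib)
  also have "\<dots> \<le> (\<Sum>c\<in>(UNIV :: colour set). 2)"
    by (intro sum_mono cost_near_add)
  also have "\<dots> = 6" by (simp add: UNIV_colour)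
  finally show ?thesis .
qed

end

section \<open>The coupling of the tower chain\<close>

subsection \<open>The distance of height functions\<close>

context region
begin

definition height_dist :: "height \<Rightarrow> height \<Rightarrow> real" where
  "height_dist x y = (\<Sum>T\<in>S. \<bar>real_of_int (x T - y T)\<bar>) / 2"

lemma height_dist_commute: "height_dist x y = height_dist y x"
  unfolding height_dist_def by (simp add: abs_minus_commute)

lemma height_dist_triangle: "height_dist x z \<le> height_dist x y + height_dist y z"
proof -
  have "(\<Sum>T\<in>S. \<bar>real_of_int (x T - z T)\<bar>)
      \<le> (\<Sum>T\<in>S. \<bar>real_of_int (x T - y T)\<bar> + \<bar>real_of_int (y T - z T)\<bar>)"
    by (intro sum_mono) auto
  then show ?thesis by (simp add: height_dist_def sum.distrib)
qed

lemma height_dist_self [simp]: "height_dist x x = 0"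
  by (simp add: height_dist_def)

lemma height_dist_scale: "s \<in> signs \<Longrightarrow> height_dist (scale s x) (scale s y) = height_dist x y"
  unfolding height_dist_def scale_def by (auto simp: abs_minus_commute)

lemma height_dist_lower:
  assumes "A \<subseteq> S"
  shows "height_dist (lower 1 A x) x = card A"
proof -
  have "height_dist (lower 1 A x) x = (\<Sum>T\<in>S. if T \<in> A then 2 else 0) / 2"
    unfolding height_dist_def lower_def by (intro arg_cong2[where f = "(/)"] sum.cong refl) auto
  also have "\<dots> = card A"
    using finite_S assms by (simp add: sum.If_cases Int_absorb1)
  finally show ?thesis .
qed

lemma height_dist_lower_lower: "height_dist (lower s A x) (lower s A y) = height_dist x y"
  unfolding height_dist_def lower_def by (intro arg_cong2[where f = "(/)"] sum.cong refl) auto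

lemma height_dist_upd:
  assumes "T \<in> S"
  shows "height_dist (x(T := v)) y
      = height_dist x y + (\<bar>real_of_int (v - y T)\<bar> - \<bar>real_of_int (x T - y T)\<bar>) / 2"
  using finite_S assms by (simp add: height_dist_def sum.remove[of S T] field_simps)

lemma height_dist_ge_one:
  assumes x: "x \<in> heights" and y: "y \<in> heights" and "x \<noteq> y"
  shows "1 \<le> height_dist x y"
proof -
  obtain T where T: "x T \<noteq> y T" using assms(3) by blast
  then have "T \<in> S" using heights_neq_in_S[OF x y] by blast
  have "even (x T - y T)" using heights_parity[OF x y] .
  then have "2 \<le> \<bar>x T - y T\<bar>" using T by presburger
  then have "2 \<le> \<bar>real_of_int (x T - y T)\<bar>" by linarith
  also have "\<dots> \<le> (\<Sum>U\<in>S. \<bar>real_of_int (x U - y U)\<bar>)"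
    using \<open>T \<in> S\<close> finite_S by (intro member_le_sum) auto
  finally show ?thesis by (simp add: height_dist_def)
qed

lemma ex_raised_closer:
  assumes x: "x \<in> heights" and y: "y \<in> heights" and "x T < y T"
  shows "\<exists>F z. flip_pair S x z F \<and> height_dist z y = height_dist x y - 1"
proof -
  define B where "B = {T. x T < y T}"
  have B_S: "B \<subseteq> S" using heights_neq_in_S[OF x y] by (force simp: B_def)
  then have finB: "finite (x ` B)" using finite_S finite_subset by blast
  have "B \<noteq> {}" using assms(3) by (auto simp: B_def)
  then have "Min (x ` B) \<in> x ` B" using finB by (intro Min_in) auto
  then obtain F where F: "F \<in> B" "x F = Min (x ` B)" by (metis imageE)
  have F_S: "F \<in> S" using F B_S by blast
  have "even (y F - x F)" "x F < y F" using heights_parity[OF y x] F by (auto simp: B_def)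
  then have gap: "x F + 2 \<le> y F" by presburger
  have up: "x (nbr c F) = x F + 1" for c
  proof (rule ccontr)
    assume "x (nbr c F) \<noteq> x F + 1"
    then have down: "x (nbr c F) = x F - 1" using heights_step[OF x F_S] by blast
    then have "nbr c F \<in> B" using heights_step[OF y F_S, of c] gap by (auto simp: B_def)
    then have "x F \<le> x (nbr c F)" using F(2) finB by simp
    then show False using down by simp
  qed
  define z where "z = x(F := x F + 2)"
  have "z \<in> heights"
    using flip_extremum_heights[OF x F_S, of "- 1"] up by (simp add: z_def local_extremum_def)
  then have "flip_pair S x z F"
    using x F_S by unfold_locales (auto simp: z_def)
  moreover have "height_dist z y = height_dist x y - 1"
    using gap by (simp add: z_def height_dist_upd[OF F_S])
  ultimately show ?thesis by blast
qed

lemma ex_flip_closer: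
  assumes x: "x \<in> heights" and y: "y \<in> heights" and "x \<noteq> y"
  shows "\<exists>F z. (flip_pair S x z F \<or> flip_pair S z x F) \<and> z \<in> heights
      \<and> height_dist z y = height_dist x y - 1"
proof -
  obtain T where "x T \<noteq> y T" using assms(3) by blast
  then consider (below) "x T < y T" | (above) "x T > y T" by linarith
  then show ?thesis
  proof cases
    case below
    then show ?thesis using ex_raised_closer[OF x y below] flip_pair.y by blast
  next
    case above
    have sign: "(- 1 :: int) \<in> signs" by simp
    have "scale (- 1) x T < scale (- 1) y T" using above by (simp add: scale_def)
    then obtain F z where flip: "flip_pair S (scale (- 1) x) z F"
      and closer: "height_dist z (scale (- 1) y) = height_dist (scale (- 1) x) (scale (- 1) y) - 1"
      using ex_raised_closer[OF scale_heights[OF x sign] scale_heights[OF y sign]] by blast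
    have "flip_pair S (scale (- 1) z) x F"
      using flip_pair.flip_pair_negated[OF flip] by (simp add: scale_scale)
    moreover have "height_dist (scale (- 1) z) y = height_dist x y - 1"
      using closer height_dist_scale[OF sign, of x y]
        height_dist_scale[OF sign, of z "scale (- 1) y"]
      by (simp add: scale_scale)
    moreover have "scale (- 1) z \<in> heights" using scale_heights[OF flip_pair.y[OF flip] sign] .
    ultimately show ?thesis by blast
  qed
qed

subsection \<open>Random tower flips\<close>

text \<open>A step uses a uniform sign, last element and coin \<open>b < coin_bound\<close>. A tower of length 1 is accepted
  with probability 1/2 and one of length \<open>k \<ge> 2\<close> with probability \<open>1/(6k)\<close>; these are the values for which
  the matched towers cancel and the unmatched ones cost at most as much as the coalescence at the flipped
  triangle gains. The factor \<open>fact\<close> makes all these probabilities multiples of \<open>1/coin_bound\<close>.\<close>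

definition coin_bound :: nat where
  "coin_bound = 12 * fact (card S + 1)"

definition threshold :: "nat \<Rightarrow> nat" where
  "threshold k = (if k = 0 then 0 else if k = 1 then coin_bound div 2 else coin_bound div (6 * k))"

lemma coin_bound_pos: "0 < coin_bound"
  by (simp add: coin_bound_def)

lemma threshold_zero [simp]: "threshold 0 = 0"
  by (simp add: threshold_def)

lemma threshold_one: "2 * threshold 1 = coin_bound"
proof -
  have "2 * (coin_bound div 2) = coin_bound"
    by (rule dvd_mult_div_cancel) (simp add: coin_bound_def)
  then show ?thesis by (simp add: threshold_def)
qed

lemma threshold_one_real: "2 * real (threshold 1) = real coin_bound"
  by (metis threshold_one of_nat_mult of_nat_numeral)

lemma threshold_ge_two:
  assumes k: "2 \<le> k" "k \<le> card S + 1"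
  shows "6 * (real k * real (threshold k)) = real coin_bound"
proof -
  have "k dvd fact (card S + 1)" using k by (intro dvd_fact) auto
  then have "6 * k dvd 12 * fact (card S + 1)" by (intro mult_dvd_mono) auto
  then have "(6 * k) * (coin_bound div (6 * k)) = coin_bound"
    unfolding coin_bound_def by (rule dvd_mult_div_cancel)
  then have "6 * (k * threshold k) = coin_bound" using k by (simp add: threshold_def)
  then show ?thesis by (metis of_nat_mult of_nat_numeral)
qed

lemma threshold_le: "threshold k \<le> coin_bound"
  by (simp add: threshold_def)

lemma threshold_antimono: "1 \<le> k \<Longrightarrow> threshold (Suc k) \<le> threshold k"
  by (auto simp: threshold_def intro!: div_le_mono2)

lemma threshold_le_twelfth:
  assumes "k \<noteq> 1"
  shows "12 * threshold k \<le> coin_bound"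
proof (cases "k = 0")
  case False
  then have "threshold k \<le> coin_bound div 12"
    using assms by (auto simp: threshold_def intro!: div_le_mono2)
  then show ?thesis by linarith
qed simp

lemma sum_coins_less:
  assumes "t \<le> coin_bound"
  shows "(\<Sum>b<coin_bound. of_bool (b < t)) = real t"
proof -
  have "{..<coin_bound} \<inter> {b. b < t} = {..<t}" using assms by auto
  then show ?thesis by (simp add: sum.If_cases of_bool_def)
qed

fun tower_move :: "int \<times> tri \<times> nat \<Rightarrow> height \<Rightarrow> height" where
  "tower_move (s, E, b) h = (if b < threshold (card (signed_tower s h E)) then tower_flip s E h else h)"

definition coins :: "(int \<times> tri \<times> nat) set" where
  "coins = signs \<times> S \<times> {..<coin_bound}"

lemma finite_coins: "finite coins"
  by (simp add: coins_def finite_S)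

lemma card_coins: "card coins = 2 * card S * coin_bound"
  by (simp add: coins_def card_cartesian_product)

lemma sum_coins: "(\<Sum>\<omega>\<in>coins. f \<omega>) = (\<Sum>s\<in>signs. \<Sum>E\<in>S. \<Sum>b<coin_bound. f (s, E, b))"
  unfolding coins_def by (simp only: sum.cartesian_product split_def prod.collapse)

lemma tower_flip_scale: "s \<in> signs \<Longrightarrow> tower_flip s E h = scale s (tower_flip 1 E (scale s h))"
  unfolding tower_flip_def scale_one by (rule lower_eq_scale)

lemma tower_move_scale: "s \<in> signs
    \<Longrightarrow> tower_move (s, E, b) h = scale s (tower_move (1, E, b) (scale s h))"
  using tower_flip_scale[of s E h] by (simp add: scale_scale)

lemma tower_move_heights: "h \<in> heights \<Longrightarrow> \<omega> \<in> coins \<Longrightarrow> tower_move \<omega> h \<in> heights"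
  by (auto simp: coins_def tower_flip_heights)

subsection \<open>Drift with a common coin\<close>

definition drift :: "int \<Rightarrow> tri \<Rightarrow> height \<Rightarrow> height \<Rightarrow> real" where
  "drift s E x y = (\<Sum>b<coin_bound. height_dist (tower_move (s, E, b) x) (tower_move (s, E, b) y)
      - height_dist x y)"

lemma drift_negate: "drift (- 1) E x y = drift 1 E (scale (- 1) y) (scale (- 1) x)"
proof -
  have sign: "(- 1 :: int) \<in> signs" by simp
  show ?thesis
    unfolding drift_def tower_move_scale[OF sign] height_dist_scale[OF sign]
    by (simp only: height_dist_commute)
qed

lemma drift_commute: "drift s E x y = drift s E y x"
  unfolding drift_def by (simp only: height_dist_commute)

lemma drift_triangle:
  assumes "height_dist x y = height_dist x z + height_dist z y"
  shows "drift s E x y \<le> drift s E x z + drift s E z y"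
  unfolding drift_def sum.distrib[symmetric] assms
proof (rule sum_mono)
  fix b
  show "height_dist (tower_move (s, E, b) x) (tower_move (s, E, b) y) - (height_dist x z + height_dist z y) \<le>
      height_dist (tower_move (s, E, b) x) (tower_move (s, E, b) z) - height_dist x z +
      (height_dist (tower_move (s, E, b) z) (tower_move (s, E, b) y) - height_dist z y)"
    using height_dist_triangle[of "tower_move (s, E, b) x" "tower_move (s, E, b) y" "tower_move (s, E, b) z"]
    by linarith
qed

lemma drift_same_tower:
  assumes "signed_tower s x E = signed_tower s y E"
  shows "drift s E x y = 0"
  unfolding drift_def
  by (intro sum.neutral) (auto simp: tower_flip_def assms height_dist_lower_lower)

end

context flip_pair
begin

lemma height_dist_xy: "height_dist x y = 1"
  unfolding y_def height_dist_commute[of x] by (simp add: height_dist_upd[OF F])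

lemma height_dist_lower_x: "height_dist (lower 1 (tower_set x E) x) y \<le> card (tower_set x E) + 1"
  using height_dist_triangle[of "lower 1 (tower_set x E) x" y x]
    height_dist_lower[OF tower_set_subset] height_dist_xy
  by simp

lemma drift_at_F: "drift 1 F x y = - coin_bound / 2"
proof -
  have "lower 1 {F} y = x" by (auto simp: lower_def)
  then have "height_dist (tower_move (1, F, b) x) (tower_move (1, F, b) y) - height_dist x y
      = - of_bool (b < threshold 1)" for b
    using tower_set_F height_dist_xy by (simp add: tower_flip_def)
  then show ?thesis
    using threshold_one_real by (simp add: drift_def sum_negf sum_coins_less[OF threshold_le])
qed

lemma drift_extended:
  assumes nonempty: "tower_set x E \<noteq> {}" and y_tower: "tower_set y E = insert F (tower_set x E)"
  shows "drift 1 E x y \<le> coin_bound * (of_bool (card (tower_set x E) = 1) / 3)"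
proof -
  define k where "k = card (tower_set x E)"
  have k: "1 \<le> k" using nonempty by (simp add: k_def Suc_le_eq card_gt_0_iff)
  have card_y: "card (tower_set y E) = Suc k" using y_tower F_notin_x_tower_set by (simp add: k_def)
  then have k_S: "Suc k \<le> card S" using card_tower_set_le[of y E] by simp
  have coalesce: "lower 1 (insert F (tower_set x E)) y = lower 1 (tower_set x E) x"
    using F_notin_x_tower_set by (auto simp: lower_def)
  have "height_dist (tower_move (1, E, b) x) (tower_move (1, E, b) y) - height_dist x y \<le>
      real k * of_bool (b < threshold k) - real (Suc k) * of_bool (b < threshold (Suc k))" for b
    using coalesce height_dist_lower_x[of E] threshold_antimono[OF k] height_dist_xy y_tower card_y
    by (auto simp: tower_flip_def k_def)
  then have "drift 1 E x y \<le>
      (\<Sum>b<coin_bound. real k * of_bool (b < threshold k) - real (Suc k) * of_bool (b < threshold (Suc k)))"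
    unfolding drift_def by (intro sum_mono)
  also have "\<dots> = real k * threshold k - real (Suc k) * threshold (Suc k)"
    by (simp only: sum_subtractf sum_distrib_left[symmetric] sum_coins_less[OF threshold_le])
  also have "\<dots> \<le> coin_bound * (of_bool (k = 1) / 3)"
    using threshold_one_real threshold_ge_two[of k] threshold_ge_two[of "Suc k"] k k_S
    by (cases "k = 1") auto
  finally show ?thesis by (simp add: k_def)
qed

lemma drift_blocked:
  assumes y_tower: "tower_set y E = {}" and card: "2 \<le> card (tower_set x E)"
  shows "drift 1 E x y \<le> coin_bound / 6"
proof -
  define k where "k = card (tower_set x E)"
  have "height_dist (tower_move (1, E, b) x) (tower_move (1, E, b) y) - height_dist x y \<le>
      real k * of_bool (b < threshold k)" for b
    using height_dist_lower_x[of E] height_dist_xy y_tower by (auto simp: tower_flip_def k_def)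
  then have "drift 1 E x y \<le> (\<Sum>b<coin_bound. real k * of_bool (b < threshold k))"
    unfolding drift_def by (intro sum_mono)
  also have "\<dots> = real k * threshold k"
    by (simp only: sum_distrib_left[symmetric] sum_coins_less[OF threshold_le])
  also have "\<dots> = coin_bound / 6"
    using threshold_ge_two[of k] card card_tower_set_le[of x E] by (simp add: k_def)
  finally show ?thesis .
qed

lemma drift_le:
  assumes E: "E \<in> S"
  shows "drift 1 E x y \<le> coin_bound
      * (of_bool (E \<in> extended) / 3 + of_bool (E \<in> blocked) / 6 - of_bool (E = F) / 2)"
proof (cases "E = F")
  case True
  then have "E \<notin> extended" "E \<notin> blocked" using tower_set_F by (auto simp: extended_def blocked_def)
  then show ?thesis using True drift_at_F by simp
next
  case False
  then show ?thesis
  proof (cases rule: tower_set_cases)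
    case same
    then show ?thesis using drift_same_tower[of 1 x E y] False by simp
  next
    case extended
    then have "of_bool (card (tower_set x E) = 1) = (of_bool (E \<in> extended) :: real)" "E \<notin> blocked"
      using E False by (simp_all add: extended_def blocked_def)
    then show ?thesis using drift_extended[OF extended(1,2)] False by simp
  next
    case (blocked c a b k m)
    then have "2 \<le> card (tower_set x E)" using card_tower_set[OF blocked(2)] by simp
    then show ?thesis using drift_blocked blocked(1) E False by (simp add: extended_def blocked_def)
  qed
qed

lemma sum_drift_le: "(\<Sum>E\<in>S. drift 1 E x y) \<le> coin_bound * (cost / 6 - 1 / 2)"
proof -
  have count: "(\<Sum>E\<in>S. of_bool (E \<in> A)) = real (card A)" if "A \<subseteq> S" for A
    using that finite_S by (simp add: of_bool_def sum.If_cases Int_absorb1)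
  have "(\<Sum>E\<in>S. drift 1 E x y) \<le>
      (\<Sum>E\<in>S. coin_bound * (of_bool (E \<in> extended) / 3 + of_bool (E \<in> blocked) / 6 - of_bool (E \<in> {F}) / 2))"
    using drift_le by (intro sum_mono) simp
  also have "\<dots> = coin_bound * ((\<Sum>E\<in>S. of_bool (E \<in> extended)) / 3 +
      (\<Sum>E\<in>S. of_bool (E \<in> blocked)) / 6 - (\<Sum>E\<in>S. of_bool (E \<in> {F})) / 2)"
    by (simp only: sum.distrib sum_subtractf sum_distrib_left[symmetric]
        sum_divide_distrib[symmetric])
  also have "\<dots> = coin_bound * (cost / 6 - 1 / 2)"
    using count[OF extended_subset] count[OF blocked_subset] count[of "{F}"] F
    by (simp only: cost_def) (simp add: field_simps)
  finally show ?thesis .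
qed

lemma sum_signed_drift_le: "(\<Sum>s\<in>signs. \<Sum>E\<in>S. drift s E x y) \<le> 0"
proof -
  interpret neg: flip_pair S "scale (- 1) y" "scale (- 1) x" F by (rule flip_pair_negated)
  have "(\<Sum>s\<in>signs. \<Sum>E\<in>S. drift s E x y) =
      (\<Sum>E\<in>S. drift 1 E x y) + (\<Sum>E\<in>S. drift 1 E (scale (- 1) y) (scale (- 1) x))"
    by (simp add: drift_negate)
  also have "\<dots> \<le> coin_bound * (cost / 6 - 1 / 2) + coin_bound * (neg.cost / 6 - 1 / 2)"
    by (intro add_mono sum_drift_le neg.sum_drift_le)
  also have "\<dots> = coin_bound * (real (cost + neg.cost) / 6 - 1)" by (simp add: field_simps)
  also have "\<dots> \<le> 0" using cost_add_le by (intro mult_nonneg_nonpos) auto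
  finally show ?thesis .
qed

end

context region
begin

lemma sum_drift_nonpos:
  assumes "x \<in> heights" "y \<in> heights"
  shows "(\<Sum>s\<in>signs. \<Sum>E\<in>S. drift s E x y) \<le> 0"
  using assms
proof (induction "nat \<lceil>height_dist x y\<rceil>" arbitrary: x rule: less_induct)
  case less
  show ?case
  proof (cases "x = y")
    case True
    then show ?thesis by (simp add: drift_def)
  next
    case False
    obtain F z where flip: "flip_pair S x z F \<or> flip_pair S z x F" and z: "z \<in> heights"
      and closer: "height_dist z y = height_dist x y - 1"
      using ex_flip_closer[OF less.prems False] by blast
    have "1 \<le> height_dist x y" using height_dist_ge_one[OF less.prems False] .
    then have "nat \<lceil>height_dist z y\<rceil> < nat \<lceil>height_dist x y\<rceil>" using closer by linarith
    then have rest: "(\<Sum>s\<in>signs. \<Sum>E\<in>S. drift s E z y) \<le> 0" using less.hyps z less.prems(2) by blast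
    have first: "(\<Sum>s\<in>signs. \<Sum>E\<in>S. drift s E x z) \<le> 0"
      using flip flip_pair.sum_signed_drift_le drift_commute by (metis (no_types, lifting) sum.cong)
    have "height_dist x z = 1"
      using flip flip_pair.height_dist_xy height_dist_commute by metis
    then have "height_dist x y = height_dist x z + height_dist z y" using closer by simp
    then have "(\<Sum>s\<in>signs. \<Sum>E\<in>S. drift s E x y) \<le> (\<Sum>s\<in>signs. \<Sum>E\<in>S. drift s E x z + drift s E z y)"
      by (intro sum_mono drift_triangle)
    also have "\<dots> = (\<Sum>s\<in>signs. \<Sum>E\<in>S. drift s E x z) + (\<Sum>s\<in>signs. \<Sum>E\<in>S. drift s E z y)"
      by (simp only: sum.distrib)
    finally show ?thesis using first rest by linarith
  qed
qed

subsection \<open>The fluctuation of the distance\<close>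

definition complementary :: "height \<Rightarrow> height \<Rightarrow> int \<Rightarrow> tri \<Rightarrow> bool" where
  "complementary x y s E \<longleftrightarrow> x E \<noteq> y E \<and> signed_tower s x E = {E} \<and> signed_tower s y E = {E}"

text \<open>The coupling uses a common coin, except that two single flips at a triangle where the heights
  differ use complementary coins, so that exactly one of them is accepted. This does not change the
  expected distance but guarantees that the distance fluctuates.\<close>

fun second_coin :: "height \<Rightarrow> height \<Rightarrow> int \<times> tri \<times> nat \<Rightarrow> int \<times> tri \<times> nat" where
  "second_coin x y (s, E, b) = (s, E, if complementary x y s E then coin_bound - Suc b else b)"

lemma second_coin_coins: "\<omega> \<in> coins \<Longrightarrow> second_coin x y \<omega> \<in> coins"
  by (auto simp: coins_def)

lemma sum_second_coin: "(\<Sum>\<omega>\<in>coins. g (second_coin x y \<omega>)) = (\<Sum>\<omega>\<in>coins. g \<omega> :: real)"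
proof -
  have "(\<Sum>b<coin_bound. g (second_coin x y (s, E, b))) = (\<Sum>b<coin_bound. g (s, E, b))" for s E
    using sum.nat_diff_reindex[of "\<lambda>b. g (s, E, b)" coin_bound]
    by (cases "complementary x y s E") simp_all
  then show ?thesis by (simp only: sum_coins)
qed

definition coupled_change :: "height \<Rightarrow> height \<Rightarrow> int \<times> tri \<times> nat \<Rightarrow> real" where
  "coupled_change x y \<omega> = height_dist (tower_move \<omega> x) (tower_move (second_coin x y \<omega>) y)
      - height_dist x y"

lemma height_dist_single_flip:
  assumes E: "E \<in> S" and s: "s \<in> signs" and x: "x \<in> heights" and y: "y \<in> heights"
    and neq: "x E \<noteq> y E"
  obtains \<sigma> :: real where "\<sigma>\<^sup>2 = 1" "height_dist (lower s {E} x) y = height_dist x y + \<sigma>"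
    "height_dist x (lower s {E} y) = height_dist x y - \<sigma>"
proof -
  define a where "a = x E - y E"
  have "even a" "a \<noteq> 0" using heights_parity[OF x y, of E] neq by (auto simp: a_def)
  then have a: "a \<le> - 2 \<or> 2 \<le> a" by presburger
  define \<sigma> :: real where "\<sigma> = (\<bar>real_of_int (a - 2 * s)\<bar> - \<bar>real_of_int a\<bar>) / 2"
  have first: "height_dist (lower s {E} x) y = height_dist x y + \<sigma>"
    unfolding lower_singleton height_dist_upd[OF E] \<sigma>_def a_def by (simp add: algebra_simps)
  have "height_dist x (lower s {E} y)
      = height_dist x y + (\<bar>real_of_int (a + 2 * s)\<bar> - \<bar>real_of_int a\<bar>) / 2"
    unfolding lower_singleton height_dist_commute[of x] height_dist_upd[OF E] a_def
    by (simp add: algebra_simps abs_minus_commute)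
  moreover have "(\<bar>real_of_int (a + 2 * s)\<bar> - \<bar>real_of_int a\<bar>) / 2 = - \<sigma>" and "\<sigma>\<^sup>2 = 1"
    using a s by (auto simp: \<sigma>_def)
  ultimately show thesis using that first by simp
qed

lemma coupled_change_complementary:
  assumes compl: "complementary x y s E" and "E \<in> S" "s \<in> signs" "x \<in> heights" "y \<in> heights"
  obtains \<sigma> :: real where "\<sigma>\<^sup>2 = 1"
    "\<And>b. b < coin_bound \<Longrightarrow> coupled_change x y (s, E, b) = \<sigma> * (2 * of_bool (b < threshold 1) - 1)"
proof -
  have neq: "x E \<noteq> y E" and single: "signed_tower s x E = {E}" "signed_tower s y E = {E}"
    using compl by (auto simp: complementary_def)
  obtain \<sigma> :: real where \<sigma>: "\<sigma>\<^sup>2 = 1" "height_dist (lower s {E} x) y = height_dist x y + \<sigma>"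
    "height_dist x (lower s {E} y) = height_dist x y - \<sigma>"
    by (rule height_dist_single_flip[OF assms(2-5) neq])
  have "coupled_change x y (s, E, b) = \<sigma> * (2 * of_bool (b < threshold 1) - 1)"
    if "b < coin_bound" for b
  proof -
    have "coin_bound - Suc b < threshold 1 \<longleftrightarrow> \<not> b < threshold 1" using threshold_one that by linarith
    then show ?thesis using compl single \<sigma>(2,3) by (simp add: coupled_change_def tower_flip_def)
  qed
  then show thesis using that \<sigma>(1) by blast
qed

lemma sum_coupled_change_eq_drift:
  assumes "E \<in> S" "s \<in> signs" "x \<in> heights" "y \<in> heights"
  shows "(\<Sum>b<coin_bound. coupled_change x y (s, E, b)) = drift s E x y"
proof (cases "complementary x y s E")
  case True
  then obtain \<sigma> :: real where "\<And>b. b < coin_bound \<Longrightarrow>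
      coupled_change x y (s, E, b) = \<sigma> * (2 * of_bool (b < threshold 1) - 1)"
    using coupled_change_complementary[OF True assms] by blast
  then have "(\<Sum>b<coin_bound. coupled_change x y (s, E, b))
      = \<sigma> * (2 * real (threshold 1) - coin_bound)"
    by (simp add: sum_distrib_left[symmetric] sum_subtractf sum_coins_less[OF threshold_le]
        del: One_nat_def)
  moreover have "drift s E x y = 0"
    using True by (intro drift_same_tower) (simp add: complementary_def)
  ultimately show ?thesis by (simp only: threshold_one_real) simp
next
  case False
  then show ?thesis by (simp add: coupled_change_def drift_def)
qed

lemma sum_coupled_change_nonpos:
  assumes "x \<in> heights" "y \<in> heights"
  shows "(\<Sum>\<omega>\<in>coins. coupled_change x y \<omega>) \<le> 0"
proof -
  have "(\<Sum>\<omega>\<in>coins. coupled_change x y \<omega>) = (\<Sum>s\<in>signs. \<Sum>E\<in>S. drift s E x y)"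
    unfolding sum_coins by (intro sum.cong refl sum_coupled_change_eq_drift assms)
  then show ?thesis using sum_drift_nonpos[OF assms] by simp
qed

lemma coupled_change_single:
  assumes "E \<in> S" "s \<in> signs" "x \<in> heights" "y \<in> heights" and neq: "x E \<noteq> y E"
    and compl: "\<not> complementary x y s E"
    and single: "signed_tower s x E = {E} \<or> signed_tower s y E = {E}"
    and b: "coin_bound \<le> 12 * b" "b < threshold 1"
  shows "(coupled_change x y (s, E, b))\<^sup>2 = 1"
proof -
  obtain \<sigma> :: real where \<sigma>: "\<sigma>\<^sup>2 = 1" "height_dist (lower s {E} x) y = height_dist x y + \<sigma>"
    "height_dist x (lower s {E} y) = height_dist x y - \<sigma>"
    by (rule height_dist_single_flip[OF assms(1-4) neq])
  have rejected: "\<not> b < threshold (card (signed_tower s h E))" if "signed_tower s h E \<noteq> {E}" for h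
  proof -
    have "card (signed_tower s h E) \<noteq> 1" using tower_set_card_1 that by blast
    then have "12 * threshold (card (signed_tower s h E)) \<le> 12 * b"
      using b(1) by (rule order_trans[OF threshold_le_twelfth])
    then show ?thesis by simp
  qed
  show ?thesis
    using single
  proof
    assume x_single: "signed_tower s x E = {E}"
    then have "signed_tower s y E \<noteq> {E}" using compl neq by (auto simp: complementary_def)
    then show ?thesis
      using rejected[of y] compl b x_single \<sigma> by (simp add: coupled_change_def tower_flip_def)
  next
    assume y_single: "signed_tower s y E = {E}"
    then have "signed_tower s x E \<noteq> {E}" using compl neq by (auto simp: complementary_def)
    then show ?thesis
      using rejected[of x] compl b y_single \<sigma> by (simp add: coupled_change_def tower_flip_def)
  qed
qed

lemma sum_sq_coupled_change_ge:
  assumes "E \<in> S" "s \<in> signs" "x \<in> heights" "y \<in> heights" and neq: "x E \<noteq> y E"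
    and single: "signed_tower s x E = {E} \<or> signed_tower s y E = {E}"
  shows "coin_bound / 4 \<le> (\<Sum>b<coin_bound. (coupled_change x y (s, E, b))\<^sup>2)"
proof -
  have "12 dvd coin_bound" unfolding coin_bound_def by (rule dvd_triv_left)
  then obtain n where n: "coin_bound = 12 * n" by blast
  then have half: "threshold 1 = 6 * n" using threshold_one by simp
  have "(coupled_change x y (s, E, b))\<^sup>2 = 1" if b: "b \<in> {n..<6 * n}" for b
  proof (cases "complementary x y s E")
    case True
    moreover have "b < coin_bound" using b n by simp
    ultimately obtain \<sigma> :: real where "\<sigma>\<^sup>2 = 1"
      "coupled_change x y (s, E, b) = \<sigma> * (2 * of_bool (b < threshold 1) - 1)"
      using coupled_change_complementary[OF _ assms(1-4)] by metis
    then show ?thesis by (simp add: power_mult_distrib)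
  next
    case False
    then show ?thesis using coupled_change_single[OF assms(1-4) neq False single] b n half by simp
  qed
  then have "(\<Sum>b\<in>{n..<6 * n}. (coupled_change x y (s, E, b))\<^sup>2) = 5 * n" by simp
  moreover have "(\<Sum>b\<in>{n..<6 * n}. (coupled_change x y (s, E, b))\<^sup>2)
      \<le> (\<Sum>b<coin_bound. (coupled_change x y (s, E, b))\<^sup>2)"
    using n by (intro sum_mono2) auto
  ultimately show ?thesis using n by simp
qed

lemma ex_local_maximum_above:
  assumes x: "x \<in> heights" and y: "y \<in> heights" and less: "x T < y T"
  shows "\<exists>E\<in>S. x E < y E \<and> local_extremum 1 y E"
proof -
  define M where "M = Max ((\<lambda>T. y T - x T) ` S)"
  have T: "T \<in> S" using less heights_neq_in_S[OF x y, of T] by simp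
  have le_M: "y U - x U \<le> M" if "U \<in> S" for U using that finite_S by (simp add: M_def)
  have "0 < M" using le_M[OF T] less by simp
  define B where "B = {T \<in> S. y T - x T = M}"
  have "M \<in> (\<lambda>T. y T - x T) ` S" unfolding M_def using finite_S T by (intro Max_in) auto
  then have "B \<noteq> {}" by (auto simp: B_def)
  moreover have finB: "finite B" using finite_S by (simp add: B_def)
  ultimately have "Max (y ` B) \<in> y ` B" by (intro Max_in) auto
  then obtain E where E: "E \<in> B" "y E = Max (y ` B)" by (metis imageE)
  have E_S: "E \<in> S" and diff_E: "y E - x E = M" using E by (auto simp: B_def)
  have "y (nbr c E) = y E - 1" for c
  proof (rule ccontr)
    assume "y (nbr c E) \<noteq> y E - 1"
    then have up: "y (nbr c E) = y E + 1" using heights_step[OF y E_S] by blast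
    have diff: "M \<le> y (nbr c E) - x (nbr c E)" using up heights_step[OF x E_S, of c] diff_E by auto
    then have "nbr c E \<in> S" using heights_neq_in_S[OF x y, of "nbr c E"] \<open>0 < M\<close> by auto
    then have "nbr c E \<in> B" using diff le_M by (simp add: B_def order_antisym)
    then have "y (nbr c E) \<le> y E" using E(2) finB by simp
    then show False using up by simp
  qed
  then show ?thesis using E_S diff_E \<open>0 < M\<close> by (intro bexI[of _ E]) (auto simp: local_extremum_def)
qed

lemma coupled_change_fluctuates:
  assumes x: "x \<in> heights" and y: "y \<in> heights" and "x \<noteq> y"
  shows "coin_bound / 4 \<le> (\<Sum>\<omega>\<in>coins. (coupled_change x y \<omega>)\<^sup>2)"
proof -
  obtain T where "x T \<noteq> y T" using assms(3) by blast
  then consider "x T < y T" | "y T < x T" by linarith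
  then have "\<exists>E\<in>S. x E \<noteq> y E \<and> (local_extremum 1 x E \<or> local_extremum 1 y E)"
    by cases (use ex_local_maximum_above[OF x y] ex_local_maximum_above[OF y x] in \<open>metis less_irrefl\<close>)+
  then obtain E where E: "E \<in> S" "x E \<noteq> y E" "tower_set x E = {E} \<or> tower_set y E = {E}"
    using tower_set_local_maximum by metis
  let ?q = "\<lambda>s E. \<Sum>b<coin_bound. (coupled_change x y (s, E, b))\<^sup>2"
  have "coin_bound / 4 \<le> ?q 1 E"
    using E by (intro sum_sq_coupled_change_ge x y) auto
  also have "\<dots> \<le> (\<Sum>E\<in>S. ?q 1 E)"
    using finite_S E(1) by (intro member_le_sum[of E S]) (auto intro!: sum_nonneg)
  also have "\<dots> \<le> (\<Sum>s\<in>signs. \<Sum>E\<in>S. ?q s E)"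
    by (simp add: sum_nonneg)
  finally show ?thesis by (simp only: sum_coins)
qed

end

section \<open>The spectral gap of the tower chain\<close>

subsection \<open>Bounds on heights\<close>

fun shift :: "int \<Rightarrow> int \<Rightarrow> tri \<Rightarrow> tri" where
  "shift p q (Tri i j u) = Tri (i + p) (j + q) u"

context region
begin

lemma abs_height_unit_shift:
  assumes h: "h \<in> heights"
  shows "\<bar>h (Tri i j u)\<bar> - 2 \<le> \<bar>h (Tri (i + 1) j u)\<bar>"
    and "\<bar>h (Tri i j u)\<bar> - 2 \<le> \<bar>h (Tri i (j + 1) u)\<bar>"
proof -
  note lipschitz = heights_lipschitz[OF h]
  show "\<bar>h (Tri i j u)\<bar> - 2 \<le> \<bar>h (Tri (i + 1) j u)\<bar>"
    using lipschitz[of Red "Tri i j True"] lipschitz[of Green "Tri i j False"]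
      lipschitz[of Red "Tri (i + 1) j True"] by (cases u) simp_all
  show "\<bar>h (Tri i j u)\<bar> - 2 \<le> \<bar>h (Tri i (j + 1) u)\<bar>"
    using lipschitz[of Red "Tri i j True"] lipschitz[of Blue "Tri i j False"]
      lipschitz[of Red "Tri i (j + 1) True"] by (cases u) simp_all
qed

lemma abs_height_shift:
  assumes h: "h \<in> heights"
  shows "\<bar>h T\<bar> - 2 * (int p + int q) \<le> \<bar>h (shift (int p) (int q) T)\<bar>"
proof -
  obtain i j u where T: "T = Tri i j u" by (cases T)
  have "\<bar>h (Tri i j u)\<bar> - 2 * int p \<le> \<bar>h (Tri (i + int p) j u)\<bar>"
  proof (induction p)
    case (Suc p)
    then show ?case using abs_height_unit_shift(1)[OF h, of "i + int p" j u]
      by (simp add: algebra_simps)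
  qed simp
  moreover have "\<bar>h (Tri (i + int p) j u)\<bar> - 2 * int q \<le> \<bar>h (Tri (i + int p) (j + int q) u)\<bar>"
  proof (induction q)
    case (Suc q)
    then show ?case using abs_height_unit_shift(2)[OF h, of "i + int p" "j + int q" u]
      by (simp add: algebra_simps)
  qed simp
  ultimately show ?thesis by (simp add: T)
qed

text \<open>A triangle of height \<open>m\<close> is the corner of a rhombus of side about \<open>m/4\<close> on which the height
  function does not vanish.\<close>

lemma height_sq_le:
  assumes h: "h \<in> heights"
  shows "(h T)\<^sup>2 \<le> 16 * int (card S)"
proof -
  define m where "m = nat \<bar>h T\<bar>"
  define r where "r = (m + 3) div 4"
  have m: "int m = \<bar>h T\<bar>" by (simp add: m_def)
  have in_S: "shift (int p) (int q) T \<in> S" if "p < r" "q < r" for p q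
  proof -
    have "4 * p < m" "4 * q < m" using that unfolding r_def by presburger+
    then have "2 * (p + q) < m" by presburger
    then have "h (shift (int p) (int q) T) \<noteq> 0"
      using abs_height_shift[OF h, of T p q] m by auto
    then show ?thesis using heights_zero[OF h] by blast
  qed
  have inj: "inj_on (\<lambda>(p, q). shift (int p) (int q) T) ({..<r} \<times> {..<r})"
    by (cases T) (auto intro!: inj_onI)
  have "r * r = card ((\<lambda>(p, q). shift (int p) (int q) T) ` ({..<r} \<times> {..<r}))"
    by (simp add: card_image[OF inj] card_cartesian_product)
  also have "\<dots> \<le> card S"
    using in_S finite_S by (intro card_mono) auto
  finally have "r * r \<le> card S" .
  moreover have "m \<le> 4 * r" unfolding r_def by linarith
  then have "m * m \<le> (4 * r) * (4 * r)" by (intro mult_le_mono)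
  ultimately have "m * m \<le> 16 * card S" by simp
  then have "int m * int m \<le> 16 * int (card S)" by (metis of_nat_le_iff of_nat_mult of_nat_numeral)
  then show ?thesis by (simp add: m power2_eq_square)
qed

lemma abs_height_le:
  assumes "h \<in> heights"
  shows "\<bar>real_of_int (h T)\<bar> \<le> 4 * sqrt (card S)"
proof -
  have "real_of_int ((h T)\<^sup>2) \<le> real_of_int (16 * int (card S))"
    using height_sq_le[OF assms] by (simp only: of_int_le_iff)
  then have "(real_of_int (h T))\<^sup>2 \<le> 16 * real (card S)" by simp
  then have "\<bar>real_of_int (h T)\<bar> \<le> sqrt (16 * real (card S))" using real_le_rsqrt by force
  then show ?thesis by (simp add: real_sqrt_mult)
qed

lemma finite_heights: "finite heights"
proof (rule finite_subset)
  define B where "B = \<lceil>4 * sqrt (card S)\<rceil>"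
  show "heights \<subseteq> {h. \<forall>T. (T \<in> S \<longrightarrow> h T \<in> {- B..B}) \<and> (T \<notin> S \<longrightarrow> h T = 0)}"
  proof (intro subsetI CollectI allI conjI impI)
    fix h T assume "h \<in> heights"
    then show "h T \<in> {- B..B}"
      using abs_height_le[of h T] unfolding B_def atLeastAtMost_iff by linarith
  qed (rule heights_zero)
  show "finite {h. \<forall>T. (T \<in> S \<longrightarrow> h T \<in> {- B..B}) \<and> (T \<notin> S \<longrightarrow> h T = 0)}"
    by (rule finite_set_of_finite_funs[OF finite_S]) simp
qed

lemma height_dist_le:
  assumes x: "x \<in> heights" and y: "y \<in> heights"
  shows "height_dist x y \<le> 4 * (card S * sqrt (card S))"
proof -
  have "\<bar>real_of_int (x T - y T)\<bar> \<le> 8 * sqrt (card S)" for T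
    using abs_height_le[OF x, of T] abs_height_le[OF y, of T] unfolding of_int_diff by linarith
  then have "(\<Sum>T\<in>S. \<bar>real_of_int (x T - y T)\<bar>) \<le> (\<Sum>T\<in>S. 8 * sqrt (card S))"
    by (intro sum_mono)
  then show ?thesis by (simp add: height_dist_def)
qed

lemma tower_length_le:
  assumes h: "h \<in> heights" and tower: "tower h a b k E"
  shows "k \<le> 8 * sqrt (card S)"
proof -
  have "real_of_int (h (strip a b E k)) = real_of_int (h E) + real k"
    using tower_height[OF tower, of k] by simp
  then show ?thesis
    using abs_height_le[OF h, of E] abs_height_le[OF h, of "strip a b E k"] by linarith
qed

subsection \<open>Reversibility\<close>

fun tower_weight :: "int \<times> tri \<Rightarrow> height \<Rightarrow> real" where
  "tower_weight (s, E) h = real (threshold (card (signed_tower s h E)))"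

definition proper_flips :: "(height \<times> int \<times> tri) set" where
  "proper_flips = {(h, s, E). h \<in> heights \<and> s \<in> signs \<and> E \<in> S \<and> signed_tower s h E \<noteq> {}}"

fun reverse_flip :: "height \<times> int \<times> tri \<Rightarrow> height \<times> int \<times> tri" where
  "reverse_flip (h, s, E) = (tower_flip s E h, - s, tower_top (scale s h) E)"

lemma reverse_flip_proper: "z \<in> proper_flips \<Longrightarrow> reverse_flip z \<in> proper_flips"
  using tower_flip_reverse(1,2) tower_flip_heights by (cases z) (auto simp: proper_flips_def)

lemma reverse_flip_reverse_flip: "z \<in> proper_flips \<Longrightarrow> reverse_flip (reverse_flip z) = z"
  using tower_flip_reverse(3,4) by (cases z) (auto simp: proper_flips_def)

lemma sum_tower_weight:
  "(\<Sum>h\<in>heights. \<Sum>i\<in>signs \<times> S. tower_weight i h * \<psi> h (case_prod tower_flip i h)) =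
     (\<Sum>(h, i)\<in>proper_flips. tower_weight i h * \<psi> h (case_prod tower_flip i h))"
proof -
  have "(\<Sum>h\<in>heights. \<Sum>i\<in>signs \<times> S. tower_weight i h * \<psi> h (case_prod tower_flip i h)) =
      (\<Sum>(h, i)\<in>heights \<times> signs \<times> S. tower_weight i h * \<psi> h (case_prod tower_flip i h))"
    by (simp only: sum.cartesian_product)
  also have "\<dots> = (\<Sum>(h, i)\<in>proper_flips. tower_weight i h * \<psi> h (case_prod tower_flip i h))"
    by (intro sum.mono_neutral_right) (auto simp: proper_flips_def finite_heights finite_S)
  finally show ?thesis .
qed

sublocale tower: reversible_moves heights "signs \<times> S" tower_weight "case_prod tower_flip"
  "2 * card S * coin_bound"
proof
  fix \<psi> :: "height \<Rightarrow> height \<Rightarrow> real"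
  have "(\<Sum>(h, i)\<in>proper_flips. tower_weight i h * \<psi> h (case_prod tower_flip i h)) =
      (\<Sum>(h, i)\<in>proper_flips. tower_weight i h * \<psi> (case_prod tower_flip i h) h)"
  proof (rule sum.reindex_bij_witness[of _ reverse_flip reverse_flip])
    fix z assume z: "z \<in> proper_flips"
    then show "reverse_flip z \<in> proper_flips" "reverse_flip (reverse_flip z) = z"
      by (simp_all add: reverse_flip_proper reverse_flip_reverse_flip)
    obtain h s E where "z = (h, s, E)" by (cases z)
    then show "(case reverse_flip z of (h, i) \<Rightarrow> tower_weight i h * \<psi> (case_prod tower_flip i h) h) =
        (case z of (h, i) \<Rightarrow> tower_weight i h * \<psi> h (case_prod tower_flip i h))"
      using z tower_flip_reverse(2,4)[of s h E] by (auto simp: proper_flips_def)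
  qed (simp_all add: reverse_flip_proper reverse_flip_reverse_flip)
  then show "(\<Sum>h\<in>heights. \<Sum>i\<in>signs \<times> S. tower_weight i h * \<psi> h (case_prod tower_flip i h)) =
      (\<Sum>h\<in>heights. \<Sum>i\<in>signs \<times> S. tower_weight i h * \<psi> (case_prod tower_flip i h) h)"
    using sum_tower_weight[of \<psi>] sum_tower_weight[of "\<lambda>x y. \<psi> y x"] by simp
qed

lemma sum_tower_move:
  assumes "S \<noteq> {}"
  shows "(\<Sum>\<omega>\<in>coins. g (tower_move \<omega> h)) = card coins * tower.transition g h"
proof -
  have coins_eq: "(\<Sum>b<coin_bound. g (tower_move (s, E, b) h)) =
      tower_weight (s, E) h * (g (tower_flip s E h) - g h) + coin_bound * g h" for s E
  proof -
    have "g (tower_move (s, E, b) h) =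
        of_bool (b < threshold (card (signed_tower s h E))) * (g (tower_flip s E h) - g h) + g h" for b
      by simp
    then show ?thesis
      by (simp add: sum.distrib sum_distrib_right[symmetric] sum_coins_less[OF threshold_le])
  qed
  have "(\<Sum>\<omega>\<in>coins. g (tower_move \<omega> h)) =
      (\<Sum>(s, E)\<in>signs \<times> S. tower_weight (s, E) h * (g (tower_flip s E h) - g h) + coin_bound * g h)"
    by (simp only: sum_coins coins_eq sum.cartesian_product)
  also have "\<dots> = (\<Sum>i\<in>signs \<times> S. tower_weight i h * (g (case_prod tower_flip i h) - g h))
      + card coins * g h"
    by (simp add: split_def sum.distrib card_cartesian_product card_coins del: tower_weight.simps)
  also have "\<dots> = card coins * tower.transition g h"
    unfolding tower.transition_def card_coins
    using assms finite_S coin_bound_pos by (simp add: distrib_left card_gt_0_iff)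
  finally show ?thesis .
qed

lemma tower_marginals:
  assumes "S \<noteq> {}"
  shows "tower.transition g x - tower.transition g y =
    (\<Sum>\<omega>\<in>coins. g (tower_move \<omega> x) - g (tower_move (second_coin x y \<omega>) y)) / card coins"
proof -
  have "(\<Sum>\<omega>\<in>coins. g (tower_move \<omega> x) - g (tower_move (second_coin x y \<omega>) y)) =
      card coins * tower.transition g x - card coins * tower.transition g y"
    using sum_second_coin[of "\<lambda>\<omega>. g (tower_move \<omega> y)" x y]
    by (simp add: sum_subtractf sum_tower_move[OF assms])
  moreover have "card coins \<noteq> 0"
    using assms finite_S coin_bound_pos by (simp add: card_coins)
  ultimately show ?thesis by (simp add: diff_divide_distrib)
qed

lemma tower_fluctuating_coupling:
  assumes S: "S \<noteq> {}"
  defines "n \<equiv> real (card S)"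
  shows "fluctuating_coupling heights (signs \<times> S) tower_weight (case_prod tower_flip) (2 * card S * coin_bound)
    coins (\<lambda>x y \<omega>. tower_move \<omega> x) (\<lambda>x y \<omega>. tower_move (second_coin x y \<omega>) y)
    height_dist (4 * (n * sqrt n)) (1 / (8 * n))"
proof
  have n: "1 \<le> n" using S finite_S by (simp add: n_def Suc_le_eq card_gt_0_iff)
  show "finite heights" "finite coins" "coins \<noteq> {}"
    using S coin_bound_pos finite_heights finite_coins by (auto simp: coins_def)
  show "0 < 4 * (n * sqrt n)" "0 \<le> 1 / (8 * n)" using n by simp_all
  have "1 / (8 * n) \<le> 1" using n by (simp add: divide_le_eq)
  also have "1 \<le> (4 * (n * sqrt n))\<^sup>2"
  proof -
    have "1 * 1 \<le> n * sqrt n" using n by (intro mult_mono) auto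
    then show ?thesis by (intro one_le_power) simp
  qed
  finally show "1 / (8 * n) \<le> (4 * (n * sqrt n))\<^sup>2" .
  fix x y assume x: "x \<in> heights" and y: "y \<in> heights"
  show "tower_move \<omega> x \<in> heights \<and> tower_move (second_coin x y \<omega>) y \<in> heights" if "\<omega> \<in> coins" for \<omega>
    using that x y by (simp add: tower_move_heights second_coin_coins)
  show "tower.transition g x - tower.transition g y =
      (\<Sum>\<omega>\<in>coins. g (tower_move \<omega> x) - g (tower_move (second_coin x y \<omega>) y)) / card coins" for g
    by (rule tower_marginals[OF S])
  show "height_dist x y \<le> 4 * (n * sqrt n)"
    using height_dist_le[OF x y] by (simp add: n_def)
  show "(\<Sum>\<omega>\<in>coins. height_dist (tower_move \<omega> x) (tower_move (second_coin x y \<omega>) y)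
      - height_dist x y) \<le> 0"
    using sum_coupled_change_nonpos[OF x y] by (simp add: coupled_change_def)
  assume neq: "x \<noteq> y"
  then show "1 \<le> height_dist x y" by (rule height_dist_ge_one[OF x y])
  have "1 / (8 * n) * card coins = coin_bound / 4"
    using n by (simp add: card_coins n_def field_simps)
  then show "1 / (8 * n) * card coins \<le>
      (\<Sum>\<omega>\<in>coins. (height_dist (tower_move \<omega> x) (tower_move (second_coin x y \<omega>) y) - height_dist x y)\<^sup>2)"
    using coupled_change_fluctuates[OF x y neq] by (simp add: coupled_change_def)
qed simp

theorem tower_spectral_gap:
  assumes "S \<noteq> {}"
  shows "tower.spectral_gap (1 / (128 * real (card S) ^ 4))"
proof -
  interpret fluctuating_coupling heights "signs \<times> S" tower_weight "case_prod tower_flip"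
    "2 * card S * coin_bound"
    coins "\<lambda>x y \<omega>. tower_move \<omega> x" "\<lambda>x y \<omega>. tower_move (second_coin x y \<omega>) y"
    height_dist "4 * (card S * sqrt (card S))" "1 / (8 * real (card S))"
    by (rule tower_fluctuating_coupling[OF assms])
  have "1 / (8 * real (card S)) / (4 * (card S * sqrt (card S)))\<^sup>2 = 1 / (128 * real (card S) ^ 4)"
    by (simp add: power_mult_distrib power2_eq_square power4_eq_xxxx)
  then show ?thesis using spectral_gap_ge by simp
qed

end

section \<open>Comparison with single flips\<close>

context region
begin

sublocale flip: reversible_moves heights S "\<lambda>_ _. 1" flip_at "2 * card S"
  by (rule reversible_moves_involutions) (simp_all add: flip_at_heights flip_at_flip_at)

definition flip_energy :: "(height \<Rightarrow> real) \<Rightarrow> tri \<Rightarrow> height \<Rightarrow> real" where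
  "flip_energy g T h = (g h - g (flip_at T h))\<^sup>2"

lemma flip_energy_nonneg: "0 \<le> flip_energy g T h"
  by (simp add: flip_energy_def)

lemma flip_dirichlet: "flip.dirichlet g = (\<Sum>h\<in>heights. \<Sum>T\<in>S. flip_energy g T h) / (4 * card S)"
  unfolding flip.dirichlet_def flip_energy_def by simp

definition step_energy :: "(height \<Rightarrow> real) \<Rightarrow> int \<Rightarrow> colour \<Rightarrow> colour \<Rightarrow> nat \<Rightarrow> nat \<Rightarrow> tri \<Rightarrow> height \<Rightarrow> real" where
  "step_energy g s a b k j E h = flip_energy g (strip a b E j) (lower_from (Suc j) s a b k E h)"

lemma tower_flip_energy_le:
  assumes s: "s \<in> signs" and tower: "tower (scale s h) a b k E"
  shows "(g h - g (tower_flip s E h))\<^sup>2 \<le> Suc k * (\<Sum>j\<le>k. step_energy g s a b k j E h)"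
proof -
  let ?h = "\<lambda>j. lower_from j s a b k E h"
  have "g h - g (tower_flip s E h) = g (?h (Suc k)) - g (?h 0)"
    by (simp add: lower_from_zero[OF tower])
  also have "\<dots> = (\<Sum>j\<le>k. g (?h (Suc j)) - g (?h j))"
    using sum_lessThan_telescope[of "\<lambda>j. g (?h j)" "Suc k"] by (simp add: lessThan_Suc_atMost)
  finally have "(g h - g (tower_flip s E h))\<^sup>2 \<le> Suc k * (\<Sum>j\<le>k. (g (?h (Suc j)) - g (?h j))\<^sup>2)"
    using Cauchy_Schwarz_ineq_sum[of "\<lambda>_. 1" "\<lambda>j. g (?h (Suc j)) - g (?h j)" "{..k}"] by simp
  also have "(\<Sum>j\<le>k. (g (?h (Suc j)) - g (?h j))\<^sup>2) = (\<Sum>j\<le>k. step_energy g s a b k j E h)"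
    using lower_from_eq_flip_at[OF s tower]
    by (intro sum.cong refl) (simp add: step_energy_def flip_energy_def)
  finally show ?thesis .
qed

text \<open>Every flip \<open>(z, T)\<close> occurs at most once in position \<open>j\<close> of a tower move of given colours and
  length: the last element is found by walking down the strip from \<open>T\<close>, and the initial state by
  undoing the flips above \<open>T\<close>.\<close>

lemma step_energy_congestion:
  assumes s: "s \<in> signs" and j: "j \<le> k"
  shows "(\<Sum>(h, E)\<in>heights \<times> S. of_bool (tower (scale s h) a b k E) * step_energy g s a b k j E h)
    \<le> (\<Sum>h\<in>heights. \<Sum>T\<in>S. flip_energy g T h)"
proof -
  define towers where "towers = {(h, E) \<in> heights \<times> S. tower (scale s h) a b k E}"
  define flip where "flip = (\<lambda>(h, E). (lower_from (Suc j) s a b k E h, strip a b E j))"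
  have inj: "inj_on flip towers"
  proof (intro inj_onI)
    fix u v assume flips_eq: "flip u = flip v"
    obtain h E h' E' where uv: "u = (h, E)" "v = (h', E')" by (cases u, cases v)
    have "strip a b E j = strip a b E' j" using flips_eq by (simp add: uv flip_def)
    then have "E = E'" by (rule strip_left_cancel)
    moreover from this have "h = h'"
      using flips_eq lower_left_cancel by (auto simp: uv flip_def lower_from_def)
    ultimately show "u = v" by (simp add: uv)
  qed
  have flips: "flip ` towers \<subseteq> heights \<times> S"
    using lower_from_heights[of _ s a b k _ "Suc j"] towerD(1) s j
    by (auto simp: towers_def flip_def)
  have "(\<Sum>(h, E)\<in>heights \<times> S. of_bool (tower (scale s h) a b k E) * step_energy g s a b k j E h) =
      (\<Sum>u\<in>towers. case flip u of (z, T) \<Rightarrow> flip_energy g T z)"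
    using finite_heights finite_S
    by (intro sum.mono_neutral_cong_right) (auto simp: towers_def flip_def step_energy_def)
  also have "\<dots> = (\<Sum>(z, T)\<in>flip ` towers. flip_energy g T z)"
    by (simp add: sum.reindex[OF inj])
  also have "\<dots> \<le> (\<Sum>(z, T)\<in>heights \<times> S. flip_energy g T z)"
    using flips finite_heights finite_S by (intro sum_mono2) (auto simp: flip_energy_nonneg)
  finally show ?thesis by (simp only: sum.cartesian_product)
qed

lemma threshold_mult_le:
  assumes k: "k \<le> card S"
  shows "real (threshold k) * real k \<le> coin_bound / 2"
proof -
  consider (zero) "k = 0" | (one) "k = 1" | (large) "2 \<le> k" by linarith
  then show ?thesis
  proof cases
    case one
    then show ?thesis using threshold_one_real by simp
  next
    case large
    then show ?thesis using threshold_ge_two[of k] k by (simp add: mult.commute)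
  qed simp
qed

definition tower_shapes :: "(colour \<times> colour \<times> nat \<times> nat) set" where
  "tower_shapes = {(a, b, k, j). k \<le> 8 * sqrt (card S) \<and> j \<le> k}"

lemma tower_shapes_subset:
  "tower_shapes \<subseteq> UNIV \<times> UNIV \<times> {..nat \<lfloor>8 * sqrt (card S)\<rfloor>} \<times> {..nat \<lfloor>8 * sqrt (card S)\<rfloor>}"
proof -
  have "l \<le> nat \<lfloor>8 * sqrt (card S)\<rfloor>" if "real l \<le> 8 * sqrt (card S)" for l
    using that by (simp add: le_nat_floor)
  then show ?thesis unfolding tower_shapes_def by fastforce
qed

lemma finite_tower_shapes: "finite tower_shapes"
  using tower_shapes_subset by (rule finite_subset) simp

lemma card_tower_shapes_le:
  assumes "S \<noteq> {}"
  shows "card tower_shapes \<le> 729 * real (card S)"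
proof -
  let ?l = "nat \<lfloor>8 * sqrt (card S)\<rfloor>"
  have "1 \<le> real (card S)" using assms finite_S by (simp add: Suc_le_eq card_gt_0_iff)
  then have "1 \<le> sqrt (card S)" by simp
  then have length: "real (Suc ?l) \<le> 9 * sqrt (card S)" by linarith
  have "card tower_shapes \<le> card ((UNIV :: colour set) \<times> (UNIV :: colour set) \<times> {..?l} \<times> {..?l})"
    using tower_shapes_subset by (rule card_mono[rotated]) simp
  also have "\<dots> = 9 * (Suc ?l)\<^sup>2"
    by (simp add: card_cartesian_product UNIV_colour power2_eq_square)
  finally have "real (card tower_shapes) \<le> real (9 * (Suc ?l)\<^sup>2)" by (simp only: of_nat_le_iff)
  also have "\<dots> = 9 * (real (Suc ?l))\<^sup>2" by simp
  also have "\<dots> \<le> 9 * (9 * sqrt (card S))\<^sup>2"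
    using length by (intro mult_left_mono power_mono) simp_all
  finally show ?thesis by (simp add: power_mult_distrib)
qed

lemma tower_energy_le:
  assumes h: "h \<in> heights" and s: "s \<in> signs"
  shows "tower_weight (s, E) h * (g h - g (tower_flip s E h))\<^sup>2 \<le> coin_bound / 2 *
    (\<Sum>(a, b, k, j)\<in>tower_shapes. of_bool (tower (scale s h) a b k E) * step_energy g s a b k j E h)"
    (is "_ \<le> _ * (\<Sum>i\<in>_. ?e i)")
proof (cases "signed_tower s h E = {}")
  case True
  then show ?thesis
    by (auto simp: step_energy_def flip_energy_nonneg intro!: mult_nonneg_nonneg sum_nonneg)
next
  case False
  then obtain a b k where tower: "tower (scale s h) a b k E" by (metis tower_setE)
  define energy where "energy = (\<Sum>j\<le>k. step_energy g s a b k j E h)"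
  have card: "card (signed_tower s h E) = Suc k" using card_tower_set[OF tower] .
  have shapes: "(\<lambda>j. (a, b, k, j)) ` {..k} \<subseteq> tower_shapes"
    using tower_length_le[OF scale_heights[OF h s] tower] by (auto simp: tower_shapes_def)
  have "tower_weight (s, E) h * (g h - g (tower_flip s E h))\<^sup>2
      \<le> real (threshold (Suc k)) * (real (Suc k) * energy)"
    using tower_flip_energy_le[OF s tower, of g] unfolding tower_weight.simps card energy_def
    by (intro mult_left_mono) auto
  also have "\<dots> = real (threshold (Suc k)) * real (Suc k) * energy" by (rule mult.assoc[symmetric])
  also have "\<dots> \<le> coin_bound / 2 * energy"
    using threshold_mult_le[of "Suc k"] card_tower_set_le[of "scale s h" E] card
    by (intro mult_right_mono) (auto simp: energy_def step_energy_def flip_energy_nonneg sum_nonneg)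
  also have "energy = (\<Sum>i\<in>(\<lambda>j. (a, b, k, j)) ` {..k}. ?e i)"
    using tower by (subst sum.reindex) (auto simp: inj_on_def energy_def)
  also have "\<dots> \<le> (\<Sum>i\<in>tower_shapes. ?e i)"
    using finite_tower_shapes shapes
    by (intro sum_mono2) (auto simp: step_energy_def flip_energy_nonneg)
  finally show ?thesis by (simp add: mult_left_mono)
qed

lemma sum_tower_energy_le:
  assumes s: "s \<in> signs"
  shows "(\<Sum>(h, E)\<in>heights \<times> S. tower_weight (s, E) h * (g h - g (tower_flip s E h))\<^sup>2)
    \<le> coin_bound / 2 * card tower_shapes * (\<Sum>h\<in>heights. \<Sum>T\<in>S. flip_energy g T h)"
    (is "_ \<le> _ * ?total")
proof -
  define e where "e = (\<lambda>(a, b, k, j) (h, E). of_bool (tower (scale s h) a b k E)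
      * step_energy g s a b k j E h)"
  have "(\<Sum>(h, E)\<in>heights \<times> S. tower_weight (s, E) h * (g h - g (tower_flip s E h))\<^sup>2)
      \<le> (\<Sum>z\<in>heights \<times> S. coin_bound / 2 * (\<Sum>i\<in>tower_shapes. e i z))"
    using tower_energy_le[OF _ s] by (intro sum_mono) (auto simp: e_def split_def)
  also have "\<dots> = coin_bound / 2 * (\<Sum>i\<in>tower_shapes. \<Sum>z\<in>heights \<times> S. e i z)"
    by (simp only: sum_distrib_left[symmetric] sum.swap[of _ "heights \<times> S"])
  also have "\<dots> \<le> coin_bound / 2 * (\<Sum>i\<in>tower_shapes. ?total)"
  proof (intro mult_left_mono sum_mono)
    fix i assume "i \<in> tower_shapes"
    then obtain a b k j where "i = (a, b, k, j)" "j \<le> k" by (auto simp: tower_shapes_def)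
    then show "(\<Sum>z\<in>heights \<times> S. e i z) \<le> ?total"
      using step_energy_congestion[OF s, of j k a b g] by (simp add: e_def split_def)
  qed simp
  finally show ?thesis by simp
qed

lemma tower_dirichlet_le:
  assumes S: "S \<noteq> {}"
  shows "tower.dirichlet g \<le> 729 * card S * flip.dirichlet g"
proof -
  define total where "total = (\<Sum>h\<in>heights. \<Sum>T\<in>S. flip_energy g T h)"
  have total: "0 \<le> total" by (simp add: total_def sum_nonneg flip_energy_nonneg)
  have n: "0 < real (card S)" "0 < real coin_bound"
    using S finite_S coin_bound_pos by (auto simp: card_gt_0_iff)
  define e where "e h i = tower_weight i h * (g h - g (case_prod tower_flip i h))\<^sup>2" for h i
  have "(\<Sum>h\<in>heights. \<Sum>i\<in>signs \<times> S. e h i) = (\<Sum>h\<in>heights. \<Sum>s\<in>signs. \<Sum>E\<in>S. e h (s, E))"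
    by (simp only: sum.cartesian_product split_def prod.collapse)
  also have "\<dots> = (\<Sum>s\<in>signs. \<Sum>h\<in>heights. \<Sum>E\<in>S. e h (s, E))"
    by (rule sum.swap)
  also have "\<dots> = (\<Sum>s\<in>signs. \<Sum>(h, E)\<in>heights \<times> S. tower_weight (s, E) h
      * (g h - g (tower_flip s E h))\<^sup>2)"
    by (simp only: sum.cartesian_product e_def case_prod_conv)
  also have "\<dots> \<le> (\<Sum>s\<in>signs. coin_bound / 2 * card tower_shapes * total)"
    unfolding total_def by (intro sum_mono sum_tower_energy_le)
  also have "\<dots> = real coin_bound * real (card tower_shapes) * total" by simp
  also have "\<dots> \<le> real coin_bound * (729 * real (card S)) * total"
    using card_tower_shapes_le[OF S] total by (intro mult_right_mono mult_left_mono) auto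
  finally have "tower.dirichlet g
      \<le> real coin_bound * (729 * real (card S)) * total / (2 * real (2 * card S * coin_bound))"
    unfolding tower.dirichlet_def e_def by (intro divide_right_mono) auto
  also have "\<dots> = 729 * card S * (total / (4 * card S))" using n by simp
  finally show ?thesis by (simp only: flip_dirichlet total_def)
qed

theorem flip_spectral_gap:
  assumes S: "S \<noteq> {}"
  shows "flip.spectral_gap (1 / (93312 * real (card S) ^ 5))"
  unfolding flip.spectral_gap_def
proof (intro allI impI)
  fix g :: "height \<Rightarrow> real" assume "(\<Sum>h\<in>heights. g h) = 0"
  then have "1 / (128 * real (card S) ^ 4) * (\<Sum>h\<in>heights. (g h)\<^sup>2)
      \<le> 729 * card S * flip.dirichlet g"
    by (rule order_trans[OF tower.spectral_gapD[OF tower_spectral_gap[OF S]] tower_dirichlet_le[OF S]])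
  moreover have "0 < real (card S)" using S finite_S by (simp add: card_gt_0_iff)
  ultimately show "1 / (93312 * real (card S) ^ 5) * (\<Sum>h\<in>heights. (g h)\<^sup>2) \<le> flip.dirichlet g"
    by (simp add: power_Suc2[of _ 4, simplified] field_simps)
qed

end

section \<open>Geometry of the triangular lattice\<close>

subsection \<open>Open and closed triangles\<close>

definition xcoord :: "complex \<Rightarrow> real" where "xcoord z = Re z - Im z / sqrt 3"
definition ycoord :: "complex \<Rightarrow> real" where "ycoord z = 2 * Im z / sqrt 3"

lemma xcoord_embed [simp]: "xcoord (embed v) = fst v"
  and ycoord_embed [simp]: "ycoord (embed v) = snd v"
  by (simp_all add: xcoord_def ycoord_def embed_def cos_60 sin_60)

lemma xcoord_linear [simp]:
  "xcoord (z + w) = xcoord z + xcoord w" "xcoord (z - w) = xcoord z - xcoord w"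
    "xcoord (r *\<^sub>R z) = r * xcoord z"
  and ycoord_linear [simp]:
  "ycoord (z + w) = ycoord z + ycoord w" "ycoord (z - w) = ycoord z - ycoord w"
    "ycoord (r *\<^sub>R z) = r * ycoord z"
  by (simp_all add: xcoord_def ycoord_def add_divide_distrib diff_divide_distrib algebra_simps)

lemma continuous_xcoord [continuous_intros]: "continuous_on A xcoord"
  and continuous_ycoord [continuous_intros]: "continuous_on A ycoord"
  by (simp_all add: xcoord_def[abs_def] ycoord_def[abs_def] continuous_intros)

lemma coords_eqI: "xcoord z = xcoord w \<Longrightarrow> ycoord z = ycoord w \<Longrightarrow> z = w"
  by (rule complex_eqI) (simp_all add: xcoord_def ycoord_def)

definition of_coords :: "real \<Rightarrow> real \<Rightarrow> complex" where
  "of_coords x y = Complex (x + y / 2) (y * sqrt 3 / 2)"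

lemma xcoord_of_coords [simp]: "xcoord (of_coords x y) = x"
  and ycoord_of_coords [simp]: "ycoord (of_coords x y) = y"
  by (simp_all add: xcoord_def ycoord_def of_coords_def)

lemma abs_xcoord_le: "\<bar>xcoord z\<bar> \<le> 2 * norm z" and abs_ycoord_le: "\<bar>ycoord z\<bar> \<le> 2 * norm z"
proof -
  have "\<bar>Im z\<bar> / sqrt 3 \<le> \<bar>Im z\<bar> / 1" by (intro divide_left_mono) auto
  then have "\<bar>Im z / sqrt 3\<bar> \<le> norm z" using abs_Im_le_cmod[of z] by simp
  then show "\<bar>xcoord z\<bar> \<le> 2 * norm z" "\<bar>ycoord z\<bar> \<le> 2 * norm z"
    using abs_Re_le_cmod[of z] unfolding xcoord_def ycoord_def by linarith+
qed

fun open_tri :: "tri \<Rightarrow> complex set" where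
  "open_tri (Tri i j u) = (if u then {z. i < xcoord z \<and> j < ycoord z \<and> xcoord z + ycoord z < i + j + 1}
     else {z. xcoord z < i + 1 \<and> ycoord z < j + 1 \<and> i + j + 1 < xcoord z + ycoord z})"

fun closed_tri :: "tri \<Rightarrow> complex set" where
  "closed_tri (Tri i j u) = (if u then {z. i \<le> xcoord z \<and> j \<le> ycoord z \<and> xcoord z + ycoord z \<le> i + j + 1}
     else {z. xcoord z \<le> i + 1 \<and> ycoord z \<le> j + 1 \<and> i + j + 1 \<le> xcoord z + ycoord z})"

lemma open_tri_subset_closed_tri: "open_tri T \<subseteq> closed_tri T"
  by (cases T) auto

lemma open_open_tri: "open (open_tri T)"
  by (cases T) (auto intro!: open_Collect_conj open_Collect_less continuous_intros)

lemma closed_closed_tri: "closed (closed_tri T)"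
  by (cases T) (auto intro!: closed_Collect_conj closed_Collect_le continuous_intros)

lemma closed_tri_box:
  assumes "z \<in> closed_tri (Tri i j u)"
  shows "i \<le> xcoord z" "xcoord z \<le> i + 1" "j \<le> ycoord z" "ycoord z \<le> j + 1"
  using assms by (auto split: if_splits)

definition centroid :: "tri \<Rightarrow> complex" where
  "centroid T = (if upward T then of_coords (tcol T + 1 / 3) (trow T + 1 / 3)
     else of_coords (tcol T + 2 / 3) (trow T + 2 / 3))"

lemma centroid_in_open_tri: "centroid T \<in> open_tri T"
  by (cases T) (auto simp: centroid_def)

lemma segment_into_open_tri:
  assumes z: "z \<in> closed_tri T" and w: "w \<in> open_tri T" and t: "0 < t" "t \<le> 1"
  shows "(1 - t) *\<^sub>R z + t *\<^sub>R w \<in> open_tri T"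
proof -
  have less: "(1 - t) * a + t * b < (c::real)" if "a \<le> c" "b < c" for a b c
  proof -
    have "(1 - t) * a \<le> (1 - t) * c" "t * b < t * c" using that t by (auto intro: mult_left_mono)
    then show ?thesis by (simp add: algebra_simps)
  qed
  have greater: "(c::real) < (1 - t) * a + t * b" if "c \<le> a" "c < b" for a b c
    using less[of "- a" "- c" "- b"] that by simp
  have "(1 - t) * a + t * b + ((1 - t) * a' + t * b')
      = (1 - t) * (a + a') + t * (b + b')" for a b a' b' :: real
    by (simp add: algebra_simps)
  then show ?thesis
    using z w by (cases T) (auto intro!: less greater split: if_splits)
qed

lemma convex_open_tri: "convex (open_tri T)"
  unfolding convex_alt
proof (intro ballI allI impI)
  fix z w and t :: real
  assume "z \<in> open_tri T" "w \<in> open_tri T" "0 \<le> t \<and> t \<le> 1"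
  then show "(1 - t) *\<^sub>R z + t *\<^sub>R w \<in> open_tri T"
    using segment_into_open_tri[of z T w t] open_tri_subset_closed_tri by (cases "t = 0") auto
qed

lemma connected_open_tri: "connected (open_tri T)"
  by (rule convex_connected[OF convex_open_tri])

lemma closure_open_tri: "closure (open_tri T) = closed_tri T"
proof
  show "closure (open_tri T) \<subseteq> closed_tri T"
    by (rule closure_minimal[OF open_tri_subset_closed_tri closed_closed_tri])
  show "closed_tri T \<subseteq> closure (open_tri T)"
  proof
    fix z assume z: "z \<in> closed_tri T"
    have "((\<lambda>t. (1 - t) *\<^sub>R z + t *\<^sub>R centroid T) \<longlongrightarrow> (1 - 0) *\<^sub>R z
        + 0 *\<^sub>R centroid T) (at_right (0::real))"
      by (intro tendsto_intros)
    moreover have "eventually (\<lambda>t. (1 - t) *\<^sub>R z + t *\<^sub>R centroid T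
        \<in> open_tri T) (at_right (0::real))"
      unfolding eventually_at_right_field
      using segment_into_open_tri[OF z centroid_in_open_tri] by (intro exI[of _ 1]) auto
    then have "eventually (\<lambda>t. (1 - t) *\<^sub>R z + t *\<^sub>R centroid T
        \<in> closure (open_tri T)) (at_right (0::real))"
      by (rule eventually_mono) (use closure_subset in blast)
    ultimately have "(1 - 0) *\<^sub>R z + 0 *\<^sub>R centroid T \<in> closure (open_tri T)"
      by (intro Lim_in_closed_set[OF closed_closure]) auto
    then show "z \<in> closure (open_tri T)" by simp
  qed
qed

lemma frontier_open_tri: "frontier (open_tri T) = closed_tri T - open_tri T"
  by (simp add: frontier_def closure_open_tri interior_open open_open_tri)

lemma finite_triangles_meeting_bounded:
  assumes "bounded B"
  shows "finite {T. closed_tri T \<inter> B \<noteq> {}}"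
proof -
  obtain M where M: "\<And>z. z \<in> B \<Longrightarrow> norm z \<le> M" using assms by (auto simp: bounded_iff)
  let ?I = "{\<lfloor>- 2 * M\<rfloor> - 1 .. \<lceil>2 * M\<rceil>}"
  have "{T. closed_tri T \<inter> B \<noteq> {}} \<subseteq> (\<lambda>(i, j, u). Tri i j u) ` (?I \<times> ?I \<times> UNIV)"
  proof
    fix T assume "T \<in> {T. closed_tri T \<inter> B \<noteq> {}}"
    then obtain z where z: "z \<in> closed_tri T" "z \<in> B" by blast
    obtain i j u where T: "T = Tri i j u" by (cases T)
    have "\<bar>xcoord z\<bar> \<le> 2 * M" "\<bar>ycoord z\<bar> \<le> 2 * M"
      using abs_xcoord_le[of z] abs_ycoord_le[of z] M[OF z(2)] by linarith+
    then have "i \<in> ?I" "j \<in> ?I"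
      using closed_tri_box[OF z(1)[unfolded T]]
      by (auto simp: le_ceiling_iff floor_le_iff) linarith+
    then show "T \<in> (\<lambda>(i, j, u). Tri i j u) ` (?I \<times> ?I \<times> UNIV)"
      unfolding T by (force intro!: image_eqI[of _ _ "(i, j, u)"])
  qed
  then show ?thesis by (rule finite_subset) auto
qed

lemma closed_tri_locally:
  obtains \<epsilon> where "0 < \<epsilon>" "\<And>w T. w \<in> ball z \<epsilon> \<Longrightarrow> w \<in> closed_tri T \<Longrightarrow> z \<in> closed_tri T"
proof -
  define K where "K = \<Union>(closed_tri ` {T. closed_tri T \<inter> ball z 1 \<noteq> {} \<and> z \<notin> closed_tri T})"
  have "finite {T. closed_tri T \<inter> ball z 1 \<noteq> {} \<and> z \<notin> closed_tri T}"
    by (rule finite_subset[OF _ finite_triangles_meeting_bounded[OF bounded_ball[of z 1]]]) auto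
  then have "closed K" unfolding K_def by (intro closed_Union) (auto simp: closed_closed_tri)
  moreover have "z \<notin> K" by (auto simp: K_def)
  ultimately have "open (ball z 1 - K)" "z \<in> ball z 1 - K" by auto
  then obtain \<epsilon> where "0 < \<epsilon>" "ball z \<epsilon> \<subseteq> ball z 1 - K" using open_contains_ball by blast
  then show thesis using that unfolding K_def by blast
qed

subsection \<open>Edges and arcs\<close>

text \<open>The arcs of a triangle run counterclockwise around it.\<close>

fun src :: "colour \<Rightarrow> tri \<Rightarrow> vertex" and tgt :: "colour \<Rightarrow> tri \<Rightarrow> vertex" where
  "src Red (Tri i j u) = (if u then (i + 1, j) else (i, j + 1))"
| "src Green (Tri i j u) = (if u then (i, j + 1) else (i + 1, j))"
| "src Blue (Tri i j u) = (if u then (i, j) else (i + 1, j + 1))"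
| "tgt Red (Tri i j u) = (if u then (i, j + 1) else (i + 1, j))"
| "tgt Green (Tri i j u) = (if u then (i, j) else (i + 1, j + 1))"
| "tgt Blue (Tri i j u) = (if u then (i + 1, j) else (i, j + 1))"

definition tri_arc :: "colour \<Rightarrow> tri \<Rightarrow> vertex \<times> vertex" where
  "tri_arc c T = (src c T, tgt c T)"

definition edge :: "colour \<Rightarrow> tri \<Rightarrow> vertex set" where
  "edge c T = {src c T, tgt c T}"

lemma src_nbr [simp]: "src c (nbr c T) = tgt c T" and tgt_nbr [simp]: "tgt c (nbr c T) = src c T"
  by (cases T; cases c; auto)+

lemma tri_arc_nbr: "tri_arc c (nbr c T) = prod.swap (tri_arc c T)"
  by (simp add: tri_arc_def)

lemma edge_nbr [simp]: "edge c (nbr c T) = edge c T"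
  by (auto simp: edge_def)

lemma tri_arc_eq_iff [simp]: "tri_arc c T = tri_arc c' T' \<longleftrightarrow> c = c' \<and> T = T'"
  by (cases T; cases T'; cases c; cases c') (auto simp: tri_arc_def split: if_splits)

lemma edge_eq_iff_tri_arc: "{u, v} = edge c T \<longleftrightarrow> (u, v) = tri_arc c T \<or> (u, v) = tri_arc c (nbr c T)"
  by (auto simp: edge_def tri_arc_def doubleton_eq_iff)

lemma edge_eq_iff: "edge c T = edge c' T' \<longleftrightarrow> c' = c \<and> (T' = T \<or> T' = nbr c T)"
proof -
  have "edge c T = edge c' T' \<longleftrightarrow> tri_arc c T = tri_arc c' T' \<or> tri_arc c T = tri_arc c' (nbr c' T')"
    using edge_eq_iff_tri_arc[of "src c T" "tgt c T" c' T'] by (simp add: edge_def tri_arc_def)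
  then show ?thesis by (auto simp: nbr_eq_iff_eq_nbr)
qed

lemma lattice_edges_eq: "lattice_edges = {edge c (Tri i j True) | c i j. True}"
proof (intro equalityI subsetI)
  fix e assume "e \<in> lattice_edges"
  then obtain i j where "e = {(i, j), (i + 1, j)} \<or> e = {(i, j), (i, j + 1)}
      \<or> e = {(i, j), (i + 1, j - 1)}"
    unfolding lattice_edges_def by blast
  then have "e = edge Blue (Tri i j True) \<or> e = edge Green (Tri i j True)
      \<or> e = edge Red (Tri i (j - 1) True)"
    by (auto simp: edge_def)
  then show "e \<in> {edge c (Tri i j True) | c i j. True}" by blast
next
  fix e assume "e \<in> {edge c (Tri i j True) | c i j. True}"
  then obtain c i j where "e = edge c (Tri i j True)" by blast
  then have "e = {(i, j + 1), (i + 1, (j + 1) - 1)} \<or> e = {(i, j), (i, j + 1)}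
      \<or> e = {(i, j), (i + 1, j)}"
    by (cases c) (auto simp: edge_def)
  then show "e \<in> lattice_edges" unfolding lattice_edges_def by blast
qed

lemma edge_in_lattice: "edge c T \<in> lattice_edges"
  by (cases rule: tri_upward_cases[where T = T and c = c])
    (auto simp: lattice_edges_eq simp del: nbr.simps)

lemma lattice_edgeE:
  assumes "e \<in> lattice_edges"
  obtains c T where "e = edge c T"
  using assms unfolding lattice_edges_eq by blast

lemma lattice_arcE:
  assumes "{u, v} \<in> lattice_edges"
  obtains c T where "(u, v) = tri_arc c T"
  using assms edge_eq_iff_tri_arc by (metis lattice_edgeE)

lemma edge_segment_upward_iff:
  "z \<in> edge_segment (edge c (Tri i j True)) \<longleftrightarrow> (case c of
      Red \<Rightarrow> xcoord z + ycoord z = of_int i + of_int j + 1 \<and> of_int i \<le> xcoord z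
        \<and> xcoord z \<le> of_int i + 1
    | Green \<Rightarrow> xcoord z = of_int i \<and> of_int j \<le> ycoord z \<and> ycoord z \<le> of_int j + 1
    | Blue \<Rightarrow> ycoord z = of_int j \<and> of_int i \<le> xcoord z \<and> xcoord z \<le> of_int i + 1)"
    (is "_ \<longleftrightarrow> ?inequalities")
proof -
  let ?a = "embed (src c (Tri i j True))" and ?b = "embed (tgt c (Tri i j True))"
  have "edge_segment (edge c (Tri i j True)) = closed_segment ?a ?b"
    by (simp add: edge_segment_def edge_def segment_convex_hull)
  then have "z \<in> edge_segment (edge c (Tri i j True))
      \<longleftrightarrow> (\<exists>t. 0 \<le> t \<and> t \<le> 1 \<and> z = (1 - t) *\<^sub>R ?a + t *\<^sub>R ?b)"
    by (auto simp: in_segment)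
  also have "\<dots> \<longleftrightarrow> (\<exists>t. 0 \<le> t \<and> t \<le> 1 \<and> xcoord z = (1 - t) * xcoord ?a + t * xcoord ?b
      \<and> ycoord z = (1 - t) * ycoord ?a + t * ycoord ?b)"
    by (metis coords_eqI xcoord_linear(1,3) ycoord_linear(1,3))
  also have "\<dots> \<longleftrightarrow> ?inequalities"
  proof (cases c)
    case Red
    then show ?thesis by (auto simp: algebra_simps intro!: exI[of _ "ycoord z - j"])
  next
    case Green
    then show ?thesis by (auto simp: algebra_simps intro!: exI[of _ "j + 1 - ycoord z"])
  next
    case Blue
    then show ?thesis by (auto simp: algebra_simps intro!: exI[of _ "xcoord z - i"])
  qed
  finally show ?thesis .
qed

lemma edge_segment_subset_closed_tri: "edge_segment (edge c T) \<subseteq> closed_tri T"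
proof -
  have "edge_segment (edge c (Tri i j True)) \<subseteq> closed_tri (Tri i j True) \<inter> closed_tri (nbr c (Tri i j True))" for i j
    by (auto simp: edge_segment_upward_iff split: colour.splits)
  then show ?thesis
    by (cases rule: tri_upward_cases[where T = T and c = c])
      (auto simp del: nbr.simps closed_tri.simps)
qed

lemma open_tri_disjoint_edge: "open_tri T \<inter> edge_segment (edge c T') = {}"
proof -
  have upward: "open_tri T \<inter> edge_segment (edge c (Tri a b True)) = {}" for a b
  proof (rule ccontr)
    assume "open_tri T \<inter> edge_segment (edge c (Tri a b True)) \<noteq> {}"
    then obtain z where z: "z \<in> open_tri T" "z \<in> edge_segment (edge c (Tri a b True))" by blast
    obtain i j u where T: "T = Tri i j u" by (cases T)
    have no_int_between: "\<not> (real_of_int m < real_of_int n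
        \<and> real_of_int n < real_of_int m + 1)" for m n :: int
      by auto
    have "real_of_int i < xcoord z \<and> xcoord z < real_of_int i + 1"
      "real_of_int j < ycoord z \<and> ycoord z < real_of_int j + 1"
      "(real_of_int (i + j) < xcoord z + ycoord z \<and> xcoord z + ycoord z < real_of_int (i + j) + 1) \<or>
       (real_of_int (i + j + 1) < xcoord z + ycoord z \<and> xcoord z + ycoord z < real_of_int (i + j + 1) + 1)"
      using z(1) T by (auto split: if_splits)
    moreover have "xcoord z = real_of_int a \<or> ycoord z = real_of_int b
        \<or> xcoord z + ycoord z = real_of_int (a + b + 1)"
      using z(2) by (auto simp: edge_segment_upward_iff split: colour.splits)
    ultimately show False using no_int_between by metis
  qed
  show ?thesis
    using upward by (cases rule: tri_upward_cases[where T = T' and c = c])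
      (auto simp del: nbr.simps)
qed

lemma closed_tri_boundary:
  assumes "z \<in> closed_tri T" "z \<notin> open_tri T"
  shows "\<exists>c. z \<in> edge_segment (edge c T)"
proof -
  obtain i j u where T: "T = Tri i j u" by (cases T)
  note box = closed_tri_box[OF assms(1)[unfolded T]]
  have "\<exists>c. z \<in> edge_segment (edge c T) \<or> z \<in> edge_segment (edge c (nbr c T))"
  proof (cases u)
    case True
    then have "xcoord z = i \<or> ycoord z = j \<or> xcoord z + ycoord z = of_int i + of_int j + 1"
      using assms T by auto
    then have "z \<in> edge_segment (edge Green T) \<or> z \<in> edge_segment (edge Blue T)
        \<or> z \<in> edge_segment (edge Red T)"
      using box True T by (auto simp: edge_segment_upward_iff)
    then show ?thesis by blast
  next
    case False
    then have "xcoord z = i + 1 \<or> ycoord z = j + 1 \<or> xcoord z + ycoord z = of_int i + of_int j + 1"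
      using assms T by auto
    then have "z \<in> edge_segment (edge Green (nbr Green T)) \<or> z \<in> edge_segment (edge Blue (nbr Blue T)) \<or>
        z \<in> edge_segment (edge Red (nbr Red T))"
      using box False T by (auto simp: edge_segment_upward_iff simp del: edge_nbr)
    then show ?thesis by blast
  qed
  then show ?thesis by simp
qed

lemma embed_in_edge: "\<exists>c T. embed v \<in> edge_segment (edge c T)"
proof -
  have "embed v \<in> edge_segment (edge Blue (Tri (fst v) (snd v) True))"
    by (simp add: edge_segment_upward_iff)
  then show ?thesis by blast
qed

subsection \<open>Functions constant across edges\<close>

definition tri_at :: "complex \<Rightarrow> tri" where
  "tri_at z = Tri \<lfloor>xcoord z\<rfloor> \<lfloor>ycoord z\<rfloor> (xcoord z + ycoord z < \<lfloor>xcoord z\<rfloor> + \<lfloor>ycoord z\<rfloor> + 1)"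

lemma in_closed_tri_at: "z \<in> closed_tri (tri_at z)"
  using floor_correct[of "xcoord z"] floor_correct[of "ycoord z"] unfolding tri_at_def by auto

lemma tri_at_eqI:
  assumes "real_of_int i \<le> xcoord z" "xcoord z < i + 1" "real_of_int j \<le> ycoord z"
    "ycoord z < j + 1"
  shows "tri_at z = Tri i j (xcoord z + ycoord z < i + j + 1)"
proof -
  have "\<lfloor>xcoord z\<rfloor> = i" "\<lfloor>ycoord z\<rfloor> = j" using assms by (auto simp: floor_eq_iff)
  then show ?thesis by (simp add: tri_at_def)
qed

context
  fixes h :: "tri \<Rightarrow> 'a" and z :: complex
  assumes across: "\<And>T c. z \<in> edge_segment (edge c T) \<Longrightarrow> h (nbr c T) = h T"
begin

lemma across_red:
  "xcoord z + ycoord z = i + j + 1 \<Longrightarrow> i \<le> xcoord z \<Longrightarrow> xcoord z \<le> i + 1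
      \<Longrightarrow> h (Tri i j False) = h (Tri i j True)"
  using across[of Red "Tri i j True"] by (simp add: edge_segment_upward_iff)

lemma across_green:
  "xcoord z = i + 1 \<Longrightarrow> j \<le> ycoord z \<Longrightarrow> ycoord z \<le> j + 1 \<Longrightarrow> h (Tri i j False) = h (Tri (i + 1) j True)"
  using across[of Green "Tri (i + 1) j True"] by (simp add: edge_segment_upward_iff)

lemma across_blue:
  "ycoord z = j + 1 \<Longrightarrow> i \<le> xcoord z \<Longrightarrow> xcoord z \<le> i + 1 \<Longrightarrow> h (Tri i j False) = h (Tri i (j + 1) True)"
  using across[of Blue "Tri i (j + 1) True"] by (simp add: edge_segment_upward_iff)

lemma value_upward_at:
  assumes "z \<in> closed_tri (Tri i j True)"
  shows "h (Tri i j True) = h (tri_at z)"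
proof -
  have bounds: "i \<le> xcoord z" "j \<le> ycoord z" "xcoord z + ycoord z \<le> i + j + 1" using assms by auto
  then consider (below_diagonal) "xcoord z + ycoord z < i + j + 1"
    | (on_diagonal) "xcoord z + ycoord z = i + j + 1" "xcoord z < i + 1" "ycoord z < j + 1"
    | (right_corner) "xcoord z = i + 1" "ycoord z = j"
    | (upper_corner) "xcoord z = i" "ycoord z = j + 1" by linarith
  then show ?thesis
  proof cases
    case below_diagonal
    then show ?thesis using bounds tri_at_eqI[of i z j] by simp
  next
    case on_diagonal
    then show ?thesis using bounds tri_at_eqI[of i z j] across_red[of i j] by simp
  next
    case right_corner
    then show ?thesis
      using tri_at_eqI[of "i + 1" z j] across_red[of i j] across_green[of i j] by simp
  next
    case upper_corner
    then show ?thesis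
      using tri_at_eqI[of i z "j + 1"] across_red[of i j] across_blue[of j i] by simp
  qed
qed

lemma value_at:
  assumes z: "z \<in> closed_tri T"
  shows "h T = h (tri_at z)"
proof -
  obtain i j u where T: "T = Tri i j u" by (cases T)
  show ?thesis
  proof (cases u)
    case True
    then show ?thesis using value_upward_at[of i j] z T by simp
  next
    case False
    then have bounds: "xcoord z \<le> i + 1" "ycoord z \<le> j + 1" "i + j + 1 \<le> xcoord z + ycoord z"
      using z T by auto
    then consider (right_edge) "xcoord z = i + 1" | (upper_edge) "ycoord z = j + 1"
      | (interior) "xcoord z < i + 1" "ycoord z < j + 1" by linarith
    then show ?thesis
    proof cases
      case right_edge
      then show ?thesis
        using bounds T False across_green[of i j] value_upward_at[of "i + 1" j] by simp
    next
      case upper_edge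
      then show ?thesis
        using bounds T False across_blue[of j i] value_upward_at[of i "j + 1"] by simp
    next
      case interior
      then show ?thesis using bounds T False tri_at_eqI[of i z j] by simp
    qed
  qed
qed

end

lemma connected_imp_value_eq:
  fixes h :: "tri \<Rightarrow> 'a"
  assumes conn: "connected Q"
    and across: "\<And>z T c. z \<in> Q \<Longrightarrow> z \<in> edge_segment (edge c T) \<Longrightarrow> h (nbr c T) = h T"
    and z: "z \<in> Q" "z \<in> closed_tri T" and w: "w \<in> Q" "w \<in> closed_tri T'"
  shows "h T = h T'"
proof -
  have "h (tri_at z) = h (tri_at w)"
  proof (rule connected_local_const[OF conn z(1) w(1)])
    show "\<forall>a\<in>Q. \<forall>\<^sub>F b in at a within Q. h (tri_at a) = h (tri_at b)"
    proof
      fix a assume a: "a \<in> Q"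
      obtain \<epsilon> where \<epsilon>: "0 < \<epsilon>" "\<And>b T. b \<in> ball a \<epsilon> \<Longrightarrow> b \<in> closed_tri T \<Longrightarrow> a \<in> closed_tri T"
        using closed_tri_locally by blast
      have "h (tri_at a) = h (tri_at b)" if "b \<in> ball a \<epsilon>" for b
        using value_at[of a h, OF across[OF a] \<epsilon>(2)[OF that in_closed_tri_at]] by simp
      then show "\<forall>\<^sub>F b in at a within Q. h (tri_at a) = h (tri_at b)"
        unfolding eventually_at using \<epsilon>(1) by (intro exI[of _ \<epsilon>]) (auto simp: dist_commute)
    qed
  qed
  then show ?thesis using value_at[of z h T] value_at[of w h T'] across z w by simp
qed

lemma open_tri_meets_closed_tri:
  assumes "open_tri T \<inter> closed_tri T' \<noteq> {}"
  shows "T = T'"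
proof -
  obtain z where z: "z \<in> open_tri T" "z \<in> closed_tri T'" using assms by blast
  have "(nbr c U = T) = (U = T)" if "z \<in> edge_segment (edge c U)" for c U
    using open_tri_disjoint_edge z(1) that by blast
  then have "(T = T) = (tri_at z = T)" "(T' = T) = (tri_at z = T)"
    using value_at[of z "\<lambda>U. U = T"] z open_tri_subset_closed_tri by blast+
  then show ?thesis by simp
qed

lemma inj_open_tri: "inj open_tri"
proof (rule injI)
  fix T T' assume "open_tri T = open_tri T'"
  then have "centroid T \<in> open_tri T \<inter> closed_tri T'"
    using centroid_in_open_tri open_tri_subset_closed_tri by blast
  then show "T = T'" using open_tri_meets_closed_tri by blast
qed

subsection \<open>Midpoints of edges\<close>

definition mid :: "colour \<Rightarrow> tri \<Rightarrow> complex" where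
  "mid c T = midpoint (embed (src c T)) (embed (tgt c T))"

lemma mid_nbr [simp]: "mid c (nbr c T) = mid c T"
  by (simp add: mid_def midpoint_sym)

lemma mid_in_edge_segment: "mid c T \<in> edge_segment (edge c T)"
  by (simp add: mid_def edge_segment_def edge_def segment_convex_hull[symmetric])

lemma xcoord_mid: "xcoord (mid c T) = real_of_int (fst (src c T) + fst (tgt c T)) / 2"
  and ycoord_mid: "ycoord (mid c T) = real_of_int (snd (src c T) + snd (tgt c T)) / 2"
  by (simp_all add: mid_def midpoint_def)

lemma half_integral_in_edge_segment_iff:
  assumes "xcoord z = real_of_int x / 2" "ycoord z = real_of_int y / 2"
  shows "z \<in> edge_segment (edge c (Tri i j True)) \<longleftrightarrow> (case c of
      Red \<Rightarrow> x + y = 2 * (i + j + 1) \<and> 2 * i \<le> x \<and> x \<le> 2 * (i + 1)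
    | Green \<Rightarrow> x = 2 * i \<and> 2 * j \<le> y \<and> y \<le> 2 * (j + 1)
    | Blue \<Rightarrow> y = 2 * j \<and> 2 * i \<le> x \<and> x \<le> 2 * (i + 1))"
proof -
  have "real_of_int a / 2 = b \<longleftrightarrow> a = 2 * b" "real_of_int b \<le> real_of_int a / 2 \<longleftrightarrow> 2 * b \<le> a"
    "real_of_int a / 2 \<le> real_of_int b + 1 \<longleftrightarrow> a \<le> 2 * (b + 1)" for a b :: int
    unfolding of_int_le_iff[where 'a = real, symmetric] of_int_eq_iff[where 'a = real, symmetric]
    by auto
  moreover have "real_of_int x / 2 + real_of_int y / 2 = real_of_int i + real_of_int j + 1
      \<longleftrightarrow> x + y = 2 * (i + j + 1)"
    unfolding of_int_eq_iff[where 'a = real, symmetric] by auto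
  ultimately show ?thesis unfolding edge_segment_upward_iff assms by (simp only:)
qed

lemma mid_in_edge_segment_imp_eq:
  assumes "mid c T \<in> edge_segment (edge c' T')"
  shows "edge c' T' = edge c T"
proof -
  have upward: "edge c' (Tri a b True) = edge c (Tri i j True)"
    if "mid c (Tri i j True) \<in> edge_segment (edge c' (Tri a b True))" for i j a b
  proof -
    have "c' = c \<and> a = i \<and> b = j"
      using that unfolding half_integral_in_edge_segment_iff[OF xcoord_mid ycoord_mid]
      by (cases c; cases c'; simp; presburger)
    then show ?thesis by simp
  qed
  have "\<exists>i j. edge d U = edge d (Tri i j True) \<and> mid d U = mid d (Tri i j True)" for d U
    by (cases rule: tri_upward_cases[where T = U and c = d]) (auto simp del: nbr.simps)
  then obtain i j a b where "edge c T = edge c (Tri i j True)" "mid c T = mid c (Tri i j True)"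
    "edge c' T' = edge c' (Tri a b True)" by metis
  then show ?thesis using upward assms by simp
qed

lemma mid_in_closed_tri:
  assumes "mid c T \<in> closed_tri T'"
  shows "T' = T \<or> T' = nbr c T"
proof -
  let ?h = "\<lambda>U. U = T \<or> U = nbr c T"
  have across: "?h (nbr d U) = ?h U" if "mid c T \<in> edge_segment (edge d U)" for d U
    using mid_in_edge_segment_imp_eq[OF that] by (auto simp: edge_eq_iff nbr_eq_iff_eq_nbr)
  have "mid c T \<in> closed_tri T" using mid_in_edge_segment edge_segment_subset_closed_tri by blast
  then show ?thesis
    using value_at[of "mid c T" ?h, OF across assms] value_at[of "mid c T" ?h T, OF across] by simp
qed

subsection \<open>Closed one-forms\<close>

definition outgoing :: "vertex \<Rightarrow> (colour \<times> tri) set" where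
  "outgoing v = {(c, T). src c T = v}"

definition circulation :: "(tri \<Rightarrow> colour \<Rightarrow> 'a :: ab_group_add) \<Rightarrow> vertex \<Rightarrow> 'a" where
  "circulation \<omega> v = (\<Sum>(c, T)\<in>outgoing v. \<omega> T c)"

lemma outgoing_eq: "outgoing (i, j) = {(Blue, Tri i j True), (Red, Tri i (j - 1) False), (Green, Tri i (j - 1) True),
    (Blue, Tri (i - 1) (j - 1) False), (Red, Tri (i - 1) j True), (Green, Tri (i - 1) j False)}" (is "_ = ?A")
proof (intro equalityI subsetI)
  fix p assume p: "p \<in> outgoing (i, j)"
  obtain c a b u where "p = (c, Tri a b u)" by (metis surj_pair tri.exhaust)
  then show "p \<in> ?A" using p by (cases c) (auto simp: outgoing_def split: if_splits)
qed (auto simp: outgoing_def)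

lemma finite_outgoing [simp]: "finite (outgoing v)"
  by (cases v) (simp add: outgoing_eq)

lemma circulation_eq: "circulation \<omega> (i, j) = \<omega> (Tri i j True) Blue + \<omega> (Tri i (j - 1) False) Red
    + \<omega> (Tri i (j - 1) True) Green + \<omega> (Tri (i - 1) (j - 1) False) Blue + \<omega> (Tri (i - 1) j True) Red
    + \<omega> (Tri (i - 1) j False) Green"
  by (simp add: circulation_def outgoing_eq add.assoc)

locale closed_one_form =
  fixes \<omega> :: "tri \<Rightarrow> colour \<Rightarrow> 'a :: ab_group_add"
  assumes antisymmetric: "\<And>T c. \<omega> (nbr c T) c = - \<omega> T c"
    and closed: "\<And>v. circulation \<omega> v = 0"
    and finite_support: "finite {T. \<exists>c. \<omega> T c \<noteq> 0}"
begin

definition support_bound :: int where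
  "support_bound = Max (insert 0 (tcol ` {T. \<exists>c. \<omega> T c \<noteq> 0}))"

lemma zero_beyond_support:
  assumes "support_bound < tcol T"
  shows "\<omega> T c = 0"
proof (rule ccontr)
  assume "\<omega> T c \<noteq> 0"
  then have "tcol T \<le> support_bound" unfolding support_bound_def
    using finite_support by (intro Max_ge) auto
  then show False using assms by simp
qed

definition potential :: "tri \<Rightarrow> 'a" where
  "potential T =
     - (\<Sum>k\<in>{tcol T..support_bound}. \<omega> (Tri k (trow T) True) Red + \<omega> (Tri k (trow T) False) Green)
     + (if upward T then 0 else \<omega> (Tri (tcol T) (trow T) True) Red)"

lemma potential_zero: "support_bound < tcol T \<Longrightarrow> potential T = 0"
  by (simp add: potential_def zero_beyond_support)

lemma potential_red: "potential (Tri i j False) = potential (Tri i j True) + \<omega> (Tri i j True) Red"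
  by (simp add: potential_def)

lemma potential_green: "potential (Tri (i + 1) j True)
    = potential (Tri i j False) + \<omega> (Tri i j False) Green"
proof (cases "i \<le> support_bound")
  case True
  then have "{i..support_bound} = insert i {i + 1..support_bound}" by auto
  then show ?thesis by (simp add: potential_def algebra_simps)
next
  case False
  then show ?thesis by (simp add: potential_zero zero_beyond_support)
qed

lemma potential_blue: "potential (Tri i (j - 1) False)
    = potential (Tri i j True) + \<omega> (Tri i j True) Blue"
proof -
  define defect where
    "defect i = potential (Tri i (j - 1) False) - potential (Tri i j True)
        - \<omega> (Tri i j True) Blue" for i
  have defect_step: "defect (i - 1) = defect i" for i
  proof -
    have "potential (Tri (i - 1) (j - 1) False) =
        potential (Tri i (j - 1) False) - \<omega> (Tri i (j - 1) True) Red - \<omega> (Tri (i - 1) (j - 1) False) Green"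
      using potential_red[of i "j - 1"] potential_green[of "i - 1" "j - 1"]
      by (simp add: algebra_simps)
    moreover have "potential (Tri (i - 1) j True) =
        potential (Tri i j True) - \<omega> (Tri (i - 1) j True) Red - \<omega> (Tri (i - 1) j False) Green"
      using potential_red[of "i - 1" j] potential_green[of "i - 1" j] by (simp add: algebra_simps)
    moreover have "\<omega> (Tri i (j - 1) False) Red = - \<omega> (Tri i (j - 1) True) Red"
      "\<omega> (Tri (i - 1) (j - 1) False) Green = - \<omega> (Tri i (j - 1) True) Green"
      "\<omega> (Tri (i - 1) (j - 1) False) Blue = - \<omega> (Tri (i - 1) j True) Blue"
      using antisymmetric[of Red "Tri i (j - 1) True"] antisymmetric[of Green "Tri i (j - 1) True"]
        antisymmetric[of Blue "Tri (i - 1) j True"] by simp_all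
    ultimately have "defect (i - 1) - defect i = circulation \<omega> (i, j)"
      by (simp add: defect_def circulation_eq algebra_simps)
    then show ?thesis using closed by simp
  qed
  have "defect i = defect (i + int n)" for n
  proof (induction n)
    case (Suc n)
    then show ?case using defect_step[of "i + int (Suc n)"] by (simp add: algebra_simps)
  qed simp
  from this[of "nat (support_bound + 1 - i)"] have "defect i = defect (max i (support_bound + 1))"
    by (cases "i \<le> support_bound + 1") (auto simp: max_def)
  also have "\<dots> = 0" by (simp add: defect_def potential_zero zero_beyond_support)
  finally show ?thesis by (simp add: defect_def algebra_simps)
qed

lemma potential_nbr: "potential (nbr c T) = potential T + \<omega> T c"
proof -
  have upward: "potential (nbr c (Tri i j True))
      = potential (Tri i j True) + \<omega> (Tri i j True) c" for i j
  proof (cases c)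
    case Green
    then show ?thesis
      using potential_green[of "i - 1" j] antisymmetric[of Green "Tri i j True"]
      by (simp add: algebra_simps)
  qed (use potential_red potential_blue in simp_all)
  show ?thesis
  proof (cases rule: tri_upward_cases[where T = T and c = c])
    case (downward i j)
    then show ?thesis using upward[of i j] antisymmetric[of c "Tri i j True"] by simp
  qed (use upward in simp)
qed

end

subsection \<open>The flow of a set of arcs\<close>

definition flow :: "(vertex \<times> vertex) set \<Rightarrow> tri \<Rightarrow> colour \<Rightarrow> int" where
  "flow X T c = of_bool (tri_arc c (nbr c T) \<in> X) - of_bool (tri_arc c T \<in> X)"

lemma card_lattice_nbrs:
  assumes "\<And>w. Q w \<Longrightarrow> {v, w} \<in> lattice_edges"
  shows "card {w. Q w} = (\<Sum>(c, T)\<in>outgoing v. of_bool (Q (tgt c T)))"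
proof -
  define A where "A = {(c, T) \<in> outgoing v. Q (tgt c T)}"
  have "inj_on (\<lambda>(c, T). tgt c T) A"
  proof (rule inj_onI)
    fix p q assume "p \<in> A" "q \<in> A" "(case p of (c, T) \<Rightarrow> tgt c T) = (case q of (c, T) \<Rightarrow> tgt c T)"
    then have "case_prod tri_arc p = case_prod tri_arc q"
      by (auto simp: A_def outgoing_def tri_arc_def)
    then show "p = q" by (cases p; cases q) simp
  qed
  moreover have "w \<in> (\<lambda>(c, T). tgt c T) ` A" if Q: "Q w" for w
  proof -
    obtain c T where "(v, w) = tri_arc c T" using assms[OF Q] by (rule lattice_arcE)
    then show ?thesis
      using Q by (intro image_eqI[of _ _ "(c, T)"]) (auto simp: A_def outgoing_def tri_arc_def)
  qed
  then have "(\<lambda>(c, T). tgt c T) ` A = {w. Q w}" by (auto simp: A_def)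
  ultimately have "card {w. Q w} = card A" by (metis card_image)
  also have "\<dots> = (\<Sum>(c, T)\<in>outgoing v. of_bool (Q (tgt c T)))"
    by (simp add: A_def of_bool_def sum.If_cases split_def Int_def)
  finally show ?thesis .
qed

lemma circulation_flow:
  assumes lattice: "\<And>u v. (u, v) \<in> X \<Longrightarrow> {u, v} \<in> lattice_edges"
  shows "circulation (flow X) v = int (card {u. (u, v) \<in> X}) - int (card {w. (v, w) \<in> X})"
proof -
  have "card {u. (u, v) \<in> X} = (\<Sum>(c, T)\<in>outgoing v. of_bool ((tgt c T, v) \<in> X))"
    using lattice by (intro card_lattice_nbrs) (metis insert_commute)
  also have "\<dots> = (\<Sum>(c, T)\<in>outgoing v. of_bool (tri_arc c (nbr c T) \<in> X))"
    by (intro sum.cong refl) (auto simp: outgoing_def tri_arc_def)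
  finally have indegree: "int (card {u. (u, v) \<in> X})
      = (\<Sum>(c, T)\<in>outgoing v. of_bool (tri_arc c (nbr c T) \<in> X))"
    by (simp add: split_def)
  have "card {w. (v, w) \<in> X} = (\<Sum>(c, T)\<in>outgoing v. of_bool ((v, tgt c T) \<in> X))"
    using lattice by (intro card_lattice_nbrs)
  also have "\<dots> = (\<Sum>(c, T)\<in>outgoing v. of_bool (tri_arc c T \<in> X))"
    by (intro sum.cong refl) (auto simp: outgoing_def tri_arc_def)
  finally have outdegree: "int (card {w. (v, w) \<in> X})
      = (\<Sum>(c, T)\<in>outgoing v. of_bool (tri_arc c T \<in> X))"
    by (simp add: split_def)
  show ?thesis unfolding indegree outdegree circulation_def
    by (simp add: flow_def split_def sum_subtractf)
qed

lemma closed_one_form_flow: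
  assumes fin: "finite X" and lattice: "\<And>u v. (u, v) \<in> X \<Longrightarrow> {u, v} \<in> lattice_edges"
    and balanced: "\<And>v. card {u. (u, v) \<in> X} = card {w. (v, w) \<in> X}"
  shows "closed_one_form (flow X)"
proof
  show "flow X (nbr c T) c = - flow X T c" for T c by (simp add: flow_def)
  show "circulation (flow X) v = 0" for v using circulation_flow[OF lattice] balanced by simp
  have "{T. \<exists>c. flow X T c \<noteq> 0} \<subseteq> snd ` (\<Union>v\<in>fst ` X \<union> snd ` X. outgoing v)"
  proof
    fix T assume "T \<in> {T. \<exists>c. flow X T c \<noteq> 0}"
    then obtain c where "flow X T c \<noteq> 0" by blast
    then have "tri_arc c (nbr c T) \<in> X \<or> tri_arc c T \<in> X" by (auto simp: flow_def)
    then have "src c T \<in> fst ` X \<union> snd ` X" by (force simp: tri_arc_def)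
    then show "T \<in> snd ` (\<Union>v\<in>fst ` X \<union> snd ` X. outgoing v)"
      by (intro image_eqI[of _ _ "(c, T)"]) (auto simp: outgoing_def)
  qed
  moreover have "finite (snd ` (\<Union>v\<in>fst ` X \<union> snd ` X. outgoing v))" using fin by auto
  ultimately show "finite {T. \<exists>c. flow X T c \<noteq> 0}" by (rule finite_subset)
qed

subsection \<open>Cycles\<close>

lemma card_successors:
  assumes "distinct xs" "length ys = length xs"
  shows "card {w. (v, w) \<in> set (zip xs ys)} = of_bool (v \<in> set xs)"
proof (cases "v \<in> set xs")
  case True
  then obtain k where k: "k < length xs" "xs ! k = v" by (auto simp: in_set_conv_nth)
  have "{w. (v, w) \<in> set (zip xs ys)} = {ys ! k}"
    using k assms by (auto simp: set_zip nth_eq_iff_index_eq)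
  then show ?thesis using True by simp
next
  case False
  then have "{w. (v, w) \<in> set (zip xs ys)} = {}" by (auto dest: set_zip_leftD)
  then show ?thesis using False by simp
qed

lemma cycle_arcs_balanced:
  assumes "distinct vs"
  shows "card {u. (u, v) \<in> cycle_arcs vs} = card {w. (v, w) \<in> cycle_arcs vs}"
proof -
  have "card {w. (v, w) \<in> set (zip vs (rotate1 vs))} = of_bool (v \<in> set vs)"
    using assms by (intro card_successors) auto
  moreover have "{u. (u, v) \<in> set (zip vs (rotate1 vs))} = {u. (v, u) \<in> set (zip (rotate1 vs) vs)}"
    by (auto simp: set_zip)
  moreover have "card {u. (v, u) \<in> set (zip (rotate1 vs) vs)} = of_bool (v \<in> set (rotate1 vs))"
    using assms by (intro card_successors) auto
  ultimately show ?thesis by (simp add: cycle_arcs_def)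
qed

lemma cycle_arcs_predecessor_unique:
  assumes "distinct vs" "(u, w) \<in> cycle_arcs vs" "(v, w) \<in> cycle_arcs vs"
  shows "u = v"
proof -
  obtain k l where k: "k < length vs" "u = vs ! k" "w = rotate1 vs ! k"
    and l: "l < length vs" "v = vs ! l" "w = rotate1 vs ! l"
    using assms(2,3) by (auto simp: cycle_arcs_def set_zip)
  have "k = l" using k l assms(1) nth_eq_iff_index_eq[of "rotate1 vs" k l] by simp
  then show ?thesis using k l by simp
qed

lemma cycle_arcs_nth:
  "cycle_arcs vs = {(vs ! k, vs ! (Suc k mod length vs)) | k. k < length vs}"
  by (auto simp: cycle_arcs_def set_zip nth_rotate1)

lemma cycle_arcs_antisym:
  assumes distinct: "distinct vs" and n: "3 \<le> length vs" and "(u, v) \<in> cycle_arcs vs"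
  shows "(v, u) \<notin> cycle_arcs vs"
proof
  let ?n = "length vs"
  assume "(v, u) \<in> cycle_arcs vs"
  then obtain l where l: "l < ?n" "v = vs ! l" "u = vs ! (Suc l mod ?n)"
    by (auto simp: cycle_arcs_nth)
  obtain k where k: "k < ?n" "u = vs ! k" "v = vs ! (Suc k mod ?n)"
    using assms(3) by (auto simp: cycle_arcs_nth)
  have "0 < ?n" using n by linarith
  then have "Suc k mod ?n < ?n" "Suc l mod ?n < ?n" by simp_all
  then have "l = Suc k mod ?n" "k = Suc l mod ?n"
    using k l nth_eq_iff_index_eq[OF distinct] by metis+
  moreover have "Suc m mod ?n = (if Suc m = ?n then 0 else Suc m)" if "m < ?n" for m
    using that by (simp add: mod_Suc)
  ultimately have "l = (if Suc k = ?n then 0 else Suc k)" "k = (if Suc l = ?n then 0 else Suc l)"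
    using k(1) l(1) by metis+
  then show False using n by presburger
qed

section \<open>Solid subgraphs\<close>

subsection \<open>The triangles inside the boundary cycle\<close>

locale solid =
  fixes vs :: "vertex list"
  assumes cycle: "lattice_cycle vs"
begin

abbreviation C :: "complex set" where "C \<equiv> cycle_curve vs"
abbreviation G :: graph where "G \<equiv> solid_graph vs"

definition S :: "tri set" where
  "S = {T. open_tri T \<subseteq> inside C}"

lemma verts_G: "v \<in> verts G \<longleftrightarrow> embed v \<in> C \<union> inside C"
  by (simp add: solid_graph_def Let_def)

lemma edges_G: "e \<in> edges G \<longleftrightarrow> e \<in> lattice_edges \<and> edge_segment e \<subseteq> C \<union> inside C"
  by (simp add: solid_graph_def Let_def)

lemma edge_endpoint: "e \<in> edges G \<Longrightarrow> v \<in> e \<Longrightarrow> v \<in> verts G"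
  unfolding verts_G edges_G edge_segment_def by (meson hull_inc imageI subsetD)

lemma distinct_cycle: "distinct vs" and length_cycle: "3 \<le> length vs"
  and cycle_arc_lattice: "(u, v) \<in> cycle_arcs vs \<Longrightarrow> {u, v} \<in> lattice_edges"
  using cycle by (auto simp: lattice_cycle_def)

lemma finite_cycle_arcs: "finite (cycle_arcs vs)"
  by (simp add: cycle_arcs_def)

lemma compact_curve: "compact C"
  unfolding cycle_curve_def
  by (intro compact_UN finite_cycle_arcs)
    (auto simp: edge_segment_def segment_convex_hull[symmetric])

lemma closed_curve: "closed C" and bounded_curve: "bounded C"
  using compact_curve compact_imp_closed compact_imp_bounded by auto

lemma connected_outside_curve: "connected (outside C)"
  using bounded_curve by (intro connected_outside) simp_all

lemma in_curveE:
  assumes "z \<in> C"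
  obtains c T where "tri_arc c T \<in> cycle_arcs vs" "z \<in> edge_segment (edge c T)"
proof -
  obtain u v where uv: "(u, v) \<in> cycle_arcs vs" "z \<in> edge_segment {u, v}"
    using assms unfolding cycle_curve_def by auto
  obtain c T where "(u, v) = tri_arc c T" using cycle_arc_lattice[OF uv(1)] by (rule lattice_arcE)
  then show thesis using that uv by (simp add: edge_def tri_arc_def)
qed

lemma cycle_edge_in_curve: "tri_arc c T \<in> cycle_arcs vs \<Longrightarrow> edge_segment (edge c T) \<subseteq> C"
  unfolding cycle_curve_def edge_def tri_arc_def by auto

lemma open_tri_disjoint_curve: "open_tri T \<inter> C = {}"
  using in_curveE open_tri_disjoint_edge by (metis disjoint_iff)

lemma in_S_if_meets_inside:
  assumes "open_tri T \<inter> inside C \<noteq> {}"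
  shows "T \<in> S"
proof -
  obtain z where z: "z \<in> open_tri T" "z \<in> inside C" using assms by blast
  have "w \<in> inside C" if "w \<in> open_tri T" for w
  proof (rule inside_same_component[OF _ z(2)])
    show "connected_component (- C) z w"
      using connected_open_tri[of T] open_tri_disjoint_curve[of T] z(1) that
      unfolding connected_component_def by (intro exI[of _ "open_tri T"]) auto
  qed
  then show ?thesis by (auto simp: S_def)
qed

lemma in_S_if_closed_meets_inside:
  assumes "z \<in> closed_tri T" "z \<in> inside C"
  shows "T \<in> S"
proof -
  have "inside C \<inter> closure (open_tri T) \<noteq> {}" using assms closure_open_tri by blast
  then have "open_tri T \<inter> inside C \<noteq> {}"
    using open_inside[OF closed_curve] by (metis Int_commute open_Int_closure_eq_empty)
  then show ?thesis by (rule in_S_if_meets_inside)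
qed

lemma centroid_outside:
  assumes "T \<notin> S"
  shows "centroid T \<in> outside C"
proof -
  have "centroid T \<notin> inside C"
    using assms in_S_if_meets_inside[of T] centroid_in_open_tri[of T] by blast
  moreover have "centroid T \<notin> C"
    using open_tri_disjoint_curve[of T] centroid_in_open_tri[of T] by blast
  ultimately show ?thesis using inside_Un_outside[of C] by blast
qed

lemma closed_tri_in_region:
  assumes "T \<in> S"
  shows "closed_tri T \<subseteq> C \<union> inside C"
proof -
  have "closure (open_tri T) \<subseteq> closure (inside C)"
    using assms by (intro closure_mono) (simp add: S_def)
  then show ?thesis using closure_inside_subset[OF closed_curve] closure_open_tri by blast
qed

lemma finite_S: "finite S"
proof (rule finite_subset[OF _ finite_triangles_meeting_bounded[OF bounded_inside[OF bounded_curve]]])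
  show "S \<subseteq> {T. closed_tri T \<inter> inside C \<noteq> {}}"
    using centroid_in_open_tri open_tri_subset_closed_tri unfolding S_def by blast
qed

sublocale region S
  by unfold_locales (rule finite_S)

lemma ex_outside_far_right:
  obtains w where "w \<in> outside C" "n < tcol (tri_at w)"
proof -
  have "bounded (C \<union> inside C)" using bounded_curve bounded_inside by auto
  then obtain B where B: "\<And>z. z \<in> C \<union> inside C \<Longrightarrow> norm z \<le> B" by (auto simp: bounded_iff)
  define w where "w = of_coords (max (2 * B) n + 2) 0"
  have "w \<notin> C \<union> inside C"
  proof
    assume "w \<in> C \<union> inside C"
    then show False using B[of w] abs_xcoord_le[of w] by (simp add: w_def)
  qed
  then have "w \<in> outside C" by (simp add: union_with_inside)
  moreover have "real_of_int (n + 1) \<le> xcoord w" by (simp add: w_def)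
  then have "n + 1 \<le> \<lfloor>xcoord w\<rfloor>" by (simp only: le_floor_iff)
  then have "n < tcol (tri_at w)" by (simp add: tri_at_def)
  ultimately show thesis by (rule that)
qed

lemma potential_zero_outside:
  assumes form: "closed_one_form \<omega>"
    and inside: "\<And>T c. \<omega> T c \<noteq> 0 \<Longrightarrow> edge_segment (edge c T) \<subseteq> C \<union> inside C" and T: "T \<notin> S"
  shows "closed_one_form.potential \<omega> T = 0"
proof -
  interpret closed_one_form \<omega> by (rule form)
  obtain w where w: "w \<in> outside C" "support_bound < tcol (tri_at w)" by (rule ex_outside_far_right)
  have "potential T = potential (tri_at w)"
  proof (rule connected_imp_value_eq[OF connected_outside_curve])
    show "potential (nbr c U) = potential U"
      if "z \<in> outside C" "z \<in> edge_segment (edge c U)" for z U c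
    proof -
      have "z \<notin> C \<union> inside C" using that(1) by (simp add: union_with_inside)
      then have "\<omega> U c = 0" using inside that(2) by blast
      then show ?thesis by (simp add: potential_nbr)
    qed
    show "centroid T \<in> outside C" by (rule centroid_outside[OF T])
    show "centroid T \<in> closed_tri T" using centroid_in_open_tri open_tri_subset_closed_tri by blast
  qed (rule w(1) in_closed_tri_at)+
  then show ?thesis using potential_zero[OF w(2)] by simp
qed

lemma cycle_edge_borders_S:
  assumes arc: "tri_arc c T \<in> cycle_arcs vs"
  shows "T \<in> S \<or> nbr c T \<in> S"
proof (rule ccontr)
  assume "\<not> (T \<in> S \<or> nbr c T \<in> S)"
  let ?\<omega> = "flow (cycle_arcs vs)"
  have form: "closed_one_form ?\<omega>"
    by (rule closed_one_form_flow[OF finite_cycle_arcs cycle_arc_lattice cycle_arcs_balanced[OF distinct_cycle]])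
  have "edge_segment (edge d U) \<subseteq> C \<union> inside C" if "?\<omega> U d \<noteq> 0" for U d
  proof -
    have "tri_arc d (nbr d U) \<in> cycle_arcs vs \<or> tri_arc d U \<in> cycle_arcs vs"
      using that by (auto simp: flow_def)
    then show ?thesis using cycle_edge_in_curve[of d U] cycle_edge_in_curve[of d "nbr d U"] by auto
  qed
  then have "closed_one_form.potential ?\<omega> T = 0" "closed_one_form.potential ?\<omega> (nbr c T) = 0"
    using potential_zero_outside[OF form] \<open>\<not> (T \<in> S \<or> nbr c T \<in> S)\<close> by blast+
  moreover have "tri_arc c (nbr c T) \<notin> cycle_arcs vs"
    using cycle_arcs_antisym[OF distinct_cycle length_cycle] arc by (simp add: tri_arc_def)
  then have "?\<omega> T c = - 1" using arc by (simp add: flow_def)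
  ultimately show False using closed_one_form.potential_nbr[OF form, of c T] by simp
qed

lemma S_nonempty: "S \<noteq> {}"
proof -
  have "vs \<noteq> []" using length_cycle by auto
  then have "(vs ! 0, vs ! (Suc 0 mod length vs)) \<in> cycle_arcs vs" unfolding cycle_arcs_nth by blast
  moreover from this obtain c T where "(vs ! 0, vs ! (Suc 0 mod length vs)) = tri_arc c T"
    using cycle_arc_lattice lattice_arcE by metis
  ultimately show ?thesis using cycle_edge_borders_S[of c T] by auto
qed

lemma edge_in_G_iff: "edge c T \<in> edges G \<longleftrightarrow> T \<in> S \<or> nbr c T \<in> S"
proof
  assume "T \<in> S \<or> nbr c T \<in> S"
  then have "edge_segment (edge c T) \<subseteq> C \<union> inside C"
    using edge_segment_subset_closed_tri[of c T] edge_segment_subset_closed_tri[of c "nbr c T"]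
      closed_tri_in_region
    by auto
  then show "edge c T \<in> edges G" by (simp add: edges_G edge_in_lattice)
next
  assume "edge c T \<in> edges G"
  then have "mid c T \<in> C \<union> inside C" using mid_in_edge_segment[of c T] by (auto simp: edges_G)
  then show "T \<in> S \<or> nbr c T \<in> S"
  proof
    assume "mid c T \<in> C"
    then obtain c' T'
      where arc: "tri_arc c' T' \<in> cycle_arcs vs" "mid c T \<in> edge_segment (edge c' T')"
      by (rule in_curveE)
    have "edge c T = edge c' T'" using mid_in_edge_segment_imp_eq[OF arc(2)] by simp
    then have "c' = c \<and> (T' = T \<or> T' = nbr c T)" by (simp only: edge_eq_iff)
    then show ?thesis using cycle_edge_borders_S[OF arc(1)] by auto
  next
    assume "mid c T \<in> inside C"
    then show ?thesis
      using in_S_if_closed_meets_inside mid_in_edge_segment edge_segment_subset_closed_tri by blast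
  qed
qed

lemma arc_in_GE:
  assumes "{u, v} \<in> edges G"
  obtains c T where "(u, v) = tri_arc c T" "T \<in> S \<or> nbr c T \<in> S"
proof -
  have "{u, v} \<in> lattice_edges" using assms by (simp add: edges_G)
  then obtain c T where "(u, v) = tri_arc c T" by (rule lattice_arcE)
  then show thesis using that edge_in_G_iff[of c T] assms by (simp add: edge_def tri_arc_def)
qed

subsection \<open>Orientations and height functions\<close>

text \<open>The higher triangle lies to the left of an arc.\<close>

definition orient :: "height \<Rightarrow> orientation" where
  "orient h = {tri_arc c T | c T. h T = h (nbr c T) + 1}"

lemma tri_arc_in_orient_iff [simp]: "tri_arc c T \<in> orient h \<longleftrightarrow> h T = h (nbr c T) + 1"
  by (auto simp: orient_def)

definition tri_arcs :: "(vertex \<times> vertex) set" where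
  "tri_arcs = {tri_arc c T | c T. True}"

lemma orient_subset_tri_arcs: "orient h \<subseteq> tri_arcs"
  unfolding orient_def tri_arcs_def by blast

lemma tri_arcs_eqI:
  assumes "X \<subseteq> tri_arcs" "Y \<subseteq> tri_arcs"
    and "\<And>c T. tri_arc c T \<in> X \<longleftrightarrow> tri_arc c T \<in> Y"
  shows "X = Y"
  using assms unfolding tri_arcs_def by blast

lemma orient_edge:
  assumes h: "h \<in> heights" and uv: "(u, v) \<in> orient h"
  shows "{u, v} \<in> edges G"
proof -
  obtain c T where arc: "(u, v) = tri_arc c T" "h T = h (nbr c T) + 1"
    using uv unfolding orient_def by auto
  then have "T \<in> S \<or> nbr c T \<in> S"
    using heights_zero[OF h, of T] heights_zero[OF h, of "nbr c T"] by fastforce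
  moreover have "{u, v} = edge c T" using arc(1) by (simp add: edge_eq_iff_tri_arc)
  ultimately show ?thesis using edge_in_G_iff by simp
qed

lemma flow_orient:
  assumes h: "h \<in> heights"
  shows "flow (orient h) T c = h (nbr c T) - h T"
proof -
  have "h (nbr c T) = h T - 1 \<or> h (nbr c T) = h T \<or> h (nbr c T) = h T + 1"
    using heights_lipschitz[OF h, of c T] by linarith
  then show ?thesis unfolding flow_def by (elim disjE) simp_all
qed

lemma circulation_gradient: "circulation (\<lambda>T c. h (nbr c T) - h T) v = (0 :: 'a :: ab_group_add)"
  by (cases v) (simp add: circulation_eq)

lemma orient_EO:
  assumes h: "h \<in> heights"
  shows "orient h \<in> EO G"
  unfolding EO_def orientations_def
proof (intro CollectI conjI ballI allI impI)
  fix p assume "p \<in> orient h"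
  then show "case p of (u, v) \<Rightarrow> {u, v} \<in> edges G" using orient_edge[OF h] by (cases p) auto
next
  fix u v assume "{u, v} \<in> edges G"
  then obtain c T where arc: "(u, v) = tri_arc c T" "T \<in> S \<or> nbr c T \<in> S" by (rule arc_in_GE)
  have reversed: "(v, u) = tri_arc c (nbr c T)" using arc(1) by (metis swap_simp tri_arc_nbr)
  have "h (nbr c T) = h T + 1 \<or> h (nbr c T) = h T - 1"
    using arc(2) heights_step[OF h, of T c] heights_step[OF h, of "nbr c T" c] by auto
  then show "((u, v) \<in> orient h) \<noteq> ((v, u) \<in> orient h)"
    unfolding arc(1) reversed tri_arc_in_orient_iff nbr_nbr by presburger
next
  fix v :: vertex
  have "{a, b} \<in> lattice_edges" if "(a, b) \<in> orient h" for a b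
    using orient_edge[OF h that] by (simp add: edges_G)
  then have "int (card {u. (u, v) \<in> orient h}) - int (card {w. (v, w) \<in> orient h})
      = circulation (flow (orient h)) v"
    by (intro circulation_flow[symmetric])
  also have "flow (orient h) = (\<lambda>T c. h (nbr c T) - h T)" using flow_orient[OF h] by blast
  finally show "card {u. (u, v) \<in> orient h} = card {w. (v, w) \<in> orient h}"
    by (simp add: circulation_gradient)
qed

definition arcs_G :: "(vertex \<times> vertex) set" where
  "arcs_G = {(u, v). {u, v} \<in> edges G}"

lemma arcs_G_subset:
  "arcs_G \<subseteq> case_prod tri_arc ` (UNIV \<times> S) \<union> prod.swap ` case_prod tri_arc ` (UNIV \<times> S)"
proof
  fix p assume "p \<in> arcs_G"
  then obtain u v where p: "p = (u, v)" "{u, v} \<in> edges G" by (auto simp: arcs_G_def)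
  then obtain c T where arc: "(u, v) = tri_arc c T" "T \<in> S \<or> nbr c T \<in> S" using arc_in_GE by metis
  have "tri_arc c T \<in> case_prod tri_arc ` (UNIV \<times> S)" if "T \<in> S" for c T
    using that by (intro image_eqI[of _ _ "(c, T)"]) auto
  moreover have "tri_arc c T = prod.swap (tri_arc c (nbr c T))" by (simp add: tri_arc_nbr)
  ultimately show "p \<in> case_prod tri_arc ` (UNIV \<times> S) \<union> prod.swap ` case_prod tri_arc ` (UNIV \<times> S)"
    unfolding p arc(1) using arc(2) by (metis UnI1 UnI2 imageI)
qed

lemma finite_arcs_G: "finite arcs_G"
  by (rule finite_subset[OF arcs_G_subset]) (simp add: finite_S)

lemma card_arcs_G: "card arcs_G \<le> 6 * card S"
proof -
  let ?A = "case_prod tri_arc ` ((UNIV :: colour set) \<times> S)"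
  have card_A: "card ?A \<le> 3 * card S"
    using card_image_le[of "(UNIV :: colour set) \<times> S" "case_prod tri_arc"] finite_S
    by (simp add: card_cartesian_product UNIV_colour)
  have "card arcs_G \<le> card (?A \<union> prod.swap ` ?A)"
    by (rule card_mono[OF _ arcs_G_subset]) (simp add: finite_S)
  also have "\<dots> \<le> card ?A + card (prod.swap ` ?A)" by (rule card_Un_le)
  also have "\<dots> \<le> card ?A + card ?A" by (intro add_left_mono card_image_le) (simp add: finite_S)
  finally show ?thesis using card_A by linarith
qed

lemma EO_edge: "X \<in> EO G \<Longrightarrow> (u, v) \<in> X \<Longrightarrow> {u, v} \<in> edges G"
  by (auto simp: EO_def orientations_def)

lemma EO_lattice: "X \<in> EO G \<Longrightarrow> (u, v) \<in> X \<Longrightarrow> {u, v} \<in> lattice_edges"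
  using EO_edge by (simp add: edges_G)

lemma EO_subset_arcs_G: "X \<in> EO G \<Longrightarrow> X \<subseteq> arcs_G"
  unfolding arcs_G_def using EO_edge by auto

lemma EO_exactly_one:
  assumes "X \<in> EO G" "edge c T \<in> edges G"
  shows "tri_arc c (nbr c T) \<in> X \<longleftrightarrow> tri_arc c T \<notin> X"
proof -
  have "((src c T, tgt c T) \<in> X) \<noteq> ((tgt c T, src c T) \<in> X)"
    using assms unfolding EO_def orientations_def edge_def by blast
  then show ?thesis by (auto simp: tri_arc_def)
qed

lemma EO_balanced:
  assumes X: "X \<in> EO G"
  shows "card {u. (u, v) \<in> X} = card {w. (v, w) \<in> X}"
proof (cases "v \<in> verts G")
  case True
  then show ?thesis using X by (simp add: EO_def)
next
  case False
  then have "{u. (u, v) \<in> X} = {}" "{w. (v, w) \<in> X} = {}"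
    using EO_edge[OF X] edge_endpoint by blast+
  then show ?thesis by (simp only:)
qed

lemma flow_EO:
  assumes X: "X \<in> EO G"
  shows "flow X T c = (if edge c T \<in> edges G then if tri_arc c T \<in> X then - 1 else 1 else 0)"
proof (cases "edge c T \<in> edges G")
  case True
  then show ?thesis using EO_exactly_one[OF X True] by (simp add: flow_def)
next
  case False
  then have "tri_arc c T \<notin> X" "tri_arc c (nbr c T) \<notin> X"
    using EO_edge[OF X, of "src c T" "tgt c T"] EO_edge[OF X, of "tgt c T" "src c T"]
    by (auto simp: tri_arc_def edge_def insert_commute)
  then show ?thesis using False by (simp add: flow_def)
qed

lemma closed_one_form_flow_EO: "X \<in> EO G \<Longrightarrow> closed_one_form (flow X)"
  using finite_subset[OF EO_subset_arcs_G finite_arcs_G] EO_lattice EO_balanced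
  by (intro closed_one_form_flow)

definition height_of :: "orientation \<Rightarrow> height" where
  "height_of X = closed_one_form.potential (flow X)"

lemma height_of_nbr: "X \<in> EO G \<Longrightarrow> height_of X (nbr c T) = height_of X T + flow X T c"
  unfolding height_of_def by (rule closed_one_form.potential_nbr[OF closed_one_form_flow_EO])

lemma height_of_heights:
  assumes X: "X \<in> EO G"
  shows "height_of X \<in> heights"
  unfolding heights_def
proof (intro CollectI conjI allI impI ballI)
  fix T assume "T \<notin> S"
  then show "height_of X T = 0"
    unfolding height_of_def using closed_one_form_flow_EO[OF X]
    by (intro potential_zero_outside) (auto simp: flow_EO[OF X] edges_G split: if_splits)
next
  fix T c assume "T \<in> S"
  then have "edge c T \<in> edges G" using edge_in_G_iff by blast
  then show "\<bar>height_of X (nbr c T) - height_of X T\<bar> = 1"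
    by (simp add: height_of_nbr[OF X] flow_EO[OF X])
qed

lemma orient_height_of:
  assumes X: "X \<in> EO G"
  shows "orient (height_of X) = X"
proof (rule tri_arcs_eqI[OF orient_subset_tri_arcs])
  show "X \<subseteq> tri_arcs"
  proof
    fix p assume "p \<in> X"
    then obtain c T where "p = tri_arc c T" using EO_lattice[OF X] lattice_arcE by (metis surj_pair)
    then show "p \<in> tri_arcs" unfolding tri_arcs_def by blast
  qed
  fix c T
  have "edge c T \<in> edges G" if "tri_arc c T \<in> X"
    using that EO_edge[OF X] by (simp add: tri_arc_def edge_def)
  then show "tri_arc c T \<in> orient (height_of X) \<longleftrightarrow> tri_arc c T \<in> X"
    by (auto simp: height_of_nbr[OF X] flow_EO[OF X])
qed

lemma inj_on_orient: "inj_on orient heights"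
proof (rule inj_onI)
  fix g h assume g: "g \<in> heights" and h: "h \<in> heights" and eq: "orient g = orient h"
  have "{T. g T \<noteq> h T} = {}"
  proof (rule nbr_closed_subset_empty)
    show "{T. g T \<noteq> h T} \<subseteq> S" using heights_neq_in_S[OF g h] by blast
    fix T c assume "T \<in> {T. g T \<noteq> h T}"
    then show "nbr c T \<in> {T. g T \<noteq> h T}"
      using flow_orient[OF g, of T c] flow_orient[OF h, of T c] eq by simp
  qed
  then show "g = h" by auto
qed

lemma bij_betw_orient: "bij_betw orient heights (EO G)"
  unfolding bij_betw_def
proof (intro conjI inj_on_orient equalityI subsetI)
  show "X \<in> EO G" if "X \<in> orient ` heights" for X using that orient_EO by blast
  show "X \<in> orient ` heights" if "X \<in> EO G" for X
    using orient_height_of[OF that] height_of_heights[OF that] by (metis imageI)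
qed

subsection \<open>Eulerian graphs have height functions\<close>

definition edge_form :: "tri \<Rightarrow> colour \<Rightarrow> bit" where
  "edge_form T c = of_bool (edge c T \<in> edges G)"

lemma degree_eq: "degree G v = (\<Sum>(c, T)\<in>outgoing v. of_bool (edge c T \<in> edges G))"
proof -
  have "{e \<in> edges G. v \<in> e} = (\<lambda>w. {v, w}) ` {w. {v, w} \<in> edges G}"
  proof (intro equalityI subsetI)
    fix e assume e: "e \<in> {e \<in> edges G. v \<in> e}"
    then obtain c T where "e = edge c T" by (auto simp: edges_G elim: lattice_edgeE)
    then have "e = {v, tgt c T} \<or> e = {v, src c T}" using e by (auto simp: edge_def)
    then show "e \<in> (\<lambda>w. {v, w}) ` {w. {v, w} \<in> edges G}" using e by blast
  qed auto
  moreover have "inj_on (\<lambda>w. {v, w}) {w. {v, w} \<in> edges G}"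
    by (auto intro!: inj_onI simp: doubleton_eq_iff)
  ultimately have "degree G v = card {w. {v, w} \<in> edges G}"
    by (simp add: degree_def card_image)
  also have "\<dots> = (\<Sum>(c, T)\<in>outgoing v. of_bool ({v, tgt c T} \<in> edges G))"
    by (rule card_lattice_nbrs) (simp add: edges_G)
  also have "\<dots> = (\<Sum>(c, T)\<in>outgoing v. of_bool (edge c T \<in> edges G))"
    by (intro sum.cong refl) (auto simp: outgoing_def edge_def)
  finally show ?thesis .
qed

lemma even_degree:
  assumes "eulerian G"
  shows "even (degree G v)"
proof (cases "v \<in> verts G")
  case True
  then show ?thesis using assms by (simp add: eulerian_def)
next
  case False
  then have "{e \<in> edges G. v \<in> e} = {}" using edge_endpoint by blast
  then show ?thesis by (simp only: degree_def card.empty even_zero)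
qed

lemma closed_one_form_edge_form:
  assumes "eulerian G"
  shows "closed_one_form edge_form"
proof
  show "edge_form (nbr c T) c = - edge_form T c" for T c by (simp add: edge_form_def)
  fix v
  have "circulation edge_form v = of_nat (degree G v)"
    by (simp add: circulation_def edge_form_def degree_eq split_def)
  then show "circulation edge_form v = 0" using even_degree[OF assms, of v] by (auto elim!: evenE)
next
  have "{T. \<exists>c. edge_form T c \<noteq> 0} \<subseteq> S \<union> (\<Union>c. nbr c ` S)"
  proof
    fix T assume "T \<in> {T. \<exists>c. edge_form T c \<noteq> 0}"
    then obtain c where "T \<in> S \<or> nbr c T \<in> S" using edge_in_G_iff by (auto simp: edge_form_def)
    then show "T \<in> S \<union> (\<Union>c. nbr c ` S)" by (metis UNIV_I UN_I UnI1 UnI2 imageI nbr_nbr)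
  qed
  then show "finite {T. \<exists>c. edge_form T c \<noteq> 0}" by (rule finite_subset) (simp add: finite_S)
qed

lemma heights_nonempty:
  assumes "eulerian G"
  shows "heights \<noteq> {}"
proof -
  let ?p = "closed_one_form.potential edge_form"
  note form = closed_one_form_edge_form[OF assms]
  have "(\<lambda>T. if ?p T = 0 then 0 else 1) \<in> heights"
    unfolding heights_def
  proof (intro CollectI conjI allI impI ballI)
    fix T assume "T \<notin> S"
    with form have "?p T = 0" by (intro potential_zero_outside) (auto simp: edge_form_def edges_G)
    then show "(if ?p T = 0 then 0 else 1 :: int) = 0" by simp
  next
    fix T c assume "T \<in> S"
    then have "?p (nbr c T) = ?p T + 1"
      using edge_in_G_iff closed_one_form.potential_nbr[OF form, of c T]
      by (simp add: edge_form_def)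
    then show "\<bar>(if ?p (nbr c T) = 0 then 0 else 1) - (if ?p T = 0 then 0 else 1)\<bar> = (1::int)"
      by (cases "?p T") auto
  qed
  then show ?thesis by blast
qed

subsection \<open>Bounded faces\<close>

lemma drawing_subset_region: "drawing G \<subseteq> C \<union> inside C"
  unfolding drawing_def using verts_G edges_G by blast

lemma edge_subset_drawing: "e \<in> edges G \<Longrightarrow> edge_segment e \<subseteq> drawing G"
  unfolding drawing_def by blast

lemma curve_subset_drawing: "C \<subseteq> drawing G"
proof
  fix z assume "z \<in> C"
  then obtain c T where arc: "tri_arc c T \<in> cycle_arcs vs" "z \<in> edge_segment (edge c T)"
    by (rule in_curveE)
  then have "edge c T \<in> edges G" using cycle_edge_borders_S edge_in_G_iff by simp
  then show "z \<in> drawing G" using edge_subset_drawing arc(2) by blast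
qed

lemma open_tri_disjoint_drawing: "open_tri T \<inter> drawing G = {}"
proof -
  have "open_tri T \<inter> edge_segment e = {}" if "e \<in> edges G" for e
    using that open_tri_disjoint_edge by (auto simp: edges_G elim!: lattice_edgeE)
  moreover have "embed v \<notin> open_tri T" for v
    using embed_in_edge[of v] open_tri_disjoint_edge by blast
  ultimately show ?thesis unfolding drawing_def by blast
qed

lemma closed_tri_in_drawing_or_open:
  assumes "T \<in> S" "z \<in> closed_tri T" "z \<notin> drawing G"
  shows "z \<in> open_tri T"
proof (rule ccontr)
  assume "z \<notin> open_tri T"
  then obtain c where "z \<in> edge_segment (edge c T)" using closed_tri_boundary assms(2) by blast
  moreover have "edge c T \<in> edges G" using assms(1) edge_in_G_iff by blast
  ultimately show False using edge_subset_drawing assms(3) by blast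
qed

lemma open_tri_component:
  assumes T: "T \<in> S"
  shows "open_tri T \<in> components (- drawing G)"
  unfolding in_components_maximal
proof (intro conjI allI impI)
  show "open_tri T \<noteq> {}" using centroid_in_open_tri by blast
  show "open_tri T \<subseteq> - drawing G" using open_tri_disjoint_drawing by blast
  show "connected (open_tri T)" by (rule connected_open_tri)
  fix D assume D: "D \<noteq> {} \<and> open_tri T \<subseteq> D \<and> D \<subseteq> - drawing G \<and> connected D"
  show "D = open_tri T"
  proof (rule ccontr)
    assume "D \<noteq> open_tri T"
    then have "D \<inter> frontier (open_tri T) \<noteq> {}"
      using D centroid_in_open_tri[of T] by (intro connected_Int_frontier) auto
    then obtain z where "z \<in> D" "z \<in> closed_tri T" "z \<notin> open_tri T" unfolding frontier_open_tri
      by blast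
    then show False using closed_tri_in_drawing_or_open[OF T] D by blast
  qed
qed

lemma other_component_outside:
  assumes F: "F \<in> components (- drawing G)" and other: "F \<notin> open_tri ` S"
  shows "F \<subseteq> outside C"
proof
  fix z assume z: "z \<in> F"
  then have not_drawn: "z \<notin> drawing G" using in_components_subset[OF F] by blast
  show "z \<in> outside C"
  proof (rule ccontr)
    assume "z \<notin> outside C"
    then have "z \<in> C \<union> inside C" by (simp add: union_with_inside)
    then have "z \<in> inside C" using curve_subset_drawing not_drawn by blast
    then have T: "tri_at z \<in> S" using in_S_if_closed_meets_inside[OF in_closed_tri_at] by blast
    then have "z \<in> open_tri (tri_at z)"
      using closed_tri_in_drawing_or_open in_closed_tri_at not_drawn by blast
    then show False using components_nonoverlap[OF F open_tri_component[OF T]] other T z by blast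
  qed
qed

lemma bounded_faces_G: "bounded_faces G = open_tri ` S"
proof (intro equalityI subsetI)
  fix F assume "F \<in> open_tri ` S"
  then obtain T where T: "T \<in> S" "F = open_tri T" by blast
  have "bounded (open_tri T)"
    using T bounded_inside[OF bounded_curve] bounded_subset by (auto simp: S_def)
  then show "F \<in> bounded_faces G" using T open_tri_component by (simp add: bounded_faces_def)
next
  fix F assume "F \<in> bounded_faces G"
  then have F: "F \<in> components (- drawing G)" "bounded F" by (auto simp: bounded_faces_def)
  show "F \<in> open_tri ` S"
  proof (rule ccontr)
    assume "F \<notin> open_tri ` S"
    then have "F \<subseteq> outside C" by (rule other_component_outside[OF F(1)])
    moreover have "outside C \<subseteq> - drawing G"
      using drawing_subset_region by (auto simp: union_with_inside)
    moreover have "F \<noteq> {}" using in_components_nonempty[OF F(1)] .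
    ultimately have "outside C \<subseteq> F"
      using connected_outside_curve by (intro components_maximal[OF F(1)]) auto
    then show False using F(2) bounded_subset unbounded_outside[OF bounded_curve] by blast
  qed
qed

lemma card_bounded_faces: "card (bounded_faces G) = card S"
  unfolding bounded_faces_G by (rule card_image) (rule inj_on_subset[OF inj_open_tri subset_UNIV])

lemma face_edges_open_tri:
  assumes T: "T \<in> S"
  shows "face_edges G (open_tri T) = range (\<lambda>c. edge c T)"
proof (intro equalityI subsetI)
  fix e assume "e \<in> face_edges G (open_tri T)"
  then have e: "e \<in> lattice_edges" "edge_segment e \<subseteq> closed_tri T"
    by (auto simp: face_edges_def edges_G frontier_open_tri)
  obtain c U where U: "e = edge c U" using e(1) by (rule lattice_edgeE)
  then have "mid c U \<in> closed_tri T" using e(2) mid_in_edge_segment by blast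
  then have "T = U \<or> T = nbr c U" by (rule mid_in_closed_tri)
  then show "e \<in> range (\<lambda>c. edge c T)" using U by (metis edge_nbr rangeI)
next
  fix e assume "e \<in> range (\<lambda>c. edge c T)"
  then obtain c where "e = edge c T" by blast
  then show "e \<in> face_edges G (open_tri T)"
    using T edge_in_G_iff edge_segment_subset_closed_tri[of c T] open_tri_disjoint_edge[of T c T]
    by (auto simp: face_edges_def frontier_open_tri)
qed

lemma in_face_arcs_iff:
  assumes "T \<in> S"
  shows "p \<in> face_arcs G X (open_tri T) \<longleftrightarrow> p \<in> X \<and> (\<exists>c. p = tri_arc c T \<or> p = tri_arc c (nbr c T))"
  unfolding face_arcs_def face_edges_open_tri[OF assms]
  by (cases p) (auto simp: image_iff edge_eq_iff_tri_arc)

lemma tri_arc_in_face_arcs_iff: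
  assumes "T \<in> S"
  shows "tri_arc c U \<in> face_arcs G X (open_tri T) \<longleftrightarrow> tri_arc c U \<in> X \<and> (U = T \<or> nbr c U = T)"
  unfolding in_face_arcs_iff[OF assms] by (auto simp: nbr_eq_iff_eq_nbr)

subsection \<open>Face reversals are flips\<close>

lemma tri_arc_in_reverse_face_iff:
  assumes "T \<in> S"
  shows "tri_arc c U \<in> reverse_face G X (open_tri T) \<longleftrightarrow>
    (if U = T \<or> nbr c U = T then tri_arc c (nbr c U) \<in> X else tri_arc c U \<in> X)"
proof -
  have "tri_arc c U \<in> (face_arcs G X (open_tri T))\<inverse>
      \<longleftrightarrow> tri_arc c (nbr c U) \<in> face_arcs G X (open_tri T)"
    by (simp add: tri_arc_def)
  then show ?thesis unfolding reverse_face_def Un_iff Diff_iff tri_arc_in_face_arcs_iff[OF assms]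
    by auto
qed

lemma reverse_face_subset_tri_arcs:
  assumes T: "T \<in> S" and X: "X \<subseteq> tri_arcs"
  shows "reverse_face G X (open_tri T) \<subseteq> tri_arcs"
proof
  fix p assume "p \<in> reverse_face G X (open_tri T)"
  then consider (kept) "p \<in> X" | (reversed) "prod.swap p \<in> face_arcs G X (open_tri T)"
    by (cases p) (auto simp: reverse_face_def)
  then show "p \<in> tri_arcs"
  proof cases
    case kept
    then show ?thesis using X by blast
  next
    case reversed
    then obtain c U where "prod.swap p = tri_arc c U" using in_face_arcs_iff[OF T] by blast
    then have "p = tri_arc c (nbr c U)" by (metis swap_swap tri_arc_nbr)
    then show ?thesis unfolding tri_arcs_def by blast
  qed
qed

lemma reverse_face_orient:
  assumes T: "T \<in> S" and s: "s \<in> signs" and ext: "local_extremum s h T"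
  shows "reverse_face G (orient h) (open_tri T) = orient (h(T := h T - 2 * s))"
proof (rule tri_arcs_eqI[OF reverse_face_subset_tri_arcs[OF T orient_subset_tri_arcs] orient_subset_tri_arcs])
  fix c U
  consider "U = T" | "U = nbr c T" | "U \<noteq> T" "nbr c U \<noteq> T" using nbr_eq_iff_eq_nbr by blast
  then show "tri_arc c U \<in> reverse_face G (orient h) (open_tri T)
      \<longleftrightarrow> tri_arc c U \<in> orient (h(T := h T - 2 * s))"
    unfolding tri_arc_in_reverse_face_iff[OF T] using local_extremumD[OF ext, of c] s by cases auto
qed

fun next_colour :: "colour \<Rightarrow> colour" where
  "next_colour Blue = Red" | "next_colour Red = Green" | "next_colour Green = Blue"

lemma tgt_eq_src_next: "tgt c T = src (next_colour c) T"
  by (cases T; cases c) auto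

lemma src_eq_iff: "src c T = src d T \<longleftrightarrow> c = d"
  by (cases T; cases c; cases d) auto

lemma cycle_around_tri:
  "range (\<lambda>c. tri_arc c T) = cycle_arcs [src Blue T, src Red T, src Green T]"
  "range (\<lambda>c. tri_arc c (nbr c T)) = cycle_arcs [src Blue T, src Green T, src Red T]"
  by (cases T; auto simp: UNIV_colour cycle_arcs_def tri_arc_def)+

lemma directed_face_extremum:
  assumes T: "T \<in> S" and s: "s \<in> signs" and ext: "local_extremum s h T"
  shows "directed_face G (orient h) (open_tri T)"
proof -
  let ?A = "face_arcs G (orient h) (open_tri T)"
  have "?A = (if s = 1 then range (\<lambda>c. tri_arc c T) else range (\<lambda>c. tri_arc c (nbr c T)))"
    using s local_extremumD[OF ext] by (auto simp: in_face_arcs_iff[OF T])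
  then have "?A = cycle_arcs [src Blue T, src Red T, src Green T]
      \<or> ?A = cycle_arcs [src Blue T, src Green T, src Red T]"
    by (simp add: cycle_around_tri)
  moreover have "distinct [src Blue T, src Red T, src Green T]"
    "distinct [src Blue T, src Green T, src Red T]"
    by (simp_all add: src_eq_iff)
  moreover have "3 \<le> length [src Blue T, src Red T, src Green T]"
    "3 \<le> length [src Blue T, src Green T, src Red T]"
    by simp_all
  ultimately show ?thesis unfolding directed_face_def by blast
qed

lemma extremum_if_directed_face:
  assumes h: "h \<in> heights" and T: "T \<in> S" and directed: "directed_face G (orient h) (open_tri T)"
  shows "local_extremum 1 h T \<or> local_extremum (- 1) h T"
proof (rule ccontr)
  assume no_extremum: "\<not> (local_extremum 1 h T \<or> local_extremum (- 1) h T)"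
  obtain ws where ws: "distinct ws" "face_arcs G (orient h) (open_tri T) = cycle_arcs ws"
    using directed by (auto simp: directed_face_def)
  have "\<exists>c. h (nbr c T) = h T - 1 \<and> h (nbr (next_colour c) T) = h T + 1"
  proof (rule ccontr)
    assume no_change: "\<not> ?thesis"
    have down_next: "h (nbr (next_colour c) T) = h T - 1" if "h (nbr c T) = h T - 1" for c
      using no_change that heights_step[OF h T, of "next_colour c"] by blast
    obtain c where "h (nbr c T) \<noteq> h T + 1" using no_extremum by (auto simp: local_extremum_def)
    then have down: "h (nbr c T) = h T - 1" using heights_step[OF h T] by blast
    have "h (nbr d T) = h T - 1" for d
    proof -
      have "d = c \<or> d = next_colour c \<or> d = next_colour (next_colour c)"
        by (cases c; cases d) simp_all
      then show ?thesis using down down_next by blast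
    qed
    then show False using no_extremum by (simp add: local_extremum_def)
  qed
  then obtain c where down: "h (nbr c T) = h T - 1" and up: "h (nbr (next_colour c) T) = h T + 1"
    by blast
  have "tri_arc c T \<in> cycle_arcs ws"
    "tri_arc (next_colour c) (nbr (next_colour c) T) \<in> cycle_arcs ws"
    unfolding ws(2)[symmetric] tri_arc_in_face_arcs_iff[OF T] using down up by simp_all
  then have "src c T = tgt (next_colour c) T"
    using cycle_arcs_predecessor_unique[OF ws(1), of "src c T" "tgt c T" "tgt (next_colour c) T"]
    by (simp add: tri_arc_def tgt_eq_src_next[of c T])
  then have "c = next_colour (next_colour c)" by (simp add: tgt_eq_src_next src_eq_iff)
  then show False by (cases c) auto
qed

definition face_flip :: "complex set \<Rightarrow> orientation \<Rightarrow> orientation" where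
  "face_flip F X = (if directed_face G X F then reverse_face G X F else X)"

lemma face_flip_orient:
  assumes h: "h \<in> heights" and T: "T \<in> S"
  shows "face_flip (open_tri T) (orient h) = orient (flip_at T h)"
proof (cases rule: flip_at_cases[of h T])
  case (extremum s)
  then show ?thesis
    using directed_face_extremum[OF T] reverse_face_orient[OF T] by (simp add: face_flip_def)
next
  case fixed
  then show ?thesis using extremum_if_directed_face[OF h T] by (auto simp: face_flip_def)
qed

end

section \<open>The mixing time of the face-reversal chain\<close>

context solid
begin

lemma finite_EO: "finite (EO G)"
  using bij_betw_finite[OF bij_betw_orient] finite_heights by simp

lemma sum_EO: "(\<Sum>X\<in>EO G. \<phi> X) = (\<Sum>h\<in>heights. \<phi> (orient h))"
  using sum.reindex_bij_betw[OF bij_betw_orient, of \<phi>] by simp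

sublocale face: lazy_involution_chain "EO G" "bounded_faces G" face_flip "face_step G"
proof
  show "finite (EO G)" by (rule finite_EO)
  show "finite (bounded_faces G)" "bounded_faces G \<noteq> {}"
    using finite_S S_nonempty by (simp_all add: bounded_faces_G)
  show "face_step G X = bind_pmf (bernoulli_pmf (1 / 2))
      (\<lambda>stay. if stay then return_pmf X else map_pmf (\<lambda>F. face_flip F X) (pmf_of_set (bounded_faces G)))" for X
    unfolding face_step_def face_flip_def by (rule refl)
  fix F X assume "F \<in> bounded_faces G" "X \<in> EO G"
  then obtain T h where "T \<in> S" "F = open_tri T" "h \<in> heights" "X = orient h"
    using bounded_faces_G orient_height_of height_of_heights by (metis imageE)
  then show "face_flip F X \<in> EO G" "face_flip F (face_flip F X) = X"
    by (simp_all add: face_flip_orient orient_EO flip_at_heights flip_at_flip_at)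
qed

lemma face_dirichlet: "face.dirichlet g = flip.dirichlet (\<lambda>h. g (orient h))"
proof -
  have "face.dirichlet g =
      (\<Sum>X\<in>EO G. \<Sum>F\<in>bounded_faces G. (g X - g (face_flip F X))\<^sup>2) / (4 * card (bounded_faces G))"
    unfolding face.dirichlet_def by simp
  also have "(\<Sum>X\<in>EO G. \<Sum>F\<in>bounded_faces G. (g X - g (face_flip F X))\<^sup>2)
      = (\<Sum>X\<in>EO G. \<Sum>T\<in>S. (g X - g (face_flip (open_tri T) X))\<^sup>2)"
    unfolding bounded_faces_G by (subst sum.reindex) (auto intro: inj_on_subset[OF inj_open_tri])
  also have "\<dots> = (\<Sum>h\<in>heights. \<Sum>T\<in>S. (g (orient h) - g (orient (flip_at T h)))\<^sup>2)"
    unfolding sum_EO by (intro sum.cong refl) (simp add: face_flip_orient)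
  finally show ?thesis
    unfolding flip.dirichlet_def card_bounded_faces by simp
qed

lemma face_spectral_gap: "face.spectral_gap (1 / (93312 * real (card (bounded_faces G)) ^ 5))"
  using flip.spectral_gapD[OF flip_spectral_gap[OF S_nonempty]]
  unfolding face.spectral_gap_def face_dirichlet sum_EO by (simp add: card_bounded_faces)

lemma ln_card_EO_le: "ln (card (EO G)) \<le> 6 * card (bounded_faces G)"
proof (cases "EO G = {}")
  case False
  then have pos: "0 < card (EO G)" using finite_EO by (simp add: card_gt_0_iff)
  have "card (EO G) \<le> card (Pow arcs_G)"
    using EO_subset_arcs_G finite_arcs_G by (intro card_mono) auto
  also have "\<dots> \<le> 2 ^ (6 * card S)"
    using card_arcs_G finite_arcs_G by (simp add: card_Pow)
  finally have "real (card (EO G)) \<le> 2 ^ (6 * card S)"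
    by (metis of_nat_le_iff of_nat_numeral of_nat_power)
  then have "ln (card (EO G)) \<le> ln (2 ^ (6 * card S) :: real)"
    using pos by (intro ln_mono) simp_all
  also have "\<dots> = 6 * card S * ln 2" by (simp add: ln_realpow)
  also have "\<dots> \<le> real (6 * card S) * 1" using ln_2_less_1 by (intro mult_left_mono) auto
  finally show ?thesis by (simp add: card_bounded_faces)
qed simp

theorem face_mixing_time_le:
  assumes eulerian: "eulerian G" and \<epsilon>: "0 < \<epsilon>" "\<epsilon> < 1"
  shows "real (face_mixing_time G \<epsilon>)
      \<le> 746497 * real (card (bounded_faces G)) ^ 6 * real_of_int \<lceil>ln (1 / \<epsilon>)\<rceil>"
proof -
  define f where "f = real (card (bounded_faces G))"
  define l where "l = real_of_int \<lceil>ln (1 / \<epsilon>)\<rceil>"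
  have f: "1 \<le> f" using face.card_moves_pos by (simp add: f_def)
  have "0 < ln (1 / \<epsilon>)" using \<epsilon> by simp
  then have l: "1 \<le> l" "ln (1 / \<epsilon>) \<le> l" unfolding l_def by (simp_all add: one_le_ceiling)
  have "EO G \<noteq> {}" using heights_nonempty[OF eulerian] orient_EO by blast
  then have "real (face_mixing_time G \<epsilon>)
      \<le> (ln (card (EO G)) + 2 * ln (1 / \<epsilon>)) / (1 / (93312 * f ^ 5)) + 1"
    unfolding face_mixing_time_def f_def using f \<epsilon>
    by (intro face.mixing_time_le face_spectral_gap) (simp_all add: f_def)
  also have "\<dots> = 93312 * f ^ 5 * (ln (card (EO G)) + 2 * ln (1 / \<epsilon>)) + 1" by simp
  also have "\<dots> \<le> 93312 * f ^ 5 * (8 * (f * l)) + f ^ 6 * l"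
  proof (intro add_mono mult_left_mono)
    have "f * 1 \<le> f * l" "1 * l \<le> f * l" using f l by (auto intro!: mult_left_mono mult_right_mono)
    then show "ln (card (EO G)) + 2 * ln (1 / \<epsilon>) \<le> 8 * (f * l)"
      using ln_card_EO_le l unfolding f_def by linarith
    have "1 * 1 \<le> f ^ 6 * l" using f l by (intro mult_mono) auto
    then show "1 \<le> f ^ 6 * l" by simp
  qed (use f in simp)
  also have "\<dots> = 746497 * f ^ 6 * l" by (simp add: power_numeral_reduce algebra_simps)
  finally show ?thesis by (simp only: f_def l_def)
qed

end

theorem theorem11:
  shows "\<exists>c::real. c > 0 \<and>
    (\<forall>(G::graph) (\<epsilon>::real).
       solid_subgraph G \<longrightarrow> eulerian G \<longrightarrow> 0 < \<epsilon> \<longrightarrow> \<epsilon> < 1 \<longrightarrow>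
       real (face_mixing_time G \<epsilon>) \<le>
         c * real (card (bounded_faces G)) ^ 6 * real_of_int \<lceil>ln (1 / \<epsilon>)\<rceil>)"
proof (intro exI[of _ 746497] conjI allI impI)
  fix G :: graph and \<epsilon> :: real
  assume "solid_subgraph G" "eulerian G" "0 < \<epsilon>" "\<epsilon> < 1"
  then obtain vs where "solid vs" "G = solid_graph vs" by (auto simp: solid_subgraph_def solid_def)
  then show "real (face_mixing_time G \<epsilon>) \<le>
      746497 * real (card (bounded_faces G)) ^ 6 * real_of_int \<lceil>ln (1 / \<epsilon>)\<rceil>"
    using solid.face_mixing_time_le \<open>eulerian G\<close> \<open>0 < \<epsilon>\<close> \<open>\<epsilon> < 1\<close> by blast
qed simp

end
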